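(* Let $A$ and $X$ be compact Hausdorff spaces with $A$ second countable, let $H$ be a separable Hilbert space, and let $\mu$ be a Borel probability measure on $X$. For any $\dot{E}\in\mathfrak{C}_\mu(A,X;H)$ there exists a unital completely positive map $\Phi_{\dot{E}}:C(A)\to L_\sigma^\infty(X,\mu,\mathcal{B}(H))$ such that for every $f\in C(A)$ and all $\xi,\eta\in H$ we have $$\langle\Phi_{\dot{E}}(f)(x)\xi,\eta\rangle=\int_A f(a)\,d\dot{E}_{\xi,\eta}(a|x),\qquad \mu\text{-a.e.}$$ Conversely, for any unital completely positive map $\Phi:C(A)\to L_\sigma^\infty(X,\mu,\mathcal{B}(H))$ there exists a unique $\dot{E}\in\mathfrak{C}_\mu(A,X;H)$ such that $\Phi=\Phi_{\dot{E}}$.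
   Context: $\mathfrak{A}_A$ denotes the Borel $\sigma$-algebra of $A$, $C(A)$ the C*-algebra of continuous complex functions on $A$, and $\mathcal{B}(H)$ the bounded operators on $H$, the dual of the trace class operators $\mathcal{T}(H)$. $Q(A;H)$ is the set of $\mathcal{B}(H)$-valued quantum probability measures on $A$: maps $E:\mathfrak{A}_A\to\mathcal{B}(H)$ such that $E(\delta)\ge 0$ for all $\delta\in\mathfrak{A}_A$, $E(\emptyset)=0$, $E(A)=I$, and $E(\bigcup_n\delta_n)=\sum_n E(\delta_n)$ in the strong operator topology for every countable family of pairwise disjoint $\delta_n\in\mathfrak{A}_A$. $\mathfrak{C}(A,X;H)$ is the set of $\mathcal{B}(H)$-valued information channels from $X$ to $A$: families $E=(E(\cdot|x))_{x\in X}$ in $Q(A;H)$ such that $x\mapsto\langle E(\alpha|x)\xi,\eta\rangle$ is Borel measurable for all $\alpha\in\mathfrak{A}_A$, $\xi,\eta\in H$. $E\sim_\mu F$ means: for every $\alpha\in\mathfrak{A}_A$, $E(\alpha|x)=F(\alpha|x)$ for $\mu$-almost every $x$. $\mathfrak{C}_\mu(A,X;H)$ is the set of $\sim_\mu$-equivalence classes; $\dot E$ denotes the class of $E$. The measure $\dot E_{\xi,\eta}(\cdot|x)$ is understood via a representative $E$ of $\dot E$: $E_{\xi,\eta}(\alpha|x)=\langle E(\alpha|x)\xi,\eta\rangle$; the displayed integral, as a function of $x$ up to $\mu$-a.e. equality, does not depend on the representative. $L_\sigma^\infty(X,\mu,\mathcal{B}(H))$ is the space of w$^*$-measurable functions $g:X\to\mathcal{B}(H)$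 (i.e. $x\mapsto\operatorname{Tr}(g(x)T)$ is measurable for all $T\in\mathcal{T}(H)$) with $\operatorname{ess\,sup}_{x}\|g(x)\|<\infty$, with functions identified when equal $\mu$-a.e.; it is a von Neumann algebra with pointwise product and involution and the essential supremum norm. *)

theory Defs
  imports "HOL-Probability.Probability" "HOL-Algebra.Module"
begin

section \<open>Complex Hilbert spaces and their bounded operators\<close>

text \<open>The inner product is linear in the first argument.  Positive definiteness is not listed:
  \<open>cinner x x\<close> is real by \<open>cinner_commute\<close>, and the remaining part follows from the last axiom,
  because \<open>norm\<close> is a norm and \<open>sqrt\<close> is negative on negative reals.\<close>

class complex_hilbert_space = banach +
  fixes scaleC :: "complex \<Rightarrow> 'a \<Rightarrow> 'a"
    and cinner :: "'a \<Rightarrow> 'a \<Rightarrow> complex"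
  assumes scaleC_add_right: "scaleC c (x + y) = scaleC c x + scaleC c y"
    and scaleC_add_left: "scaleC (c + d) x = scaleC c x + scaleC d x"
    and scaleC_scaleC: "scaleC c (scaleC d x) = scaleC (c * d) x"
    and scaleC_of_real: "scaleC (complex_of_real r) x = scaleR r x"
    and cinner_add_left: "cinner (x + y) z = cinner x z + cinner y z"
    and cinner_scaleC_left: "cinner (scaleC c x) y = c * cinner x y"
    and cinner_commute: "cinner x y = cnj (cinner y x)"
    and norm_eq_sqrt_cinner: "norm x = sqrt (Re (cinner x x))"

instantiation complex :: complex_hilbert_space
begin

definition scaleC_complex :: "complex \<Rightarrow> complex \<Rightarrow> complex"
  where "scaleC_complex c x = c * x"

definition cinner_complex :: "complex \<Rightarrow> complex \<Rightarrow> complex"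
  where "cinner_complex x y = x * cnj y"

instance
  by standard
    (auto simp: scaleC_complex_def cinner_complex_def algebra_simps scaleR_conv_of_real
      cmod_def power2_eq_square)

end

definition bounded_op :: "('h::complex_hilbert_space \<Rightarrow> 'h) \<Rightarrow> bool"
  where "bounded_op T \<longleftrightarrow> bounded_linear T \<and> (\<forall>c \<xi>. T (scaleC c \<xi>) = scaleC c (T \<xi>))"

definition adjoint_op :: "('h::complex_hilbert_space \<Rightarrow> 'h) \<Rightarrow> 'h \<Rightarrow> 'h"
  where "adjoint_op T = (THE S. \<forall>\<xi> \<eta>. cinner (T \<xi>) \<eta> = cinner \<xi> (S \<eta>))"

definition positive_op :: "('h::complex_hilbert_space \<Rightarrow> 'h) \<Rightarrow> bool"
  where "positive_op T \<longleftrightarrow> bounded_op T \<and> (\<forall>\<xi>. cinner (T \<xi>) \<xi> \<in> \<real>\<^sub>\<ge>\<^sub>0)"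

definition abs_op :: "('h::complex_hilbert_space \<Rightarrow> 'h) \<Rightarrow> 'h \<Rightarrow> 'h"
  where "abs_op T = (THE P. positive_op P \<and> P \<circ> P = adjoint_op T \<circ> T)"

definition is_onb :: "'h::complex_hilbert_space set \<Rightarrow> bool"
  where "is_onb B \<longleftrightarrow>
    (\<forall>e\<in>B. \<forall>e'\<in>B. cinner e e' = (if e = e' then 1 else 0)) \<and>
    (\<forall>\<xi>. (\<forall>e\<in>B. cinner \<xi> e = 0) \<longrightarrow> \<xi> = 0)"

definition trace_class :: "('h::complex_hilbert_space \<Rightarrow> 'h) \<Rightarrow> bool"
  where "trace_class T \<longleftrightarrow>
    bounded_op T \<and> (\<exists>B. is_onb B \<and> (\<lambda>e. cinner (abs_op T e) e) summable_on B)"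

text \<open>For trace class operators the value does not depend on the chosen orthonormal basis.\<close>

definition trace_op :: "('h::complex_hilbert_space \<Rightarrow> 'h) \<Rightarrow> complex"
  where "trace_op T = (\<Sum>\<^sub>\<infinity>e\<in>(SOME B. is_onb B). cinner (T e) e)"


section \<open>Unital completely positive maps\<close>

record 'b star_algebra = "(complex, 'b) module" +
  star :: "'b \<Rightarrow> 'b"

text \<open>Positivity of the \<open>n \<times> n\<close> matrix \<open>M\<close> as an element of the C*-algebra of \<open>n \<times> n\<close> matrices
  over \<open>R\<close>: it is \<open>S\<^sup>* S\<close> for such a matrix \<open>S\<close>.  Only entries with indices below \<open>n\<close> matter.\<close>

definition positive_matrix ::
    "('b, 'm) star_algebra_scheme \<Rightarrow> nat \<Rightarrow> (nat \<Rightarrow> nat \<Rightarrow> 'b) \<Rightarrow> bool"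
  where "positive_matrix R n M \<longleftrightarrow>
    (\<exists>S. (\<forall>i<n. \<forall>j<n. S i j \<in> carrier R) \<and>
         (\<forall>i<n. \<forall>j<n. M i j = (\<Oplus>\<^bsub>R\<^esub>k\<in>{..<n}. star R (S k i) \<otimes>\<^bsub>R\<^esub> S k j)))"

definition ucp_maps ::
    "('b, 'm) star_algebra_scheme \<Rightarrow> ('c, 'k) star_algebra_scheme \<Rightarrow> ('b \<Rightarrow> 'c) set"
  where "ucp_maps R S = {\<Phi> \<in> carrier R \<rightarrow>\<^sub>E carrier S.
    (\<forall>a\<in>carrier R. \<forall>b\<in>carrier R. \<Phi> (a \<oplus>\<^bsub>R\<^esub> b) = \<Phi> a \<oplus>\<^bsub>S\<^esub> \<Phi> b) \<and>
    (\<forall>c. \<forall>a\<in>carrier R. \<Phi> (c \<odot>\<^bsub>R\<^esub> a) = c \<odot>\<^bsub>S\<^esub> \<Phi> a) \<and>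
    \<Phi> \<one>\<^bsub>R\<^esub> = \<one>\<^bsub>S\<^esub> \<and>
    (\<forall>n M. (\<forall>i<n. \<forall>j<n. M i j \<in> carrier R) \<longrightarrow> positive_matrix R n M \<longrightarrow>
       positive_matrix S n (\<lambda>i j. \<Phi> (M i j)))}"


section \<open>The two algebras\<close>

definition cont_alg :: "('a::topological_space \<Rightarrow> complex) star_algebra"
  where "cont_alg =
    \<lparr> carrier = {f. continuous_on UNIV f},
      mult = (\<lambda>f g a. f a * g a),
      one = (\<lambda>_. 1),
      zero = (\<lambda>_. 0),
      add = (\<lambda>f g a. f a + g a),
      smult = (\<lambda>c f a. c * f a),
      star = (\<lambda>f a. cnj (f a)) \<rparr>"

definition Linf_fun :: "'x measure \<Rightarrow> ('x \<Rightarrow> 'h::complex_hilbert_space \<Rightarrow> 'h) set"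
  where "Linf_fun \<mu> = {g.
    (\<forall>x\<in>space \<mu>. bounded_op (g x)) \<and>
    (\<forall>T. trace_class T \<longrightarrow> (\<lambda>x. trace_op (g x \<circ> T)) \<in> borel_measurable \<mu>) \<and>
    (\<exists>C. AE x in \<mu>. onorm (g x) \<le> C)}"

definition Linf_rel :: "'x measure \<Rightarrow>
    (('x \<Rightarrow> 'h::complex_hilbert_space \<Rightarrow> 'h) \<times> ('x \<Rightarrow> 'h \<Rightarrow> 'h)) set"
  where "Linf_rel \<mu> =
    {(g, h). g \<in> Linf_fun \<mu> \<and> h \<in> Linf_fun \<mu> \<and> (AE x in \<mu>. g x = h x)}"

text \<open>Elements are a.e.-equivalence classes; each operation returns the class of the pointwise
  operation on arbitrary representatives.\<close>

definition Linf_alg :: "'x measure \<Rightarrow> ('x \<Rightarrow> 'h::complex_hilbert_space \<Rightarrow> 'h) set star_algebra"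
  where "Linf_alg \<mu> =
    \<lparr> carrier = Linf_fun \<mu> // Linf_rel \<mu>,
      mult = (\<lambda>P Q. Linf_rel \<mu> `` {\<lambda>x. p x \<circ> q x | p q. p \<in> P \<and> q \<in> Q}),
      one = Linf_rel \<mu> `` {\<lambda>x \<xi>. \<xi>},
      zero = Linf_rel \<mu> `` {\<lambda>x \<xi>. 0},
      add = (\<lambda>P Q. Linf_rel \<mu> `` {\<lambda>x \<xi>. p x \<xi> + q x \<xi> | p q. p \<in> P \<and> q \<in> Q}),
      smult = (\<lambda>c P. Linf_rel \<mu> `` {\<lambda>x \<xi>. scaleC c (p x \<xi>) | p. p \<in> P}),
      star = (\<lambda>P. Linf_rel \<mu> `` {\<lambda>x. adjoint_op (p x) | p. p \<in> P}) \<rparr>"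


section \<open>Quantum probability measures and information channels\<close>

text \<open>Values on non-Borel sets are irrelevant, and are left unconstrained.\<close>

definition quantum_prob :: "('a::topological_space set \<Rightarrow> 'h::complex_hilbert_space \<Rightarrow> 'h) set"
  where "quantum_prob = {E.
    (\<forall>\<delta>\<in>sets borel. positive_op (E \<delta>)) \<and>
    E {} = (\<lambda>\<xi>. 0) \<and> E UNIV = (\<lambda>\<xi>. \<xi>) \<and>
    (\<forall>\<delta>::nat \<Rightarrow> 'a set. range \<delta> \<subseteq> sets borel \<longrightarrow> disjoint_family \<delta> \<longrightarrow>
       (\<forall>\<xi>. (\<lambda>n. E (\<delta> n) \<xi>) sums E (\<Union>n. \<delta> n) \<xi>))}"

text \<open>\<open>E x \<alpha>\<close> stands for \<open>E(\<alpha>|x)\<close>.\<close>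

definition channels ::
    "('x::topological_space \<Rightarrow> 'a::topological_space set \<Rightarrow> 'h::complex_hilbert_space \<Rightarrow> 'h) set"
  where "channels = {E.
    (\<forall>x. E x \<in> quantum_prob) \<and>
    (\<forall>\<alpha>\<in>sets borel. \<forall>\<xi> \<eta>. (\<lambda>x. cinner (E x \<alpha> \<xi>) \<eta>) \<in> borel_measurable borel)}"

definition channel_rel :: "'x::topological_space measure \<Rightarrow>
    (('x \<Rightarrow> 'a::topological_space set \<Rightarrow> 'h::complex_hilbert_space \<Rightarrow> 'h) \<times>
     ('x \<Rightarrow> 'a set \<Rightarrow> 'h \<Rightarrow> 'h)) set"
  where "channel_rel \<mu> = {(E, F). E \<in> channels \<and> F \<in> channels \<and>
    (\<forall>\<alpha>\<in>sets borel. AE x in \<mu>. E x \<alpha> = F x \<alpha>)}"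

definition channel_classes :: "'x::topological_space measure \<Rightarrow>
    ('x \<Rightarrow> 'a::topological_space set \<Rightarrow> 'h::complex_hilbert_space \<Rightarrow> 'h) set set"
  where "channel_classes \<mu> = channels // channel_rel \<mu>"

text \<open>Integration against a complex Borel measure \<open>\<nu>\<close>, through any decomposition
  \<open>\<nu> = (M\<^sub>1 - M\<^sub>2) + \<i> (M\<^sub>3 - M\<^sub>4)\<close> into finite positive measures; the value does not depend
  on the decomposition.\<close>

definition has_cmeasure_integral ::
    "('a::topological_space set \<Rightarrow> complex) \<Rightarrow> ('a \<Rightarrow> complex) \<Rightarrow> complex \<Rightarrow> bool"
  where "has_cmeasure_integral \<nu> f I \<longleftrightarrow>
    (\<exists>M\<^sub>1 M\<^sub>2 M\<^sub>3 M\<^sub>4.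
      (\<forall>M\<in>{M\<^sub>1, M\<^sub>2, M\<^sub>3, M\<^sub>4}. finite_measure M \<and> sets M = sets borel \<and> integrable M f) \<and>
      (\<forall>\<alpha>\<in>sets borel. \<nu> \<alpha> =
         complex_of_real (measure M\<^sub>1 \<alpha> - measure M\<^sub>2 \<alpha>) +
         \<i> * complex_of_real (measure M\<^sub>3 \<alpha> - measure M\<^sub>4 \<alpha>)) \<and>
      I = (integral\<^sup>L M\<^sub>1 f - integral\<^sup>L M\<^sub>2 f) + \<i> * (integral\<^sup>L M\<^sub>3 f - integral\<^sup>L M\<^sub>4 f))"

definition cmeasure_integral ::
    "('a::topological_space set \<Rightarrow> complex) \<Rightarrow> ('a \<Rightarrow> complex) \<Rightarrow> complex"
  where "cmeasure_integral \<nu> f = (THE I. has_cmeasure_integral \<nu> f I)"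

text \<open>The identity is required of all representatives of \<open>D\<close> and of \<open>\<Phi> f\<close>; since both are
  nonempty classes, this is equivalent to requiring it of some representatives.\<close>

definition represents :: "'x::topological_space measure \<Rightarrow>
    ('x \<Rightarrow> 'a::topological_space set \<Rightarrow> 'h::complex_hilbert_space \<Rightarrow> 'h) set \<Rightarrow>
    (('a \<Rightarrow> complex) \<Rightarrow> ('x \<Rightarrow> 'h \<Rightarrow> 'h) set) \<Rightarrow> bool"
  where "represents \<mu> D \<Phi> \<longleftrightarrow>
    (\<forall>f\<in>carrier cont_alg. \<forall>\<xi> \<eta>. \<forall>E\<in>D. \<forall>g\<in>\<Phi> f.
       AE x in \<mu>. cinner (g x \<xi>) \<eta> = cmeasure_integral (\<lambda>\<alpha>. cinner (E x \<alpha> \<xi>) \<eta>) f)"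

definition channel_map :: "'x::topological_space measure \<Rightarrow>
    ('x \<Rightarrow> 'a::topological_space set \<Rightarrow> 'h::complex_hilbert_space \<Rightarrow> 'h) set \<Rightarrow>
    ('a \<Rightarrow> complex) \<Rightarrow> ('x \<Rightarrow> 'h \<Rightarrow> 'h) set"
  where "channel_map \<mu> D =
    (THE \<Phi>. \<Phi> \<in> ucp_maps cont_alg (Linf_alg \<mu>) \<and> represents \<mu> D \<Phi>)"

end

theory Submission
  imports Defs
begin

text \<open>
  The correspondence is \<open>\<Phi>(f)(x) = \<integral> f dE(\<cdot>|x)\<close>, where the integral of \<open>f\<close> against an operator-valued
  measure is the operator with matrix coefficients \<open>\<integral> f dE\<^bsub>\<xi>,\<eta>\<^esub>(\<cdot>|x)\<close>.

  From a channel to a map.  A continuous function is approximated by finitely valued ones along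
  partitions that serve all finite measures at once, so the coefficients of \<open>\<integral> f dE(\<cdot>|x)\<close> are limits of
  the measurable functions \<open>\<Sum>\<^sub>z z \<langle>E(T\<^sub>z|x) \<xi>, \<eta>\<rangle>\<close>.  Membership in \<open>L\<^sup>\<infinity>\<close> is defined by traces against
  trace class operators, but it amounts to measurability of the coefficients (\<open>Linf_fun_iff\<close>): in one
  direction a trace is a countable sum of coefficients, in the other a rank one operator is trace class.
  On a partition, the operator matrix coming from \<open>cnj (h i) * h j\<close> is positive, since its quadratic form
  is a sum of terms \<open>\<langle>E(T\<^sub>z|x) u, u\<rangle>\<close> (\<open>qintegral_completely_positive\<close>).  Positivity over \<open>L\<^sup>\<infinity>\<close>
  asks for more: a factorization \<open>P = R\<^sup>* R\<close> with an \<open>n \<times> n\<close> matrix \<open>R\<close> of measurable operator functions.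
  The square root of \<open>P(x)\<close> serves.  If \<open>0 \<le> P \<le> c\<close> then \<open>D = 1 - P/c\<close> is a contraction, and the Taylor
  series of \<open>\<surd>(1 - t)\<close> converges at \<open>D\<close> because its coefficients are absolutely summable; so
  \<open>\<surd>P(x)\<close> is a limit of polynomials in \<open>P(x)\<close> and depends measurably on \<open>x\<close>
  (\<open>positive_opmat_factorization\<close>).

  From a map to a channel.  Representatives of the classes \<open>\<Phi>(f)\<close> are chosen.  By the
  Stone--Weierstrass theorem there is a countable dense set of real continuous functions, closed under
  addition and multiplication by rationals.  Countably many almost everywhere identities say that off one
  null set the representatives are additive, rational-homogeneous, positive and unital on this set.  For
  such \<open>x\<close> they extend by continuity to a positive functional for each vector \<open>\<xi>\<close>, and the
  Riesz--Markov theorem gives a measure \<open>m \<xi>\<close>.  The polarized integrals of continuous functions are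
  sesquilinear in the vectors, and this passes to the polarized measures of Borel sets by a Dynkin
  argument; hence they come from operators (\<open>quantum_prob_from_forms\<close>).  Countable additivity holds in
  the strong topology because \<open>0 \<le> T \<le> I\<close> implies \<open>\<parallel>T \<xi>\<parallel>\<^sup>2 \<le> \<langle>T \<xi>, \<xi>\<rangle>\<close>.  Measurability in \<open>x\<close> is
  again a Dynkin argument.

  Uniqueness.  If two channels have the same integrals of every continuous function almost everywhere,
  then \<open>E(\<alpha>|x) = F(\<alpha>|x)\<close> for almost every \<open>x\<close>, for each Borel set \<open>\<alpha>\<close>.  As the null set may depend on
  \<open>\<alpha>\<close>, the induction over Borel sets applies to the almost everywhere statement itself
  (\<open>qintegral_eq_imp_channel_eq\<close>).
\<close>


section \<open>Hilbert space preliminaries\<close>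

lemma scaleC_zero_left [simp]: "scaleC 0 x = (0::'h::complex_hilbert_space)"
  using scaleC_of_real[of 0 x] by simp

lemma scaleC_one [simp]: "scaleC 1 x = (x::'h::complex_hilbert_space)"
  using scaleC_of_real[of 1 x] by simp

lemma scaleC_zero_right [simp]: "scaleC c 0 = (0::'h::complex_hilbert_space)"
  using scaleC_add_right[of c 0 0] by simp

lemma scaleC_minus_right: "scaleC c (- x) = - scaleC c (x::'h::complex_hilbert_space)"
  using scaleC_add_right[of c "- x" x] by (simp add: eq_neg_iff_add_eq_0)

lemma scaleC_minus_left: "scaleC (- c) x = - scaleC c (x::'h::complex_hilbert_space)"
  using scaleC_add_left[of "- c" c x] by (simp add: eq_neg_iff_add_eq_0)

lemma scaleC_diff_right: "scaleC c (x - y) = scaleC c x - scaleC c (y::'h::complex_hilbert_space)"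
  using scaleC_add_right[of c x "- y"] by (simp add: scaleC_minus_right)

lemma scaleC_sum_right: "scaleC c (sum f F) = (\<Sum>i\<in>F. scaleC c (f i :: 'h::complex_hilbert_space))"
  by (induction F rule: infinite_finite_induct) (auto simp: scaleC_add_right)

lemma cinner_add_right: "cinner (x::'h::complex_hilbert_space) (y + z) = cinner x y + cinner x z"
  by (metis cinner_add_left cinner_commute complex_cnj_add)

lemma cinner_scaleC_right: "cinner (x::'h::complex_hilbert_space) (scaleC c y) = cnj c * cinner x y"
  by (metis cinner_scaleC_left cinner_commute complex_cnj_mult)

lemma cinner_zero_left [simp]: "cinner 0 (x::'h::complex_hilbert_space) = 0"
  using cinner_add_left[of 0 0 x] by simp

lemma cinner_zero_right [simp]: "cinner (x::'h::complex_hilbert_space) 0 = 0"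
  using cinner_add_right[of x 0 0] by simp

lemma cinner_minus_left: "cinner (- x) (y::'h::complex_hilbert_space) = - cinner x y"
  using cinner_add_left[of "- x" x y] by (simp add: eq_neg_iff_add_eq_0)

lemma cinner_minus_right: "cinner (x::'h::complex_hilbert_space) (- y) = - cinner x y"
  using cinner_add_right[of x "- y" y] by (simp add: eq_neg_iff_add_eq_0)

lemma cinner_diff_left: "cinner (x - y) (z::'h::complex_hilbert_space) = cinner x z - cinner y z"
  using cinner_add_left[of x "- y" z] by (simp add: cinner_minus_left)

lemma cinner_diff_right: "cinner (x::'h::complex_hilbert_space) (y - z) = cinner x y - cinner x z"
  using cinner_add_right[of x y "- z"] by (simp add: cinner_minus_right)

lemma cinner_sum_left: "cinner (sum f F) (y::'h::complex_hilbert_space) = (\<Sum>i\<in>F. cinner (f i) y)"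
  by (induction F rule: infinite_finite_induct) (auto simp: cinner_add_left)

lemma cinner_sum_right: "cinner (y::'h::complex_hilbert_space) (sum f F) = (\<Sum>i\<in>F. cinner y (f i))"
  by (induction F rule: infinite_finite_induct) (auto simp: cinner_add_right)

lemma cinner_self: "cinner x x = complex_of_real ((norm (x::'h::complex_hilbert_space))\<^sup>2)"
proof -
  have im: "Im (cinner x x) = 0"
    using arg_cong[OF cinner_commute[of x x], of Im] by simp
  have "sqrt (Re (cinner x x)) \<ge> 0"
    using norm_ge_zero[of x] unfolding norm_eq_sqrt_cinner .
  then have "(norm x)\<^sup>2 = Re (cinner x x)"
    unfolding norm_eq_sqrt_cinner by simp
  with im show ?thesis by (simp add: complex_eq_iff)
qed

lemma Re_cinner_self: "Re (cinner x x) = (norm (x::'h::complex_hilbert_space))\<^sup>2"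
  by (simp add: cinner_self)

lemma cinner_self_eq_0 [simp]: "cinner x x = 0 \<longleftrightarrow> x = (0::'h::complex_hilbert_space)"
  by (simp add: cinner_self)

lemma cmod_cinner_self: "cmod (cinner x x) = (norm (x::'h::complex_hilbert_space))\<^sup>2"
  by (simp add: cinner_self norm_power)

lemma cinner_scaleR_left: "cinner (r *\<^sub>R x) (y::'h::complex_hilbert_space) = r *\<^sub>R cinner x y"
  unfolding scaleC_of_real[symmetric, of r x] cinner_scaleC_left by (simp add: scaleR_conv_of_real)

lemma cinner_scaleR_right: "cinner (x::'h::complex_hilbert_space) (r *\<^sub>R y) = r *\<^sub>R cinner x y"
  unfolding scaleC_of_real[symmetric, of r y] cinner_scaleC_right by (simp add: scaleR_conv_of_real)

lemma norm_scaleC: "norm (scaleC c x) = cmod c * norm (x::'h::complex_hilbert_space)"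
proof -
  have "cinner (scaleC c x) (scaleC c x) = (c * cnj c) * cinner x x"
    by (simp add: cinner_scaleC_left cinner_scaleC_right)
  then have "complex_of_real ((norm (scaleC c x))\<^sup>2) = complex_of_real ((cmod c * norm x)\<^sup>2)"
    unfolding cinner_self complex_norm_square[symmetric] by (simp add: power_mult_distrib)
  then have "(norm (scaleC c x))\<^sup>2 = (cmod c * norm x)\<^sup>2"
    using of_real_eq_iff by blast
  then show ?thesis
    by (metis norm_ge_zero mult_nonneg_nonneg power2_eq_iff_nonneg)
qed

text \<open>The Cauchy--Schwarz inequality is needed not only for the inner product but also for the
  degenerate forms \<open>\<langle>T \<xi>, \<eta>\<rangle>\<close> with \<open>T \<ge> 0\<close>, on single vectors and on tuples; the argument
  uses only the restriction of the form to a complex line.\<close>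

lemma cauchy_schwarz_quadratic:
  fixes a c :: real and b :: complex
  assumes "\<And>t. a + 2 * Re (t * b) + (cmod t)\<^sup>2 * c \<ge> 0" and "a \<ge> 0" "c \<ge> 0"
  shows "(cmod b)\<^sup>2 \<le> a * c"
proof -
  have cb: "cnj b * b = complex_of_real ((cmod b)\<^sup>2)"
    by (metis complex_norm_square mult.commute)
  show ?thesis
  proof (cases "c = 0")
  case True
  show ?thesis
  proof (rule ccontr)
    assume "\<not> ?thesis"
    with True have b: "(cmod b)\<^sup>2 > 0" by simp
    define s where "s = (a + 1) / (cmod b)\<^sup>2"
    \<comment> \<open>With \<open>c = 0\<close> the form is affine along the real multiples of \<open>cnj b\<close>, so it becomes negative.\<close>
    have e: "complex_of_real (- s) * cnj b * b = complex_of_real (- s * (cmod b)\<^sup>2)"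
      by (simp only: mult.assoc cb of_real_mult)
    have "a - 2 * (s * (cmod b)\<^sup>2) \<ge> 0"
      using assms(1)[of "complex_of_real (- s) * cnj b", unfolded e] True by simp
    moreover have "s * (cmod b)\<^sup>2 = a + 1" using b by (simp add: s_def)
    ultimately show False using assms(2) by simp
  qed
next
  case False
  with assms have c: "c > 0" by simp
  \<comment> \<open>The minimum over \<open>t\<close> is attained at \<open>t = - cnj b / c\<close>.\<close>
  have e: "complex_of_real (- 1 / c) * cnj b * b = complex_of_real (- 1 / c * (cmod b)\<^sup>2)"
    by (simp only: mult.assoc cb of_real_mult)
  have "a + 2 * Re (complex_of_real (- 1 / c) * cnj b * b)
     + (cmod (complex_of_real (- 1 / c) * cnj b))\<^sup>2 * c \<ge> 0"
    using assms(1)[of "complex_of_real (- 1 / c) * cnj b"] .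
  then have "a - 2 * ((cmod b)\<^sup>2 / c) + (cmod b / c)\<^sup>2 * c \<ge> 0"
    unfolding e using c by (simp add: norm_mult norm_divide)
  moreover have "(cmod b / c)\<^sup>2 * c = (cmod b)\<^sup>2 / c"
    using c by (simp add: power2_eq_square field_simps)
  ultimately have "(cmod b)\<^sup>2 / c \<le> a" by simp
  with c show ?thesis by (simp add: field_simps)
  qed
qed

lemma cinner_cauchy_schwarz:
  "cmod (cinner x y) \<le> norm x * norm (y::'h::complex_hilbert_space)"
proof -
  have "(norm y)\<^sup>2 + 2 * Re (t * cinner x y) + (cmod t)\<^sup>2 * (norm x)\<^sup>2 \<ge> 0" for t
  proof -
    have "0 \<le> Re (cinner (scaleC t x + y) (scaleC t x + y))"
      unfolding Re_cinner_self by simp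
    also have "cinner (scaleC t x + y) (scaleC t x + y)
        = (t * cnj t) * cinner x x + (t * cinner x y + cnj (t * cinner x y)) + cinner y y"
      using cinner_commute[of y x]
      by (simp add: cinner_add_left cinner_add_right cinner_scaleC_left cinner_scaleC_right algebra_simps)
    also have "Re \<dots> = (norm y)\<^sup>2 + 2 * Re (t * cinner x y) + (cmod t)\<^sup>2 * (norm x)\<^sup>2"
      unfolding cinner_self complex_norm_square[symmetric]
      by (simp add: complex_add_cnj flip: of_real_mult of_real_power)
    finally show ?thesis .
  qed
  then have "(cmod (cinner x y))\<^sup>2 \<le> (norm y)\<^sup>2 * (norm x)\<^sup>2"
    by (intro cauchy_schwarz_quadratic) auto
  then have "(cmod (cinner x y))\<^sup>2 \<le> (norm x * norm y)\<^sup>2"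
    by (simp add: power_mult_distrib mult.commute)
  then show ?thesis
    by (rule power2_le_imp_le) simp
qed

lemma bounded_linear_cinner_left: "bounded_linear (\<lambda>x. cinner x (y::'h::complex_hilbert_space))"
proof (rule bounded_linear_intro[where K = "norm y"])
  show "cinner (r *\<^sub>R x) y = r *\<^sub>R cinner x y" for r x
    by (rule cinner_scaleR_left)
qed (auto simp: cinner_add_left cinner_cauchy_schwarz)

lemma bounded_linear_cinner_right: "bounded_linear (\<lambda>y. cinner (x::'h::complex_hilbert_space) y)"
proof (rule bounded_linear_intro[where K = "norm x"])
  show "cinner x (r *\<^sub>R y) = r *\<^sub>R cinner x y" for r y
    by (rule cinner_scaleR_right)
  show "norm (cinner x y) \<le> norm y * norm x" for y
    using cinner_cauchy_schwarz[of x y] by (simp add: mult.commute)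
qed (auto simp: cinner_add_right)

lemma bounded_linear_scaleC: "bounded_linear (scaleC c :: 'h::complex_hilbert_space \<Rightarrow> 'h)"
proof (rule bounded_linear_intro[where K = "cmod c"])
  show "scaleC c (r *\<^sub>R x) = r *\<^sub>R scaleC c x" for r and x :: 'h
    by (simp add: scaleC_of_real[symmetric] scaleC_scaleC mult.commute)
qed (auto simp: scaleC_add_right norm_scaleC mult.commute)

lemma cinner_ext_left:
  assumes "\<And>z. cinner x z = cinner y (z::'h::complex_hilbert_space)"
  shows "x = y"
proof -
  have "cinner (x - y) (x - y) = 0"
    by (simp add: cinner_diff_left assms)
  then show ?thesis by simp
qed

lemma cinner_ext_right:
  assumes "\<And>z. cinner z x = cinner z (y::'h::complex_hilbert_space)"
  shows "x = y"
  by (rule cinner_ext_left, subst (1 2) cinner_commute) (simp only: assms)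

subsection \<open>Bounded operators\<close>

lemma bounded_opD:
  assumes "bounded_op T"
  shows "bounded_linear T" "T (x + y) = T x + T y" "T (scaleC c x) = scaleC c (T x)"
    "T (x - y) = T x - T y" "T 0 = 0" "T (- x) = - T x" "T (sum f F) = (\<Sum>i\<in>F. T (f i))"
proof -
  show bl: "bounded_linear T" using assms by (simp add: bounded_op_def)
  interpret bounded_linear T by fact
  show "T (x + y) = T x + T y" "T (x - y) = T x - T y" "T 0 = 0" "T (- x) = - T x"
    "T (sum f F) = (\<Sum>i\<in>F. T (f i))"
    by (fact add diff zero neg sum)+
  show "T (scaleC c x) = scaleC c (T x)"
    using assms by (simp add: bounded_op_def)
qed

lemma bounded_opI:
  assumes "\<And>x y. T (x + y) = T x + T y" "\<And>c x. T (scaleC c x) = scaleC c (T x)"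
    and "\<And>x. norm (T x) \<le> K * norm x"
  shows "bounded_op (T :: 'h::complex_hilbert_space \<Rightarrow> 'h)"
  unfolding bounded_op_def
proof (intro conjI allI)
  show "bounded_linear T"
  proof (rule bounded_linear_intro[where K = K])
    show "T (r *\<^sub>R x) = r *\<^sub>R T x" for r x
      by (simp add: assms(2) flip: scaleC_of_real)
    show "norm (T x) \<le> norm x * K" for x using assms(3)[of x] by (simp add: mult.commute)
  qed (fact assms)
qed (fact assms)

lemma bounded_op_add:
  "bounded_op S \<Longrightarrow> bounded_op T \<Longrightarrow> bounded_op (\<lambda>\<xi>. S \<xi> + T \<xi>)"
  by (auto simp: bounded_op_def scaleC_add_right intro: bounded_linear_add)

lemma bounded_op_scaleC: "bounded_op T \<Longrightarrow> bounded_op (\<lambda>\<xi>. scaleC c (T \<xi>))"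
  by (auto simp: bounded_op_def scaleC_scaleC mult.commute
      intro: bounded_linear_compose[OF bounded_linear_scaleC])

lemma bounded_op_comp: "bounded_op S \<Longrightarrow> bounded_op T \<Longrightarrow> bounded_op (S \<circ> T)"
  by (auto simp: bounded_op_def o_def intro: bounded_linear_compose)

lemma bounded_op_id: "bounded_op (\<lambda>\<xi>. \<xi>)"
  by (auto simp: bounded_op_def bounded_linear_ident)

lemma bounded_op_zero: "bounded_op (\<lambda>\<xi>. 0)"
  by (auto simp: bounded_op_def)

lemma bounded_op_norm_le: "bounded_op T \<Longrightarrow> norm (T x) \<le> onorm T * norm x"
  by (rule onorm[OF bounded_opD(1)])

text \<open>The integer powers of \<open>\<i>\<close> cancel all but the linear term, so coefficients are determined by the
  quadratic form.  In particular operators are equal if their quadratic forms are, and self-adjoint if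
  the quadratic form is real.\<close>

lemma polarization:
  assumes "bounded_op T"
  shows "cinner (T \<xi>) \<eta> = (\<Sum>k<4. \<i> ^ k * cinner (T (\<xi> + scaleC (\<i> ^ k) \<eta>)) (\<xi> + scaleC (\<i> ^ k) \<eta>)) / 4"
  by (simp add: bounded_opD[OF assms] eval_nat_numeral cinner_add_left cinner_add_right
      cinner_scaleC_left cinner_scaleC_right scaleC_minus_left cinner_minus_left cinner_minus_right
      algebra_simps)

lemma bounded_op_eqI:
  assumes "bounded_op S" "bounded_op T" "\<And>\<xi>. cinner (S \<xi>) \<xi> = cinner (T \<xi>) \<xi>"
  shows "S = T"
proof (rule ext, rule cinner_ext_left)
  fix \<xi> \<eta>
  show "cinner (S \<xi>) \<eta> = cinner (T \<xi>) \<eta>"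
    unfolding polarization[OF assms(1), of \<xi> \<eta>] polarization[OF assms(2), of \<xi> \<eta>] assms(3) ..
qed

lemma bounded_op_self_adjoint:
  assumes T: "bounded_op T" and real: "\<And>\<xi>. cinner (T \<xi>) \<xi> \<in> \<real>"
  shows "cinner (T \<xi>) \<eta> = cinner \<xi> (T \<eta>)"
proof -
  have r: "cnj (cinner (T v) v) = cinner (T v) v" for v
    using real by (simp add: Reals_cnj_iff)
  have "cinner \<xi> (T \<eta>) = cnj (cinner (T \<eta>) \<xi>)" by (rule cinner_commute)
  also have "\<dots> = cinner (T \<xi>) \<eta>"
  proof -
    have p: "cinner (T (\<eta> + scaleC c \<xi>)) (\<eta> + scaleC c \<xi>)
       = cinner (T (\<xi> + scaleC (cnj c) \<eta>)) (\<xi> + scaleC (cnj c) \<eta>)" if "c * cnj c = 1" for c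
    proof -
      have e: "\<eta> + scaleC c \<xi> = scaleC c (\<xi> + scaleC (cnj c) \<eta>)"
        using that by (simp add: scaleC_add_right scaleC_scaleC)
      show ?thesis
        unfolding e bounded_opD(3)[OF T] cinner_scaleC_left cinner_scaleC_right mult.assoc[symmetric]
        by (simp add: mult.commute[of "cnj c" c] that)
    qed
    have "cnj (cinner (T \<eta>) \<xi>) = (\<Sum>k<4. cnj (\<i> ^ k) * cinner (T (\<eta> + scaleC (\<i> ^ k) \<xi>)) (\<eta> + scaleC (\<i> ^ k) \<xi>)) / 4"
      unfolding polarization[OF T, of \<eta> \<xi>] by (simp add: r del: complex_cnj_power)
    also have "\<dots> = (\<Sum>k<4. cnj (\<i> ^ k) * cinner (T (\<xi> + scaleC (cnj (\<i> ^ k)) \<eta>)) (\<xi> + scaleC (cnj (\<i> ^ k)) \<eta>)) / 4"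
      by (intro arg_cong2[where f = "(/)"] sum.cong refl arg_cong2[where f = "(*)"] p)
         (simp flip: power_mult_distrib)
    also have "\<dots> = cinner (T \<xi>) \<eta>"
      unfolding polarization[OF T, of \<xi> \<eta>] by (simp add: eval_nat_numeral)
    finally show ?thesis .
  qed
  finally show ?thesis by simp
qed

lemma positive_op_bounded: "positive_op T \<Longrightarrow> bounded_op T"
  by (simp add: positive_op_def)

lemma positive_op_cinner: 
  assumes "positive_op T"
  shows "cinner (T \<xi>) \<xi> = complex_of_real (Re (cinner (T \<xi>) \<xi>))" "Re (cinner (T \<xi>) \<xi>) \<ge> 0"
  using assms by (auto simp: positive_op_def complex_nonneg_Reals_iff complex_eq_iff)

lemma positive_opI:
  assumes "bounded_op T" "\<And>\<xi>. Im (cinner (T \<xi>) \<xi>) = 0" "\<And>\<xi>. Re (cinner (T \<xi>) \<xi>) \<ge> 0"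
  shows "positive_op T"
  using assms by (auto simp: positive_op_def complex_nonneg_Reals_iff)

lemma positive_op_self_adjoint: "positive_op T \<Longrightarrow> cinner (T \<xi>) \<eta> = cinner \<xi> (T \<eta>)"
  by (rule bounded_op_self_adjoint) (auto simp: positive_op_def complex_nonneg_Reals_iff complex_is_Real_iff)

lemma positive_op_cauchy_schwarz:
  assumes T: "positive_op T"
  shows "(cmod (cinner (T \<xi>) \<eta>))\<^sup>2 \<le> Re (cinner (T \<xi>) \<xi>) * Re (cinner (T \<eta>) \<eta>)"
proof -
  have "Re (cinner (T \<eta>) \<eta>) + 2 * Re (t * cinner (T \<xi>) \<eta>) + (cmod t)\<^sup>2 * Re (cinner (T \<xi>) \<xi>) \<ge> 0" for t
  proof -
    have "0 \<le> Re (cinner (T (scaleC t \<xi> + \<eta>)) (scaleC t \<xi> + \<eta>))"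
      using positive_op_cinner(2)[OF T] .
    also have "cinner (T (scaleC t \<xi> + \<eta>)) (scaleC t \<xi> + \<eta>)
        = (t * cnj t) * cinner (T \<xi>) \<xi> + (t * cinner (T \<xi>) \<eta> + cnj (t * cinner (T \<xi>) \<eta>)) + cinner (T \<eta>) \<eta>"
      using positive_op_self_adjoint[OF T, of \<eta> \<xi>] cinner_commute[of \<eta> "T \<xi>"]
      by (simp add: cinner_add_left cinner_add_right cinner_scaleC_left cinner_scaleC_right
          bounded_opD[OF positive_op_bounded[OF T]] algebra_simps)
    also have "Re \<dots> = Re (cinner (T \<eta>) \<eta>) + 2 * Re (t * cinner (T \<xi>) \<eta>) + (cmod t)\<^sup>2 * Re (cinner (T \<xi>) \<xi>)"
      unfolding complex_norm_square[symmetric]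
      by (simp add: complex_add_cnj flip: of_real_mult of_real_power)
    finally show ?thesis .
  qed
  then have "(cmod (cinner (T \<xi>) \<eta>))\<^sup>2 \<le> Re (cinner (T \<eta>) \<eta>) * Re (cinner (T \<xi>) \<xi>)"
    using positive_op_cinner(2)[OF T] by (intro cauchy_schwarz_quadratic) auto
  then show ?thesis by (simp add: mult.commute)
qed

text \<open>If \<open>0 \<le> T \<le> I\<close> then \<open>T\<^sup>2 \<le> T\<close>.  This turns weak convergence of decreasing positive
  operators to zero into strong convergence.\<close>

lemma positive_contraction_norm_le:
  assumes T: "positive_op T" and le: "\<And>\<xi>. Re (cinner (T \<xi>) \<xi>) \<le> (norm \<xi>)\<^sup>2"
  shows "(norm (T \<xi>))\<^sup>2 \<le> Re (cinner (T \<xi>) \<xi>)"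
proof (cases "T \<xi> = 0")
  case False
  have "((norm (T \<xi>))\<^sup>2)\<^sup>2 = (cmod (cinner (T \<xi>) (T \<xi>)))\<^sup>2" 
    unfolding cmod_cinner_self ..
  also have "\<dots> \<le> Re (cinner (T \<xi>) \<xi>) * Re (cinner (T (T \<xi>)) (T \<xi>))"
    by (rule positive_op_cauchy_schwarz[OF T])
  also have "\<dots> \<le> Re (cinner (T \<xi>) \<xi>) * (norm (T \<xi>))\<^sup>2"
    by (intro mult_left_mono le positive_op_cinner(2)[OF T])
  finally have "(norm (T \<xi>))\<^sup>2 * (norm (T \<xi>))\<^sup>2 \<le> Re (cinner (T \<xi>) \<xi>) * (norm (T \<xi>))\<^sup>2"
    unfolding power2_eq_square[of "(norm (T \<xi>))\<^sup>2"] .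
  then show ?thesis by (rule mult_right_le_imp_le) (use False in simp)
qed simp

subsection \<open>Orthonormal bases\<close>

text \<open>The definition of a basis says exactly that an orthonormal set is maximal, so Zorn's lemma applies.\<close>

lemma is_onb_exists: "\<exists>B. is_onb (B :: 'h::complex_hilbert_space set)"
proof -
  define P where "P B \<longleftrightarrow> (\<forall>e\<in>B. \<forall>e'\<in>B. cinner e (e'::'h) = (if e = e' then 1 else 0))" for B
  have "\<exists>M\<in>Collect P. \<forall>X\<in>Collect P. M \<subseteq> X \<longrightarrow> X = M"
  proof (rule subset_Zorn)
    fix C :: "'h set set" assume C: "subset.chain (Collect P) C"
    have "P (\<Union>C)"
      unfolding P_def
    proof (intro ballI)
      fix e e' assume "e \<in> \<Union>C" "e' \<in> \<Union>C"
      then obtain X Y where XY: "X \<in> C" "Y \<in> C" "e \<in> X" "e' \<in> Y" by blast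
      have "X \<subseteq> Y \<or> Y \<subseteq> X"
        using C XY(1,2) unfolding subset_chain_def by blast
      then obtain Z where Z: "Z \<in> C" "e \<in> Z" "e' \<in> Z" using XY by blast
      have "P Z" using C Z(1) unfolding subset_chain_def by blast
      then show "cinner e e' = (if e = e' then 1 else 0)"
        using Z(2,3) unfolding P_def by blast
    qed
    then show "\<exists>U\<in>Collect P. \<forall>X\<in>C. X \<subseteq> U" by blast
  qed
  then obtain M where M: "P M" and max: "\<And>X. P X \<Longrightarrow> M \<subseteq> X \<Longrightarrow> X = M" by blast
  have "\<xi> = 0" if orth: "\<forall>e\<in>M. cinner \<xi> e = 0" for \<xi>
  proof (rule ccontr)
    assume nz: "\<xi> \<noteq> 0"
    define u where "u = scaleC (complex_of_real (1 / norm \<xi>)) \<xi>"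
    have uu: "cinner u u = 1" using nz by (simp add: u_def cinner_self norm_scaleC norm_divide)
    have ou: "cinner u e = 0" "cinner e u = 0" if "e \<in> M" for e
    proof -
      show "cinner u e = 0" using orth that by (simp add: u_def cinner_scaleC_left)
      then show "cinner e u = 0" using cinner_commute[of e u] by simp
    qed
    have uM: "u \<notin> M" using ou(1)[of u] uu by auto
    have "P (insert u M)"
      unfolding P_def
    proof (intro ballI)
      fix e e' assume "e \<in> insert u M" "e' \<in> insert u M"
      then consider "e = u" "e' = u" | "e = u" "e' \<in> M" | "e \<in> M" "e' = u" | "e \<in> M" "e' \<in> M"
        by blast
      then show "cinner e e' = (if e = e' then 1 else 0)"
      proof cases
        case 4 then show ?thesis using M unfolding P_def by blast
      qed (use ou uu uM in auto)
    qed
    from max[OF this] uM show False by blast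
  qed
  with M show ?thesis unfolding is_onb_def P_def by blast
qed

lemma is_onbD: 
  assumes "is_onb B"
  shows "e \<in> B \<Longrightarrow> e' \<in> B \<Longrightarrow> cinner e e' = (if e = e' then 1 else 0)"
    "(\<And>e. e \<in> B \<Longrightarrow> cinner \<xi> e = 0) \<Longrightarrow> \<xi> = 0"
  using assms unfolding is_onb_def by blast+

lemma norm_orthonormal_sum:
  assumes B: "is_onb B" and F: "finite F" "F \<subseteq> B"
  shows "(norm (\<Sum>e\<in>F. scaleC (c e) e))\<^sup>2 = (\<Sum>e\<in>F. (cmod (c e))\<^sup>2)"
proof -
  have "cinner (\<Sum>e\<in>F. scaleC (c e) e) (\<Sum>e\<in>F. scaleC (c e) e)
      = (\<Sum>e\<in>F. \<Sum>e'\<in>F. c e * (cnj (c e') * cinner e e'))"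
    by (simp only: cinner_sum_left)
       (simp add: cinner_sum_right cinner_scaleC_left cinner_scaleC_right sum_distrib_left
         mult.left_commute)
  also have "\<dots> = (\<Sum>e\<in>F. \<Sum>e'\<in>F. if e = e' then c e * cnj (c e) else 0)"
    using F by (intro sum.cong) (auto simp: is_onbD(1)[OF B] subset_iff)
  also have "\<dots> = (\<Sum>e\<in>F. c e * cnj (c e))" using F by simp
  also have "\<dots> = complex_of_real (\<Sum>e\<in>F. (cmod (c e))\<^sup>2)"
    by (simp only: complex_norm_square of_real_sum)
  finally show ?thesis unfolding cinner_self of_real_eq_iff .
qed

lemma bessel:
  assumes B: "is_onb B" and F: "finite F" "F \<subseteq> B"
  shows "(\<Sum>e\<in>F. (cmod (cinner \<xi> e))\<^sup>2) \<le> (norm \<xi>)\<^sup>2"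
proof -
  let ?s = "\<Sum>e\<in>F. scaleC (cinner \<xi> e) e"
  have s: "cinner \<xi> ?s = complex_of_real (\<Sum>e\<in>F. (cmod (cinner \<xi> e))\<^sup>2)"
    by (simp only: cinner_sum_right cinner_scaleC_right of_real_sum complex_norm_square mult.commute)
  have "0 \<le> Re (cinner (\<xi> - ?s) (\<xi> - ?s))"
    unfolding Re_cinner_self by simp
  also have "cinner (\<xi> - ?s) (\<xi> - ?s) = cinner \<xi> \<xi> - cinner \<xi> ?s - cnj (cinner \<xi> ?s) + cinner ?s ?s"
    using cinner_commute[of ?s \<xi>] by (simp add: cinner_diff_left cinner_diff_right)
  also have "Re \<dots> = (norm \<xi>)\<^sup>2 - (\<Sum>e\<in>F. (cmod (cinner \<xi> e))\<^sup>2)"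
    unfolding s unfolding cinner_self norm_orthonormal_sum[OF B F] by (simp del: of_real_power of_real_sum)
  finally show ?thesis by simp
qed

text \<open>Riesz--Fischer: partial sums over finite sets form a Cauchy net because the squared
  norm of a block is the sum of its squared coefficients.\<close>

lemma riesz_fischer:
  assumes B: "is_onb B" 
    and bound: "\<And>F. finite F \<Longrightarrow> F \<subseteq> B \<Longrightarrow> (\<Sum>e\<in>F. (cmod (c e))\<^sup>2) \<le> K"
  shows "(\<lambda>e. scaleC (c e) e) summable_on B"
proof -
  have "(\<lambda>e. (cmod (c e))\<^sup>2) summable_on B"
    using bound by (intro nonneg_bdd_above_summable_on) (auto simp: bdd_above_def)
  have "cauchy_filter (filtermap (sum (\<lambda>e. scaleC (c e) e)) (finite_subsets_at_top B))"
    unfolding cauchy_filter_metric_filtermap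
  proof (intro allI impI)
    fix \<epsilon> :: real assume "\<epsilon> > 0"
    define s where "s = infsum (\<lambda>e. (cmod (c e))\<^sup>2) B"
    have "((\<lambda>e. (cmod (c e))\<^sup>2) has_sum s) B"
      unfolding s_def by (rule has_sum_infsum) fact
    then have "eventually (\<lambda>F. dist (\<Sum>e\<in>F. (cmod (c e))\<^sup>2) s < (\<epsilon>/2)\<^sup>2) (finite_subsets_at_top B)"
      using \<open>\<epsilon> > 0\<close> unfolding has_sum_def by (intro tendstoD) auto
    then obtain F0 where F0: "finite F0" "F0 \<subseteq> B"
      and d: "\<forall>F. finite F \<and> F0 \<subseteq> F \<and> F \<subseteq> B \<longrightarrow> dist (\<Sum>e\<in>F. (cmod (c e))\<^sup>2) s < (\<epsilon>/2)\<^sup>2"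
      unfolding eventually_finite_subsets_at_top by (elim exE conjE)
    have close: "dist (\<Sum>e\<in>F. scaleC (c e) e) (\<Sum>e\<in>F0. scaleC (c e) e) < \<epsilon>/2"
      if F: "finite F" "F0 \<subseteq> F" "F \<subseteq> B" for F
    proof -
      have "(\<Sum>e\<in>F. (cmod (c e))\<^sup>2) \<le> s"
        unfolding s_def using F \<open>(\<lambda>e. (cmod (c e))\<^sup>2) summable_on B\<close>
        by (intro finite_sum_le_infsum) auto
      moreover have "s - (\<Sum>e\<in>F0. (cmod (c e))\<^sup>2) < (\<epsilon>/2)\<^sup>2"
        using d[rule_format, of F0] F0 by (simp add: dist_real_def)
      ultimately have "(\<Sum>e\<in>F - F0. (cmod (c e))\<^sup>2) < (\<epsilon>/2)\<^sup>2"
        using F F0 by (simp add: sum_diff)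
      then have "(norm (\<Sum>e\<in>F - F0. scaleC (c e) e))\<^sup>2 < (\<epsilon>/2)\<^sup>2"
        using F by (subst norm_orthonormal_sum[OF B]) auto
      then have "norm (\<Sum>e\<in>F - F0. scaleC (c e) e) < \<epsilon>/2"
        by (rule power2_less_imp_less) (use \<open>\<epsilon> > 0\<close> in simp)
      then show ?thesis using F F0 by (simp add: dist_norm sum_diff)
    qed
    show "\<exists>P. eventually P (finite_subsets_at_top B) \<and>
        (\<forall>x y. P x \<and> P y \<longrightarrow> dist (\<Sum>e\<in>x. scaleC (c e) e) (\<Sum>e\<in>y. scaleC (c e) e) < \<epsilon>)"
    proof (intro exI[of _ "\<lambda>F. finite F \<and> F0 \<subseteq> F \<and> F \<subseteq> B"] conjI allI impI)
      show "eventually (\<lambda>F. finite F \<and> F0 \<subseteq> F \<and> F \<subseteq> B) (finite_subsets_at_top B)"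
        unfolding eventually_finite_subsets_at_top by (rule exI[of _ F0]) (use F0 in simp)
    next
      fix F G assume "(finite F \<and> F0 \<subseteq> F \<and> F \<subseteq> B) \<and> (finite G \<and> F0 \<subseteq> G \<and> G \<subseteq> B)"
      then show "dist (\<Sum>e\<in>F. scaleC (c e) e) (\<Sum>e\<in>G. scaleC (c e) e) < \<epsilon>"
        using close[of F] close[of G] dist_triangle_half_l by blast
    qed
  qed
  moreover have "uniform_space_class.complete (UNIV :: 'a set)"
    by (meson Cauchy_convergent UNIV_I complete_def convergent_def)
  ultimately obtain L where "(sum (\<lambda>e. scaleC (c e) e) \<longlongrightarrow> L) (finite_subsets_at_top B)"
    using complete_uniform[where S = "UNIV :: 'a set"] by (force simp add: filterlim_def)
  then show ?thesis
    using summable_on_def has_sum_def by blast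
qed

lemma onb_coeff_has_sum:
  assumes B: "is_onb B" and s: "((\<lambda>e. scaleC (c e) e) has_sum \<zeta>) B" and e: "e \<in> B"
  shows "cinner \<zeta> e = c e"
proof -
  have "((\<lambda>e'. cinner (scaleC (c e') e') e) has_sum cinner \<zeta> e) B"
    by (rule has_sum_bounded_linear[OF bounded_linear_cinner_left s])
  moreover have "((\<lambda>e'. cinner (scaleC (c e') e') e) has_sum c e) B"
    using e by (intro has_sum_finite_neutralI[of "{e}"]) (auto simp: cinner_scaleC_left is_onbD(1)[OF B])
  ultimately show ?thesis by (rule has_sum_unique)
qed

text \<open>The sum exists by Riesz--Fischer, and its difference from \<open>\<xi>\<close> is orthogonal to the basis.\<close>

lemma onb_expansion:
  assumes B: "is_onb B"
  shows "((\<lambda>e. scaleC (cinner \<xi> e) e) has_sum \<xi>) B"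
proof -
  have "(\<lambda>e. scaleC (cinner \<xi> e) e) summable_on B"
    by (rule riesz_fischer[OF B]) (rule bessel[OF B])
  then obtain \<zeta> where \<zeta>: "((\<lambda>e. scaleC (cinner \<xi> e) e) has_sum \<zeta>) B"
    unfolding summable_on_def by blast
  have "cinner (\<xi> - \<zeta>) e = 0" if "e \<in> B" for e
    using onb_coeff_has_sum[OF B \<zeta> that] by (simp add: cinner_diff_left)
  then have "\<xi> - \<zeta> = 0" by (rule is_onbD(2)[OF B])
  with \<zeta> show ?thesis by simp
qed

lemma parseval:
  assumes B: "is_onb B"
  shows "((\<lambda>e. cinner \<xi> e * cinner e \<eta>) has_sum cinner \<xi> \<eta>) B"
  using has_sum_bounded_linear[OF bounded_linear_cinner_left onb_expansion[OF B, of \<xi>], of \<eta>]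
  by (simp add: cinner_scaleC_left)

text \<open>The representing vector must be \<open>\<Sum>\<^sub>e cnj (\<phi> e) e\<close>.  Its coefficients are square summable since at a
  finite partial sum \<open>\<phi>\<close> takes the value \<open>\<Sum> |\<phi> e|\<^sup>2\<close>, which is at most \<open>K\<close> times the square root of itself.\<close>

lemma riesz_representation:
  fixes \<phi> :: "'h::complex_hilbert_space \<Rightarrow> complex"
  assumes hom_add: "\<And>x y. \<phi> (x + y) = \<phi> x + \<phi> y" and hom_scale: "\<And>c x. \<phi> (scaleC c x) = c * \<phi> x"
    and bound: "\<And>x. cmod (\<phi> x) \<le> K * norm x"
  shows "\<exists>\<eta>. \<forall>\<xi>. \<phi> \<xi> = cinner \<xi> \<eta>"
proof -
  obtain B :: "'h set" where B: "is_onb B" using is_onb_exists by blast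
  have bl: "bounded_linear \<phi>"
  proof (rule bounded_linear_intro[where K = K])
    show "\<phi> (r *\<^sub>R x) = r *\<^sub>R \<phi> x" for r x
      unfolding scaleC_of_real[symmetric, of r x] hom_scale by (simp add: scaleR_conv_of_real)
    show "norm (\<phi> x) \<le> norm x * K" for x using bound[of x] by (simp add: mult.commute)
  qed (fact hom_add)
  interpret bounded_linear \<phi> by (fact bl)
  have "(\<Sum>e\<in>F. (cmod (cnj (\<phi> e)))\<^sup>2) \<le> K\<^sup>2" if F: "finite F" "F \<subseteq> B" for F
  proof -
    define q where "q = (\<Sum>e\<in>F. (cmod (cnj (\<phi> e)))\<^sup>2)"
    let ?s = "\<Sum>e\<in>F. scaleC (cnj (\<phi> e)) e"
    have q0: "q \<ge> 0" unfolding q_def by (simp add: sum_nonneg)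
    have "\<phi> ?s = complex_of_real q"
      unfolding q_def of_real_sum complex_norm_square sum hom_scale by simp
    then have "q = cmod (\<phi> ?s)" using q0 by simp
    also have "\<dots> \<le> K * norm ?s" by (rule bound)
    finally have "q\<^sup>2 \<le> (K * norm ?s)\<^sup>2" using q0 by (intro power_mono) auto
    also have "\<dots> = K\<^sup>2 * q"
      unfolding power_mult_distrib norm_orthonormal_sum[OF B F] q_def ..
    finally have "q * q \<le> K\<^sup>2 * q" by (simp add: power2_eq_square)
    then have "q \<le> K\<^sup>2" using q0 by (cases "q = 0") auto
    then show ?thesis unfolding q_def .
  qed
  then have "(\<lambda>e. scaleC (cnj (\<phi> e)) e) summable_on B"
    by (rule riesz_fischer[OF B])
  then obtain \<eta> where \<eta>: "((\<lambda>e. scaleC (cnj (\<phi> e)) e) has_sum \<eta>) B"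
    unfolding summable_on_def by blast
  have "\<phi> \<xi> = cinner \<xi> \<eta>" for \<xi>
  proof -
    have *: "((\<lambda>e. \<phi> (scaleC (cinner \<xi> e) e)) has_sum \<phi> \<xi>) B"
      by (rule has_sum_bounded_linear[OF bl onb_expansion[OF B]])
    have "((\<lambda>e. cinner \<xi> (scaleC (cnj (\<phi> e)) e)) has_sum cinner \<xi> \<eta>) B"
      by (rule has_sum_bounded_linear[OF bounded_linear_cinner_right \<eta>])
    then have "((\<lambda>e. \<phi> (scaleC (cinner \<xi> e) e)) has_sum cinner \<xi> \<eta>) B"
      by (simp add: hom_scale cinner_scaleC_right mult.commute)
    with * show ?thesis by (rule has_sum_unique)
  qed
  then show ?thesis by blast
qed

lemma sesquilinear_form_op:
  fixes s :: "'h::complex_hilbert_space \<Rightarrow> 'h \<Rightarrow> complex"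
  assumes "\<And>x y z. s (x + y) z = s x z + s y z" "\<And>c x z. s (scaleC c x) z = c * s x z"
    and "\<And>x y z. s x (y + z) = s x y + s x z" "\<And>c x z. s x (scaleC c z) = cnj c * s x z"
    and bound: "\<And>x y. cmod (s x y) \<le> K * norm x * norm y"
  shows "\<exists>T. bounded_op T \<and> (\<forall>\<xi> \<eta>. cinner (T \<xi>) \<eta> = s \<xi> \<eta>) \<and> (\<forall>\<xi>. norm (T \<xi>) \<le> K * norm \<xi>)"
proof -
  have "\<exists>v. \<forall>\<eta>. cnj (s \<xi> \<eta>) = cinner \<eta> v" for \<xi>
    by (rule riesz_representation[where K = "K * norm \<xi>"]) (use assms in auto)
  then obtain T where T: "\<And>\<xi> \<eta>. cnj (s \<xi> \<eta>) = cinner \<eta> (T \<xi>)" by metis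
  have T': "cinner (T \<xi>) \<eta> = s \<xi> \<eta>" for \<xi> \<eta>
    using T[of \<xi> \<eta>] unfolding cinner_commute[of "T \<xi>" \<eta>] by (simp flip: T)
  have n: "norm (T \<xi>) \<le> K * norm \<xi>" for \<xi>
  proof (cases "T \<xi> = 0")
    case True
    have "0 \<le> cmod (s \<xi> \<xi>)" by simp
    also have "\<dots> \<le> K * norm \<xi> * norm \<xi>" by (rule bound)
    finally have "0 \<le> (K * norm \<xi>) * norm \<xi>" .
    then have "0 \<le> K * norm \<xi>" by (cases "\<xi> = 0") (auto simp: zero_le_mult_iff)
    with True show ?thesis by simp
  next
    case False
    have "norm (T \<xi>) * norm (T \<xi>) = cmod (s \<xi> (T \<xi>))"
      unfolding T'[symmetric] cmod_cinner_self by (simp add: power2_eq_square)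
    also have "\<dots> \<le> K * norm \<xi> * norm (T \<xi>)" by (rule bound)
    finally show ?thesis using False by simp
  qed
  have "bounded_op T"
  proof (rule bounded_opI[where K = K])
    show "T (x + y) = T x + T y" "T (scaleC c x) = scaleC c (T x)" for x y c
      by (rule cinner_ext_left, simp add: T' assms(1,2) cinner_add_left cinner_scaleC_left)+
  qed (fact n)
  with T' n show ?thesis by blast
qed

lemma adjoint_op:
  assumes T: "bounded_op (T :: 'h::complex_hilbert_space \<Rightarrow> 'h)"
  shows "cinner (T \<xi>) \<eta> = cinner \<xi> (adjoint_op T \<eta>)"
    and "bounded_op (adjoint_op T)"
    and "onorm (adjoint_op T) \<le> onorm T"
    and "cinner (adjoint_op T \<xi>) \<eta> = cinner \<xi> (T \<eta>)"
proof -
  have "\<exists>S. bounded_op S \<and> (\<forall>\<xi> \<eta>. cinner (S \<xi>) \<eta> = cinner \<xi> (T \<eta>)) \<and> (\<forall>\<xi>. norm (S \<xi>) \<le> onorm T * norm \<xi>)"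
  proof (rule sesquilinear_form_op)
    fix x y
    have "cmod (cinner x (T y)) \<le> norm x * norm (T y)" by (rule cinner_cauchy_schwarz)
    also have "\<dots> \<le> norm x * (onorm T * norm y)"
      by (intro mult_left_mono bounded_op_norm_le T) auto
    finally show "cmod (cinner x (T y)) \<le> onorm T * norm x * norm y" by (simp add: mult_ac)
  qed (simp_all add: cinner_add_left cinner_add_right cinner_scaleC_left cinner_scaleC_right bounded_opD[OF T])
  then obtain S where S: "bounded_op S" "\<And>\<xi> \<eta>. cinner (S \<xi>) \<eta> = cinner \<xi> (T \<eta>)"
     "\<And>\<xi>. norm (S \<xi>) \<le> onorm T * norm \<xi>" by blast
  have S': "cinner (T \<xi>) \<eta> = cinner \<xi> (S \<eta>)" for \<xi> \<eta>
    by (subst (1 2) cinner_commute) (simp only: S(2))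
  have e: "adjoint_op T = S"
    unfolding adjoint_op_def
  proof (rule the_equality)
    fix S' assume *: "\<forall>\<xi> \<eta>. cinner (T \<xi>) \<eta> = cinner \<xi> (S' \<eta>)"
    have "cinner z (S' \<eta>) = cinner z (S \<eta>)" for z \<eta>
      using *[rule_format, of z \<eta>] S'[of z \<eta>] by simp
    then show "S' = S"
      by (rule ext[OF cinner_ext_right])
  qed (use S' in blast)
  show "cinner (T \<xi>) \<eta> = cinner \<xi> (adjoint_op T \<eta>)" unfolding e by (rule S')
  show "bounded_op (adjoint_op T)" unfolding e by (rule S)
  show "cinner (adjoint_op T \<xi>) \<eta> = cinner \<xi> (T \<eta>)" unfolding e by (rule S)
  have "0 \<le> onorm T" using onorm_pos_le[OF bounded_opD(1)[OF T]] .
  then show "onorm (adjoint_op T) \<le> onorm T" unfolding e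
    by (rule onorm_bound) (rule S)
qed

subsection \<open>Rank one operators are trace class\<close>

lemma bounded_op_rank_one: "bounded_op (\<lambda>\<zeta>. scaleC (cinner \<zeta> \<xi>) \<eta>)"
proof (rule bounded_opI[where K = "norm \<xi> * norm \<eta>"])
  fix x
  have "norm (scaleC (cinner x \<xi>) \<eta>) \<le> (norm x * norm \<xi>) * norm \<eta>"
    unfolding norm_scaleC by (intro mult_right_mono cinner_cauchy_schwarz) auto
  then show "norm (scaleC (cinner x \<xi>) \<eta>) \<le> norm \<xi> * norm \<eta> * norm x" by (simp add: mult_ac)
qed (simp_all add: cinner_add_left scaleC_add_left cinner_scaleC_left scaleC_scaleC)

text \<open>A positive square root \<open>P\<close> of \<open>c\<^sup>2 |e\<rangle>\<langle>e|\<close> commutes with it, so it has \<open>e\<close> as an eigenvector;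
  and it vanishes on \<open>e\<^sup>\<bottom>\<close> because there \<open>|P \<zeta>|\<^sup>2 = \<langle>P\<^sup>2 \<zeta>, \<zeta>\<rangle> = 0\<close>.\<close>

lemma rank_one_sqrt_unique:
  fixes \<xi> :: "'h::complex_hilbert_space"
  assumes P: "positive_op P" and sq: "\<And>\<zeta>. P (P \<zeta>) = scaleC (complex_of_real ((norm \<xi>)\<^sup>2) * cinner \<zeta> \<xi>) \<xi>"
  shows "P = (\<lambda>\<zeta>. scaleC (cinner \<zeta> \<xi>) \<xi>)"
proof
  fix \<zeta>
  note B = bounded_opD[OF positive_op_bounded[OF P]]
  have kernel: "P z = 0" if "cinner z \<xi> = 0" for z
  proof -
    have "cinner (P z) (P z) = cinner (P (P z)) z"
      using positive_op_self_adjoint[OF P, of "P z" z] by simp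
    also have "\<dots> = 0" by (simp add: sq that)
    finally show ?thesis by simp
  qed
  show "P \<zeta> = scaleC (cinner \<zeta> \<xi>) \<xi>"
  proof (cases "\<xi> = 0")
    case True then show ?thesis by (simp add: kernel)
  next
    case nz: False
    define n where "n = (norm \<xi>)\<^sup>2"
    have n: "n > 0" using nz by (simp add: n_def)
    have "P (P (P \<xi>)) = scaleC (complex_of_real n * complex_of_real n) (P \<xi>)"
      by (simp add: sq B cinner_self n_def)
    moreover have "P (P (P \<xi>)) = scaleC (complex_of_real n * cinner (P \<xi>) \<xi>) \<xi>"
      unfolding sq[of "P \<xi>"] n_def ..
    ultimately have "scaleC (complex_of_real (1 / (n * n))) (scaleC (complex_of_real n * complex_of_real n) (P \<xi>))
        = scaleC (complex_of_real (1 / (n * n))) (scaleC (complex_of_real n * cinner (P \<xi>) \<xi>) \<xi>)" by simp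
    then have "P \<xi> = scaleC (cinner (P \<xi>) \<xi> / complex_of_real n) \<xi>"
      using n by (simp add: scaleC_scaleC)
    moreover define r where "r = Re (cinner (P \<xi>) \<xi>) / n"
    ultimately have Pxi: "P \<xi> = scaleC (complex_of_real r) \<xi>"
      using positive_op_cinner(1)[OF P, of \<xi>] by simp
    have r0: "r \<ge> 0" using positive_op_cinner(2)[OF P, of \<xi>] n by (simp add: r_def)
    have "cinner (P (P \<xi>)) \<xi> = complex_of_real (r * r * n)"
      by (simp add: Pxi B cinner_scaleC_left cinner_self n_def mult.assoc scaleC_scaleC)
    moreover have "cinner (P (P \<xi>)) \<xi> = complex_of_real (n * n * n)"
      unfolding sq cinner_scaleC_left cinner_self n_def by simp
    ultimately have "r * r * n = n * n * n" by (simp only: of_real_eq_iff)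
    then have "r\<^sup>2 = n\<^sup>2" using n by (simp add: power2_eq_square)
    then have "r = n" using r0 n by (simp add: power2_eq_iff_nonneg)
    define z where "z = \<zeta> - scaleC (cinner \<zeta> \<xi> / n) \<xi>"
    have "cinner z \<xi> = 0" using n nz
      by (simp add: z_def cinner_diff_left cinner_scaleC_left cinner_self n_def)
    then have "P z = 0" by (rule kernel)
    then have "P \<zeta> = scaleC (cinner \<zeta> \<xi> / n) (P \<xi>)" by (simp add: z_def B)
    also have "\<dots> = scaleC (cinner \<zeta> \<xi>) \<xi>"
      using n by (simp add: Pxi \<open>r = n\<close> scaleC_scaleC)
    finally show ?thesis .
  qed
qed

text \<open>The absolute value is defined as the unique positive square root of \<open>T\<^sup>* T\<close>, so uniqueness has to be
  known for these operators before they can be seen to be trace class.\<close>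

lemma trace_class_rank_one: "trace_class (\<lambda>\<zeta>. scaleC (cinner \<zeta> \<xi>) (\<xi>::'h::complex_hilbert_space))"
proof -
  define T where "T = (\<lambda>\<zeta>. scaleC (cinner \<zeta> \<xi>) \<xi>)"
  have T: "bounded_op T" unfolding T_def by (rule bounded_op_rank_one)
  have self: "cinner (T x) y = cinner x (T y)" for x y
    using cinner_commute[of \<xi> y]
    by (simp add: T_def cinner_scaleC_left cinner_scaleC_right cinner_commute[of y \<xi>])
  have pos: "positive_op T"
  proof (rule positive_opI[OF T])
    have "cinner (T x) x = complex_of_real ((cmod (cinner x \<xi>))\<^sup>2)" for x
      unfolding complex_norm_square by (simp add: T_def cinner_scaleC_left cinner_commute[of \<xi> x])
    then show "Im (cinner (T x) x) = 0" "Re (cinner (T x) x) \<ge> 0" for x by auto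
  qed
  have adj: "adjoint_op T = T"
    by (rule ext, rule cinner_ext_right) (simp only: adjoint_op(1)[OF T, symmetric] self)
  have TT: "T (T \<zeta>) = scaleC (complex_of_real ((norm \<xi>)\<^sup>2) * cinner \<zeta> \<xi>) \<xi>" for \<zeta>
    by (simp add: T_def cinner_scaleC_left cinner_self mult.commute)
  have abs: "abs_op T = T"
    unfolding abs_op_def adj
  proof (rule the_equality)
    fix P assume "positive_op P \<and> P \<circ> P = T \<circ> T"
    then have "positive_op P" "\<And>\<zeta>. P (P \<zeta>) = T (T \<zeta>)" by (auto simp: fun_eq_iff)
    then show "P = T" using rank_one_sqrt_unique[of P \<xi>] unfolding TT T_def[symmetric] by blast
  qed (use pos in blast)
  obtain B :: "'h set" where B: "is_onb B" using is_onb_exists by blast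
  have "(\<lambda>e. cinner (abs_op T e) e) summable_on B"
  proof -
    have "cinner (abs_op T e) e = cinner \<xi> e * cinner e \<xi>" for e
      unfolding abs by (simp add: T_def cinner_scaleC_left mult.commute)
    then show ?thesis using parseval[OF B, of \<xi> \<xi>] by (auto simp: summable_on_def)
  qed
  with T B show ?thesis unfolding trace_class_def T_def by blast
qed

lemma trace_op_comp_rank_one:
  fixes g :: "'h::complex_hilbert_space \<Rightarrow> 'h"
  assumes g: "bounded_op g"
  shows "trace_op (g \<circ> (\<lambda>\<zeta>. scaleC (cinner \<zeta> \<xi>) \<xi>)) = cinner (g \<xi>) \<xi>"
proof -
  have B: "is_onb (SOME B::'h set. is_onb B)" using is_onb_exists by (rule someI_ex)
  have "cinner ((g \<circ> (\<lambda>\<zeta>. scaleC (cinner \<zeta> \<xi>) \<xi>)) e) e = cinner (g \<xi>) e * cinner e \<xi>" for e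
    by (simp add: bounded_opD[OF g] cinner_scaleC_left mult.commute)
  then show ?thesis unfolding trace_op_def
    using infsumI[OF parseval[OF B, of "g \<xi>" \<xi>]] by simp
qed

section \<open>Weakly measurable operator functions\<close>

lemma separable_dense:
  assumes "separable_space (euclidean :: 'h::complex_hilbert_space topology)"
  obtains C where "countable C" "closure C = (UNIV :: 'h set)"
  using assms unfolding separable_space_def by auto

text \<open>Distinct basis vectors have distance \<open>\<surd>2\<close>, so points of a dense set at distance less than \<open>1/2\<close> from
  them are distinct.\<close>

lemma countable_onb:
  assumes sep: "separable_space (euclidean :: 'h::complex_hilbert_space topology)"
    and B: "is_onb (B::'h set)"
  shows "countable B"
proof -
  obtain C where C: "countable C" "closure C = (UNIV :: 'h set)" using separable_dense[OF sep] .
  have "\<exists>c\<in>C. dist c e < 1/2" for e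
    using C(2) closure_approachable[of e C] by (metis UNIV_I half_gt_zero zero_less_one)
  then obtain c where c: "\<And>e. c e \<in> C" "\<And>e. dist (c e) e < 1/2" by metis
  have "inj_on c B"
  proof (rule inj_onI, rule ccontr)
    fix e e' assume e: "e \<in> B" "e' \<in> B" "c e = c e'" "e \<noteq> e'"
    have "dist e e' < 1"
      using c(2)[of e] c(2)[of e'] e(3) dist_triangle_half_r[of "c e" e 1 e'] by simp
    then have lt: "(norm (e - e'))\<^sup>2 < 1"
      by (simp add: dist_norm abs_square_less_1)
    have "complex_of_real ((norm (e - e'))\<^sup>2) = cinner (e - e') (e - e')"
      by (rule cinner_self[symmetric])
    also have "\<dots> = 2"
      using e by (simp add: cinner_diff_left cinner_diff_right is_onbD(1)[OF B])
    finally have "(norm (e - e'))\<^sup>2 = 2" by (metis of_real_eq_iff of_real_numeral)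
    with lt show False by simp
  qed
  moreover have "countable (c ` B)" using c(1) C(1) by (auto intro: countable_subset)
  ultimately show ?thesis using countable_image_inj_on by blast
qed

text \<open>Where the series does not converge absolutely its value is \<open>0\<close> by convention, and the set of these
  points is measurable.\<close>

lemma borel_measurable_infsum_countable:
  fixes f :: "'i \<Rightarrow> 'x \<Rightarrow> complex"
  assumes B: "countable B" and f: "\<And>e. e \<in> B \<Longrightarrow> f e \<in> borel_measurable M"
  shows "(\<lambda>x. \<Sum>\<^sub>\<infinity>e\<in>B. f e x) \<in> borel_measurable M"
proof (cases "finite B")
  case True
  then show ?thesis using f by simp
next
  case False
  define b where "b = from_nat_into B"
  have b: "bij_betw b UNIV B" unfolding b_def using bij_betw_from_nat_into[OF B False] .
  have fb [measurable]: "f (b n) \<in> borel_measurable M" for n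
    using f bij_betwE[OF b] by blast
  have eq: "(\<Sum>\<^sub>\<infinity>e\<in>B. f e x) = (if Cauchy (\<lambda>n. \<Sum>i<n. norm (f (b i) x)) then (\<Sum>n. f (b n) x) else 0)" for x
  proof -
    have "(\<Sum>\<^sub>\<infinity>e\<in>B. f e x) = (\<Sum>\<^sub>\<infinity>n. f (b n) x)"
      by (rule infsum_reindex_bij_betw[OF b, symmetric])
    also have "\<dots> = (if summable (\<lambda>n. norm (f (b n) x)) then (\<Sum>n. f (b n) x) else 0)"
    proof (cases "summable (\<lambda>n. norm (f (b n) x))")
      case True
      have "((\<lambda>n. f (b n) x) has_sum (\<Sum>n. f (b n) x)) UNIV"
        by (rule norm_summable_imp_has_sum[OF True summable_sums[OF summable_norm_cancel[OF True]]])
      from infsumI[OF this] True show ?thesis by simp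
    next
      case False
      have "\<not> (\<lambda>n. f (b n) x) summable_on UNIV"
        using False summable_on_imp_summable[of "\<lambda>n. norm (f (b n) x)"]
        unfolding summable_on_iff_abs_summable_on_complex by blast
      with False show ?thesis by (simp add: infsum_not_exists)
    qed
    finally show ?thesis by (simp only: summable_iff_convergent Cauchy_convergent_iff)
  qed
  show ?thesis unfolding eq by measurable
qed

text \<open>Weak measurability is preserved under application to a measurable vector, by expanding the
  vector along a countable orthonormal basis.\<close>

lemma weakly_measurable_apply:
  fixes g :: "'x \<Rightarrow> 'h::complex_hilbert_space \<Rightarrow> 'h"
  assumes sep: "separable_space (euclidean :: 'h topology)"
    and b: "\<And>x. x \<in> space M \<Longrightarrow> bounded_op (g x)"
    and g: "\<And>\<xi> \<eta>. (\<lambda>x. cinner (g x \<xi>) \<eta>) \<in> borel_measurable M"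
    and v: "\<And>\<eta>. (\<lambda>x. cinner (v x) \<eta>) \<in> borel_measurable M"
  shows "(\<lambda>x. cinner (g x (v x)) \<eta>) \<in> borel_measurable M"
proof -
  obtain B :: "'h set" where B: "is_onb B" using is_onb_exists by blast
  have "(\<lambda>x. \<Sum>\<^sub>\<infinity>e\<in>B. cinner (v x) e * cinner (g x e) \<eta>) \<in> borel_measurable M"
    using countable_onb[OF sep B] g v by (intro borel_measurable_infsum_countable borel_measurable_times)
  moreover have "(\<Sum>\<^sub>\<infinity>e\<in>B. cinner (v x) e * cinner (g x e) \<eta>) = cinner (g x (v x)) \<eta>" if x: "x \<in> space M" for x
  proof -
    have "((\<lambda>e. g x (scaleC (cinner (v x) e) e)) has_sum g x (v x)) B"
      by (rule has_sum_bounded_linear[OF bounded_opD(1)[OF b[OF x]] onb_expansion[OF B]])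
    from has_sum_bounded_linear[OF bounded_linear_cinner_left this, of \<eta>]
    show ?thesis
      by (intro infsumI) (simp add: bounded_opD[OF b[OF x]] cinner_scaleC_left)
  qed
  ultimately show ?thesis by (subst measurable_cong[OF sym]) auto
qed

text \<open>The trace of \<open>g x \<circ> T\<close> is a countable sum of coefficients of \<open>g x\<close>.  Conversely, the trace against the
  rank one operator of \<open>\<xi>\<close> is \<open>\<langle>g x \<xi>, \<xi>\<rangle>\<close>, and polarization gives the other coefficients.\<close>

lemma Linf_fun_iff:
  fixes g :: "'x \<Rightarrow> 'h::complex_hilbert_space \<Rightarrow> 'h"
  assumes sep: "separable_space (euclidean :: 'h topology)"
  shows "g \<in> Linf_fun M \<longleftrightarrow>
    (\<forall>x\<in>space M. bounded_op (g x)) \<and>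
    (\<forall>\<xi> \<eta>. (\<lambda>x. cinner (g x \<xi>) \<eta>) \<in> borel_measurable M) \<and>
    (\<exists>C. AE x in M. onorm (g x) \<le> C)" (is "_ \<longleftrightarrow> ?b \<and> ?m \<and> ?C")
proof
  assume g: "g \<in> Linf_fun M"
  then have b: ?b and c: ?C
    and t: "\<And>T. trace_class T \<Longrightarrow> (\<lambda>x. trace_op (g x \<circ> T)) \<in> borel_measurable M"
    unfolding Linf_fun_def by auto
  have q: "(\<lambda>x. cinner (g x \<xi>) \<xi>) \<in> borel_measurable M" for \<xi>
  proof -
    have "(\<lambda>x. trace_op (g x \<circ> (\<lambda>\<zeta>. scaleC (cinner \<zeta> \<xi>) \<xi>))) \<in> borel_measurable M"
      by (rule t[OF trace_class_rank_one])
    then show ?thesis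
      by (subst measurable_cong[OF trace_op_comp_rank_one[symmetric]]) (use b in auto)
  qed
  have ?m
  proof (intro allI)
    fix \<xi> \<eta>
    have "(\<lambda>x. (\<Sum>k<4. \<i> ^ k * cinner (g x (\<xi> + scaleC (\<i> ^ k) \<eta>)) (\<xi> + scaleC (\<i> ^ k) \<eta>)) / 4)
        \<in> borel_measurable M"
      by (intro borel_measurable_divide borel_measurable_sum borel_measurable_times q) auto
    then show "(\<lambda>x. cinner (g x \<xi>) \<eta>) \<in> borel_measurable M"
      by (subst measurable_cong[OF polarization]) (use b in auto)
  qed
  with b c show "?b \<and> ?m \<and> ?C" by blast
next
  assume *: "?b \<and> ?m \<and> ?C"
  have "(\<lambda>x. trace_op (g x \<circ> T)) \<in> borel_measurable M" for T
  proof -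
    have B: "is_onb (SOME B::'h set. is_onb B)" using is_onb_exists by (rule someI_ex)
    show ?thesis
      unfolding trace_op_def o_def
      by (rule borel_measurable_infsum_countable[OF countable_onb[OF sep B]]) (use * in auto)
  qed
  with * show "g \<in> Linf_fun M" unfolding Linf_fun_def by blast
qed

lemma continuous_dense_eq:
  fixes f g :: "'a::topological_space \<Rightarrow> 'b::t2_space"
  assumes "closure C = UNIV" "continuous_on UNIV f" "continuous_on UNIV g" "\<And>x. x \<in> C \<Longrightarrow> f x = g x"
  shows "f x = g x"
proof -
  have "closed {x. f x = g x}" using assms(2,3) by (rule closed_Collect_eq)
  then have "closure C \<subseteq> {x. f x = g x}" using assms(4) by (intro closure_minimal) auto
  with assms(1) show ?thesis by auto
qed

lemma bounded_op_eqI_dense: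
  assumes C: "closure C = (UNIV :: 'h::complex_hilbert_space set)"
    and S: "bounded_op S" and T: "bounded_op T"
    and eq: "\<And>\<xi> \<eta>. \<xi> \<in> C \<Longrightarrow> \<eta> \<in> C \<Longrightarrow> cinner (S \<xi>) \<eta> = cinner (T \<xi>) (\<eta>::'h)"
  shows "S = T"
proof -
  have 1: "cinner (S \<xi>) \<eta> = cinner (T \<xi>) \<eta>" if "\<xi> \<in> C" for \<xi> \<eta>
    by (rule continuous_dense_eq[OF C linear_continuous_on[OF bounded_linear_cinner_right]
          linear_continuous_on[OF bounded_linear_cinner_right] eq[OF that]])
  have "cinner (S \<xi>) \<eta> = cinner (T \<xi>) \<eta>" for \<xi> \<eta>
    by (rule continuous_dense_eq[OF C linear_continuous_on linear_continuous_on 1,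
          OF bounded_linear_compose[OF bounded_linear_cinner_left bounded_opD(1)[OF S]]
             bounded_linear_compose[OF bounded_linear_cinner_left bounded_opD(1)[OF T]]])
  then show ?thesis by (rule ext[OF cinner_ext_left])
qed

text \<open>The exceptional null set of a pair of vectors depends on the pair; countably many pairs suffice.\<close>

lemma AE_bounded_op_eqI:
  fixes g h :: "'x \<Rightarrow> 'h::complex_hilbert_space \<Rightarrow> 'h"
  assumes sep: "separable_space (euclidean :: 'h topology)"
    and b: "\<And>x. x \<in> space M \<Longrightarrow> bounded_op (g x)" "\<And>x. x \<in> space M \<Longrightarrow> bounded_op (h x)"
    and eq: "\<And>\<xi> \<eta>. AE x in M. cinner (g x \<xi>) \<eta> = cinner (h x \<xi>) \<eta>"
  shows "AE x in M. g x = h x"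
proof -
  obtain C where C: "countable C" "closure C = (UNIV :: 'h set)" using separable_dense[OF sep] .
  have "AE x in M. \<forall>\<xi>\<in>C. \<forall>\<eta>\<in>C. cinner (g x \<xi>) \<eta> = cinner (h x \<xi>) \<eta>"
    using C(1) eq by (simp add: AE_ball_countable)
  with AE_space show ?thesis
  proof eventually_elim
    case (elim x)
    then show ?case using b by (intro bounded_op_eqI_dense[OF C(2)]) auto
  qed
qed

lemma Linf_funD:
  assumes sep: "separable_space (euclidean :: 'h::complex_hilbert_space topology)"
    and g: "g \<in> Linf_fun M"
  shows "x \<in> space M \<Longrightarrow> bounded_op (g x)"
    and "(\<lambda>x. cinner (g x \<xi>) (\<eta>::'h)) \<in> borel_measurable M"
    and "\<exists>C. AE x in M. onorm (g x) \<le> C"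
  using g unfolding Linf_fun_iff[OF sep] by blast+

lemma Linf_funI:
  assumes sep: "separable_space (euclidean :: 'h::complex_hilbert_space topology)"
    and b: "\<And>x. x \<in> space M \<Longrightarrow> bounded_op (g x)"
    and "\<And>\<xi> \<eta>. (\<lambda>x. cinner (g x \<xi>) (\<eta>::'h)) \<in> borel_measurable M"
    and n: "\<And>x \<xi>. x \<in> space M \<Longrightarrow> norm (g x \<xi>) \<le> C * norm \<xi>" and "C \<ge> 0"
  shows "g \<in> Linf_fun M"
  unfolding Linf_fun_iff[OF sep]
proof (intro conjI exI)
  show "AE x in M. onorm (g x) \<le> C"
    by (rule AE_I2) (use n \<open>C \<ge> 0\<close> in \<open>auto intro: onorm_bound\<close>)
qed (use assms in blast)+

lemma Linf_fun_const: 
  assumes sep: "separable_space (euclidean :: 'h::complex_hilbert_space topology)"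
  shows "bounded_op (T :: 'h \<Rightarrow> 'h) \<Longrightarrow> (\<lambda>x. T) \<in> Linf_fun M"
  unfolding Linf_fun_iff[OF sep] by auto

lemma Linf_fun_add:
  assumes sep: "separable_space (euclidean :: 'h::complex_hilbert_space topology)"
    and g: "g \<in> Linf_fun M" and h: "h \<in> Linf_fun M"
  shows "(\<lambda>x \<xi>. g x \<xi> + h x (\<xi>::'h)) \<in> Linf_fun M"
proof -
  note G = Linf_funD[OF sep g] and H = Linf_funD[OF sep h]
  obtain C D where "AE x in M. onorm (g x) \<le> C" "AE x in M. onorm (h x) \<le> D"
    using G(3) H(3) by blast
  with AE_space have "AE x in M. onorm (\<lambda>\<xi>. g x \<xi> + h x \<xi>) \<le> C + D"
  proof eventually_elim
    case (elim x)
    show ?case using onorm_triangle[OF bounded_opD(1)[OF G(1)] bounded_opD(1)[OF H(1)], of x x] elim by simp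
  qed
  then show ?thesis
    unfolding Linf_fun_iff[OF sep] using G(1,2) H(1,2) 
    by (auto intro!: bounded_op_add simp: cinner_add_left)
qed

lemma Linf_fun_scaleC:
  assumes sep: "separable_space (euclidean :: 'h::complex_hilbert_space topology)"
    and g: "g \<in> Linf_fun M"
  shows "(\<lambda>x \<xi>. scaleC c (g x (\<xi>::'h))) \<in> Linf_fun M"
proof -
  note G = Linf_funD[OF sep g]
  obtain C where "AE x in M. onorm (g x) \<le> C" using G(3) by blast
  with AE_space have "AE x in M. onorm (\<lambda>\<xi>. scaleC c (g x \<xi>)) \<le> cmod c * C"
  proof eventually_elim
    case (elim x)
    note b = bounded_opD(1)[OF G(1)[OF elim(1)]]
    have "norm (g x \<xi>) \<le> C * norm \<xi>" for \<xi>
      using onorm[OF b, of \<xi>] elim(2) by (meson mult_right_mono norm_ge_zero order_trans)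
    moreover have "0 \<le> C" using onorm_pos_le[OF b] elim(2) by simp
    ultimately show ?case
      by (intro onorm_bound) (auto simp: norm_scaleC mult.assoc intro!: mult_left_mono)
  qed
  then show ?thesis
    unfolding Linf_fun_iff[OF sep] using G(1,2)
    by (auto intro!: bounded_op_scaleC simp: cinner_scaleC_left)
qed

lemma Linf_fun_comp:
  assumes sep: "separable_space (euclidean :: 'h::complex_hilbert_space topology)"
    and g: "g \<in> Linf_fun M" and h: "h \<in> Linf_fun M"
  shows "(\<lambda>x. g x \<circ> (h x :: 'h \<Rightarrow> 'h)) \<in> Linf_fun M"
proof -
  note G = Linf_funD[OF sep g] and H = Linf_funD[OF sep h]
  obtain C D where "AE x in M. onorm (g x) \<le> C" "AE x in M. onorm (h x) \<le> D"
    using G(3) H(3) by blast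
  with AE_space have "AE x in M. onorm (g x \<circ> h x) \<le> C * D"
  proof eventually_elim
    case (elim x)
    note bg = bounded_opD(1)[OF G(1)[OF elim(1)]] and bh = bounded_opD(1)[OF H(1)[OF elim(1)]]
    have "onorm (g x \<circ> h x) \<le> onorm (g x) * onorm (h x)" by (rule onorm_compose[OF bg bh])
    also have "\<dots> \<le> C * D"
      using elim onorm_pos_le[OF bg] onorm_pos_le[OF bh] by (intro mult_mono) auto
    finally show ?case .
  qed
  moreover have "(\<lambda>x. cinner (g x (h x \<xi>)) \<eta>) \<in> borel_measurable M" for \<xi> \<eta>
    by (rule weakly_measurable_apply[OF sep G(1,2) H(2)])
  ultimately show ?thesis
    unfolding Linf_fun_iff[OF sep] using G(1) H(1) by (auto intro!: bounded_op_comp)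
qed

lemma Linf_fun_adjoint:
  assumes sep: "separable_space (euclidean :: 'h::complex_hilbert_space topology)"
    and g: "g \<in> Linf_fun M"
  shows "(\<lambda>x. adjoint_op (g x :: 'h \<Rightarrow> 'h)) \<in> Linf_fun M"
proof -
  note G = Linf_funD[OF sep g]
  obtain C where "AE x in M. onorm (g x) \<le> C" using G(3) by blast
  with AE_space have C: "AE x in M. onorm (adjoint_op (g x)) \<le> C"
    by eventually_elim (use adjoint_op(3)[OF G(1)] in force)
  have "(\<lambda>x. cinner (adjoint_op (g x) \<xi>) \<eta>) \<in> borel_measurable M" for \<xi> \<eta>
  proof -
    have "(\<lambda>x. cnj (cinner (g x \<eta>) \<xi>)) \<in> borel_measurable M"
      by (intro measurable_compose[OF G(2)] borel_measurable_continuous_onI continuous_intros)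
    moreover have "cnj (cinner (g x \<eta>) \<xi>) = cinner (adjoint_op (g x) \<xi>) \<eta>" if "x \<in> space M" for x
      unfolding adjoint_op(4)[OF G(1)[OF that]] cinner_commute[of \<xi>] ..
    ultimately show ?thesis by (subst measurable_cong[OF sym]) auto
  qed
  with C adjoint_op(2)[OF G(1)] show ?thesis
    unfolding Linf_fun_iff[OF sep] by blast
qed

section \<open>Measurable square roots of positive operator matrices\<close>

subsection \<open>The Taylor coefficients of the square root\<close>

text \<open>The Taylor coefficients of \<open>\<surd>(1 - t)\<close>.  They are absolutely summable, so the series still
  makes sense at a contraction, which need not have spectral radius less than 1.\<close>

definition sqrt_coeff :: "nat \<Rightarrow> real"
  where "sqrt_coeff k = (- 1) ^ k * ((1 / 2) gchoose k)"

lemma sqrt_coeff_Suc: "real (Suc k) * sqrt_coeff (Suc k) = (real k - 1 / 2) * sqrt_coeff k"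
proof -
  have "real (Suc k) * ((1 / 2) gchoose Suc k) = (1 / 2 - real k) * ((1 / 2) gchoose k)"
    using gbinomial_mult_1[of "1/2 :: real" k] by (simp add: algebra_simps)
  then have "(- 1) ^ Suc k * (real (Suc k) * ((1 / 2) gchoose Suc k)) = (- 1) ^ Suc k * ((1 / 2 - real k) * ((1 / 2) gchoose k))"
    by simp
  then show ?thesis unfolding sqrt_coeff_def by (simp add: algebra_simps)
qed

lemma sqrt_coeff_nonpos: "sqrt_coeff (Suc k) \<le> 0"
proof (induction k)
  case 0
  then show ?case by (simp add: sqrt_coeff_def)
next
  case (Suc k)
  have "real (Suc (Suc k)) * sqrt_coeff (Suc (Suc k)) \<le> 0"
    unfolding sqrt_coeff_Suc[of "Suc k"] using Suc by (intro mult_nonneg_nonpos) auto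
  then show ?case by (simp add: mult_le_0_iff)
qed

text \<open>All coefficients but the first are negative and the partial sums stay nonnegative, so the sum of the
  absolute values is at most 2.\<close>

lemma sqrt_coeff_partial_sum: "(\<Sum>k\<le>n. sqrt_coeff k) = - 2 * (real (Suc n) * sqrt_coeff (Suc n))"
proof (induction n)
  case 0
  then show ?case by (simp add: sqrt_coeff_def)
next
  case (Suc n)
  show ?case
    unfolding sum.atMost_Suc Suc.IH sqrt_coeff_Suc[of "Suc n"] by (simp add: algebra_simps)
qed

lemma sqrt_coeff_abs_sum: "(\<Sum>k<n. \<bar>sqrt_coeff k\<bar>) \<le> 2"
proof (cases n)
  case (Suc m)
  have eq: "\<bar>sqrt_coeff k\<bar> = (if k = 0 then 2 else 0) - sqrt_coeff k" for k
    using sqrt_coeff_nonpos[of "k - 1"] by (cases k) (auto simp: sqrt_coeff_def[of 0])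
  have "(\<Sum>k<n. \<bar>sqrt_coeff k\<bar>) = 2 - (\<Sum>k\<le>m. sqrt_coeff k)"
    unfolding Suc lessThan_Suc_atMost eq sum_subtractf by simp
  moreover have "(\<Sum>k\<le>m. sqrt_coeff k) \<ge> 0"
    unfolding sqrt_coeff_partial_sum using sqrt_coeff_nonpos[of m] by (auto simp: mult_nonneg_nonpos)
  ultimately show ?thesis by simp
qed simp

lemma sqrt_coeff_summable: "summable (\<lambda>k. \<bar>sqrt_coeff k\<bar>)"
  by (rule summableI_nonneg_bounded[where x = 2]) (simp_all add: sqrt_coeff_abs_sum)

lemma sqrt_coeff_suminf: "(\<Sum>k. \<bar>sqrt_coeff k\<bar>) \<le> 2"
  by (rule suminf_le_const[OF sqrt_coeff_summable sqrt_coeff_abs_sum])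

text \<open>Vandermonde: the square of the series is the binomial series with exponent 1, that is \<open>1 - t\<close>.\<close>

lemma sqrt_coeff_convolution:
  "(\<Sum>i\<le>n. sqrt_coeff i * sqrt_coeff (n - i)) = (if n = 0 then 1 else if n = 1 then - 1 else 0)"
proof -
  have "(\<Sum>i\<le>n. sqrt_coeff i * sqrt_coeff (n - i))
      = (\<Sum>i\<in>{0..n}. (- 1) ^ n * (((1 / 2) gchoose i) * ((1 / 2) gchoose (n - i))))"
    by (intro sum.cong) (auto simp: sqrt_coeff_def atMost_atLeast0 simp flip: power_add)
  also have "\<dots> = (- 1) ^ n * ((1 / 2 + 1 / 2) gchoose n)"
    by (simp only: gbinomial_Vandermonde sum_distrib_left[symmetric])
  also have "(1 / 2 + 1 / 2 :: real) gchoose n = real (1 choose n)"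
    by (simp add: binomial_gbinomial)
  finally show ?thesis
    by (cases n; cases "n - 1") (auto simp: binomial_eq_0)
qed

text \<open>Here \<open>u m = D\<^sup>m v\<close> is a bounded orbit.  The double series of the squared root converges absolutely, so it
  may be summed along \<open>k + l = m\<close>, where the convolution leaves only \<open>m = 0\<close> and \<open>m = 1\<close>.\<close>

lemma sqrt_series_squared:
  fixes u :: "nat \<Rightarrow> 'h::banach"
  assumes bound: "\<And>m. norm (u m) \<le> T"
    and inner: "\<And>k. (\<lambda>l. sqrt_coeff l *\<^sub>R u (k + l)) sums w k"
    and outer: "(\<lambda>k. sqrt_coeff k *\<^sub>R w k) sums z"
  shows "z = u 0 - u 1"
proof -
  define f where "f = (\<lambda>(k, l). (sqrt_coeff k * sqrt_coeff l) *\<^sub>R u (k + l))"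
  have T: "T \<ge> 0" using bound[of 0] norm_ge_zero order_trans by blast
  have s1: "summable (\<lambda>l. norm (sqrt_coeff l *\<^sub>R u (k + l)))" for k
    by (rule summable_comparison_test[OF _ summable_mult2[OF sqrt_coeff_summable, of T]])
       (use bound in \<open>auto intro!: mult_left_mono\<close>)
  have w: "((\<lambda>l. sqrt_coeff l *\<^sub>R u (k + l)) has_sum w k) UNIV" for k
    by (rule norm_summable_imp_has_sum[OF s1 inner])
  have wb: "norm (w k) \<le> 2 * T" for k
  proof -
    have "norm (w k) \<le> (\<Sum>l. norm (sqrt_coeff l *\<^sub>R u (k + l)))"
      unfolding sums_unique[OF inner] by (rule summable_norm[OF s1])
    also have "\<dots> \<le> (\<Sum>l. \<bar>sqrt_coeff l\<bar> * T)"
      by (rule suminf_le[OF _ s1 summable_mult2[OF sqrt_coeff_summable]]) (use bound in \<open>auto intro!: mult_left_mono\<close>)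
    also have "\<dots> = (\<Sum>l. \<bar>sqrt_coeff l\<bar>) * T"
      by (rule suminf_mult2[OF sqrt_coeff_summable, symmetric])
    also have "\<dots> \<le> 2 * T" by (intro mult_right_mono sqrt_coeff_suminf T)
    finally show ?thesis .
  qed
  have z: "((\<lambda>k. sqrt_coeff k *\<^sub>R w k) has_sum z) UNIV"
  proof (rule norm_summable_imp_has_sum[OF _ outer])
    show "summable (\<lambda>n. norm (sqrt_coeff n *\<^sub>R w n))"
      by (rule summable_comparison_test[OF _ summable_mult2[OF sqrt_coeff_summable, of "2 * T"]])
         (use wb in \<open>auto intro!: mult_left_mono\<close>)
  qed
  have abs: "(\<lambda>p. norm (f p)) summable_on UNIV \<times> UNIV"
  proof (rule Infinite_Sum.abs_summable_on_Sigma_iff[THEN iffD2], intro conjI ballI)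
    have a: "(\<lambda>l. norm (sqrt_coeff l *\<^sub>R u (k + l))) summable_on UNIV" for k
      by (rule norm_summable_imp_summable_on) (use s1[of k] in simp)
    have fkl: "norm (f (k, l)) = \<bar>sqrt_coeff k\<bar> * norm (sqrt_coeff l *\<^sub>R u (k + l))" for k l
      by (simp add: f_def abs_mult)
    show "(\<lambda>l. norm (f (k, l))) summable_on UNIV" for k
      unfolding fkl by (rule summable_on_cmult_right[OF a])
    have i: "(\<Sum>\<^sub>\<infinity>l. norm (f (k, l))) = \<bar>sqrt_coeff k\<bar> * (\<Sum>\<^sub>\<infinity>l. norm (sqrt_coeff l *\<^sub>R u (k + l)))" for k
      unfolding fkl by (rule infsum_cmult_right[OF a])
    have ib: "(\<Sum>\<^sub>\<infinity>l. norm (sqrt_coeff l *\<^sub>R u (k + l))) \<le> 2 * T" for k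
    proof -
      have "(\<Sum>\<^sub>\<infinity>l. norm (sqrt_coeff l *\<^sub>R u (k + l))) = (\<Sum>l. norm (sqrt_coeff l *\<^sub>R u (k + l)))"
        by (rule infsumI, rule norm_summable_imp_has_sum) (use s1[of k] in \<open>simp_all add: summable_sums\<close>)
      also have "\<dots> \<le> (\<Sum>l. \<bar>sqrt_coeff l\<bar> * T)"
        by (rule suminf_le[OF _ s1 summable_mult2[OF sqrt_coeff_summable]]) (use bound in \<open>auto intro!: mult_left_mono\<close>)
      also have "\<dots> = (\<Sum>l. \<bar>sqrt_coeff l\<bar>) * T"
        by (rule suminf_mult2[OF sqrt_coeff_summable, symmetric])
      also have "\<dots> \<le> 2 * T" by (intro mult_right_mono sqrt_coeff_suminf T)
      finally show ?thesis .
    qed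
    have i0: "0 \<le> (\<Sum>\<^sub>\<infinity>l. norm (sqrt_coeff l *\<^sub>R u (k + l)))" for k
      by (rule infsum_nonneg) simp
    have "summable (\<lambda>k. norm (norm (\<Sum>\<^sub>\<infinity>l. norm (f (k, l)))))"
      by (rule summable_comparison_test[OF _ summable_mult2[OF sqrt_coeff_summable, of "2 * T"]])
         (use ib i0 in \<open>auto simp: i abs_mult intro!: mult_left_mono\<close>)
    then show "(\<lambda>k. norm (\<Sum>\<^sub>\<infinity>l. norm (f (k, l)))) summable_on UNIV"
      by (rule norm_summable_imp_summable_on)
  qed
  have f: "f summable_on UNIV \<times> UNIV" by (rule abs_summable_summable[OF abs])
  have "z = (\<Sum>\<^sub>\<infinity>k. sqrt_coeff k *\<^sub>R w k)" using infsumI[OF z] by simp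
  also have "\<dots> = (\<Sum>\<^sub>\<infinity>k. \<Sum>\<^sub>\<infinity>l. f (k, l))"
  proof (rule infsum_cong)
    fix k
    have "((\<lambda>l. sqrt_coeff k *\<^sub>R (sqrt_coeff l *\<^sub>R u (k + l))) has_sum sqrt_coeff k *\<^sub>R w k) UNIV"
      by (rule has_sum_bounded_linear[OF bounded_linear_scaleR_right w])
    then have "((\<lambda>l. f (k, l)) has_sum sqrt_coeff k *\<^sub>R w k) UNIV"
      by (simp add: f_def)
    from infsumI[OF this] show "sqrt_coeff k *\<^sub>R w k = (\<Sum>\<^sub>\<infinity>l. f (k, l))" by simp
  qed
  also have "\<dots> = infsum f (UNIV \<times> UNIV)"
    by (rule infsum_Sigma_banach[OF f])
  also have "\<dots> = infsum (\<lambda>(m, i). f (i, m - i)) (SIGMA m:UNIV. {..m})"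
    by (rule infsum_reindex_bij_witness[where i = "\<lambda>(m, i). (i, m - i)" and j = "\<lambda>(k, l). (k + l, k)"]) auto
  also have "\<dots> = (\<Sum>\<^sub>\<infinity>m. \<Sum>\<^sub>\<infinity>i\<in>{..m}. f (i, m - i))"
  proof -
    have "(\<lambda>(m, i). f (i, m - i)) summable_on (SIGMA m:UNIV. {..m}) \<longleftrightarrow> f summable_on UNIV \<times> UNIV"
      by (rule summable_on_reindex_bij_witness[where j = "\<lambda>(m, i). (i, m - i)" and i = "\<lambda>(k, l). (k + l, k)"]) auto
    then have "(\<lambda>(m, i). f (i, m - i)) summable_on (SIGMA m:UNIV. {..m})" using f by simp
    from infsum_Sigma_banach[OF this] show ?thesis by simp
  qed
  also have "\<dots> = (\<Sum>\<^sub>\<infinity>m. (if m = 0 then 1 else if m = 1 then - 1 else 0) *\<^sub>R u m)"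
  proof (rule infsum_cong)
    fix m :: nat
    have "(\<Sum>\<^sub>\<infinity>i\<in>{..m}. f (i, m - i)) = (\<Sum>i\<le>m. sqrt_coeff i * sqrt_coeff (m - i)) *\<^sub>R u m"
      by (simp add: f_def scaleR_sum_left)
    then show "(\<Sum>\<^sub>\<infinity>i\<in>{..m}. f (i, m - i)) = (if m = 0 then 1 else if m = 1 then - 1 else 0) *\<^sub>R u m"
      unfolding sqrt_coeff_convolution .
  qed
  also have "\<dots> = (\<Sum>\<^sub>\<infinity>m\<in>{0, 1}. (if m = 0 then 1 else if m = 1 then - 1 else 0) *\<^sub>R u m)"
    by (rule infsum_cong_neutral) auto
  also have "\<dots> = u 0 - u 1" by simp
  finally show ?thesis .
qed

subsection \<open>Contractive operator matrices\<close>

text \<open>Matrices and tuples are functions of all indices, of which those below \<open>n\<close> matter, because \<open>n\<close> is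
  quantified inside the notion of complete positivity and cannot be a type.\<close>

definition opmat_apply :: "nat \<Rightarrow> (nat \<Rightarrow> nat \<Rightarrow> 'h \<Rightarrow> 'h::complex_hilbert_space) \<Rightarrow> (nat \<Rightarrow> 'h) \<Rightarrow> nat \<Rightarrow> 'h"
  where "opmat_apply n D v i = (\<Sum>j<n. D i j (v j))"

definition tuple_inner :: "nat \<Rightarrow> (nat \<Rightarrow> 'h) \<Rightarrow> (nat \<Rightarrow> 'h::complex_hilbert_space) \<Rightarrow> complex"
  where "tuple_inner n v w = (\<Sum>i<n. cinner (v i) (w i))"

definition unit_tuple :: "nat \<Rightarrow> 'h \<Rightarrow> nat \<Rightarrow> 'h::complex_hilbert_space"
  where "unit_tuple j \<xi> = (\<lambda>l. if l = j then \<xi> else 0)"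

definition opmat_pow :: "nat \<Rightarrow> (nat \<Rightarrow> nat \<Rightarrow> 'h \<Rightarrow> 'h::complex_hilbert_space) \<Rightarrow> nat \<Rightarrow> (nat \<Rightarrow> 'h) \<Rightarrow> nat \<Rightarrow> 'h"
  where "opmat_pow n D k = (opmat_apply n D ^^ k)"

text \<open>The entries of \<open>\<surd>(1 - D)\<close>, for a contraction \<open>D\<close>.\<close>

definition opmat_sqrt :: "nat \<Rightarrow> (nat \<Rightarrow> nat \<Rightarrow> 'h \<Rightarrow> 'h::complex_hilbert_space) \<Rightarrow> nat \<Rightarrow> nat \<Rightarrow> 'h \<Rightarrow> 'h"
  where "opmat_sqrt n D i j \<xi> = (\<Sum>k. sqrt_coeff k *\<^sub>R opmat_pow n D k (unit_tuple j \<xi>) i)"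

lemma tuple_inner_self: "tuple_inner n v v = complex_of_real (\<Sum>i<n. (norm (v i))\<^sup>2)"
  unfolding tuple_inner_def cinner_self of_real_sum ..

lemma opmat_pow_0: "opmat_pow n D 0 v = v"
  and opmat_pow_Suc: "opmat_pow n D (Suc k) v i = (\<Sum>j<n. D i j (opmat_pow n D k v j))"
  by (simp_all add: opmat_pow_def opmat_apply_def)

lemma tuple_inner_unit_right: "i < n \<Longrightarrow> tuple_inner n v (unit_tuple i \<eta>) = cinner (v i) \<eta>"
proof -
  assume "i < n"
  have "tuple_inner n v (unit_tuple i \<eta>) = (\<Sum>l<n. if l = i then cinner (v i) \<eta> else 0)"
    unfolding tuple_inner_def unit_tuple_def by (intro sum.cong) auto
  with \<open>i < n\<close> show ?thesis by simp
qed

lemma tuple_inner_unit_left: "i < n \<Longrightarrow> tuple_inner n (unit_tuple i \<xi>) w = cinner \<xi> (w i)"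
proof -
  assume "i < n"
  have "tuple_inner n (unit_tuple i \<xi>) w = (\<Sum>l<n. if l = i then cinner \<xi> (w i) else 0)"
    unfolding tuple_inner_def unit_tuple_def by (intro sum.cong) auto
  with \<open>i < n\<close> show ?thesis by simp
qed

lemma norm_entry_le: "i < (n::nat) \<Longrightarrow> norm (v i) \<le> sqrt (\<Sum>i<n. (norm (v i))\<^sup>2)"
  by (rule real_le_rsqrt) (rule member_le_sum, auto)

lemma unit_tuple_norm: "j < n \<Longrightarrow> (\<Sum>i<n. (norm (unit_tuple j \<xi> i))\<^sup>2) = (norm \<xi>)\<^sup>2"
proof -
  assume "j < n"
  have "(\<Sum>i<n. (norm (unit_tuple j \<xi> i))\<^sup>2) = (\<Sum>i<n. if i = j then (norm \<xi>)\<^sup>2 else 0)"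
    unfolding unit_tuple_def by (intro sum.cong) auto
  with \<open>j < n\<close> show ?thesis by simp
qed

locale contractive_opmat =
  fixes n :: nat and D :: "nat \<Rightarrow> nat \<Rightarrow> 'h \<Rightarrow> 'h::complex_hilbert_space"
  assumes bounded: "\<And>i j. i < n \<Longrightarrow> j < n \<Longrightarrow> bounded_op (D i j)"
    and hermitian: "\<And>i j \<xi> \<eta>. i < n \<Longrightarrow> j < n \<Longrightarrow> cinner (D i j \<xi>) \<eta> = cinner \<xi> (D j i \<eta>)"
    and nonneg: "\<And>v. 0 \<le> Re (tuple_inner n (opmat_apply n D v) v)"
    and le_one: "\<And>v. Re (tuple_inner n (opmat_apply n D v) v) \<le> (\<Sum>i<n. (norm (v i))\<^sup>2)"
begin

lemma apply_hermitian: "tuple_inner n (opmat_apply n D v) w = tuple_inner n v (opmat_apply n D w)"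
proof -
  have "tuple_inner n (opmat_apply n D v) w = (\<Sum>i<n. \<Sum>j<n. cinner (v j) (D j i (w i)))"
    unfolding tuple_inner_def opmat_apply_def cinner_sum_left by (intro sum.cong refl hermitian) auto
  also have "\<dots> = (\<Sum>j<n. \<Sum>i<n. cinner (v j) (D j i (w i)))" by (rule sum.swap)
  finally show ?thesis
    unfolding tuple_inner_def opmat_apply_def cinner_sum_right .
qed

lemma apply_cauchy_schwarz:
  "(cmod (tuple_inner n (opmat_apply n D v) w))\<^sup>2
    \<le> Re (tuple_inner n (opmat_apply n D v) v) * Re (tuple_inner n (opmat_apply n D w) w)"
proof -
  have sesq: "tuple_inner n (opmat_apply n D (\<lambda>i. scaleC t (v i) + w i)) (\<lambda>i. scaleC t (v i) + w i)
    = (t * cnj t) * tuple_inner n (opmat_apply n D v) v + t * tuple_inner n (opmat_apply n D v) w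
      + cnj t * tuple_inner n (opmat_apply n D w) v + tuple_inner n (opmat_apply n D w) w" for t
  proof -
    have "opmat_apply n D (\<lambda>i. scaleC t (v i) + w i) i = scaleC t (opmat_apply n D v i) + opmat_apply n D w i"
      if "i < n" for i
      unfolding opmat_apply_def using that
      by (simp add: bounded_opD(2,3)[OF bounded] sum.distrib scaleC_sum_right)
    then show ?thesis
      unfolding tuple_inner_def
      by (simp add: cinner_add_left cinner_add_right cinner_scaleC_left cinner_scaleC_right
          sum.distrib sum_distrib_left algebra_simps)
  qed
  have cnj: "tuple_inner n (opmat_apply n D w) v = cnj (tuple_inner n (opmat_apply n D v) w)"
    unfolding apply_hermitian[of w v] unfolding tuple_inner_def cnj_sum
    by (intro sum.cong refl cinner_commute)
  have "0 \<le> Re (tuple_inner n (opmat_apply n D w) w) + 2 * Re (t * tuple_inner n (opmat_apply n D v) w)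
      + (cmod t)\<^sup>2 * Re (tuple_inner n (opmat_apply n D v) v)" for t
  proof -
    have "0 \<le> Re (tuple_inner n (opmat_apply n D (\<lambda>i. scaleC t (v i) + w i)) (\<lambda>i. scaleC t (v i) + w i))"
      by (rule nonneg)
    also have "\<dots> = Re (complex_of_real ((cmod t)\<^sup>2) * tuple_inner n (opmat_apply n D v) v
       + (t * tuple_inner n (opmat_apply n D v) w + cnj (t * tuple_inner n (opmat_apply n D v) w))
       + tuple_inner n (opmat_apply n D w) w)"
      unfolding sesq cnj complex_norm_square by simp
    finally show ?thesis by (simp del: of_real_power)
  qed
  then have "(cmod (tuple_inner n (opmat_apply n D v) w))\<^sup>2
    \<le> Re (tuple_inner n (opmat_apply n D w) w) * Re (tuple_inner n (opmat_apply n D v) v)"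
    by (intro cauchy_schwarz_quadratic nonneg)
  then show ?thesis by (simp add: mult.commute)
qed

text \<open>With \<open>w = D v\<close> the Cauchy--Schwarz inequality of the form of \<open>D\<close> gives
  \<open>\<parallel>w\<parallel>\<^sup>4 \<le> \<langle>D v, v\<rangle> \<langle>D w, w\<rangle> \<le> \<parallel>v\<parallel>\<^sup>2 \<parallel>w\<parallel>\<^sup>2\<close>.\<close>

lemma apply_contraction: "(\<Sum>i<n. (norm (opmat_apply n D v i))\<^sup>2) \<le> (\<Sum>i<n. (norm (v i))\<^sup>2)"
proof -
  let ?w = "opmat_apply n D v"
  define q where "q = (\<Sum>i<n. (norm (?w i))\<^sup>2)"
  define p where "p = (\<Sum>i<n. (norm (v i))\<^sup>2)"
  have p0: "p \<ge> 0" and q0: "q \<ge> 0" unfolding p_def q_def by (simp_all add: sum_nonneg)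
  have "q\<^sup>2 = (cmod (tuple_inner n ?w ?w))\<^sup>2"
    unfolding tuple_inner_self q_def[symmetric] using q0 by simp
  also have "\<dots> \<le> Re (tuple_inner n ?w v) * Re (tuple_inner n (opmat_apply n D ?w) ?w)"
    by (rule apply_cauchy_schwarz)
  also have "\<dots> \<le> p * q"
    unfolding p_def q_def by (intro mult_mono le_one nonneg sum_nonneg) auto
  finally have "q * q \<le> p * q" unfolding power2_eq_square .
  then show ?thesis
    unfolding p_def[symmetric] q_def[symmetric] using p0 q0 by (cases "q = 0") auto
qed

lemma pow_contraction: "(\<Sum>i<n. (norm (opmat_pow n D k v i))\<^sup>2) \<le> (\<Sum>i<n. (norm (v i))\<^sup>2)"
proof (induction k)
  case (Suc k)
  have "opmat_pow n D (Suc k) v = opmat_apply n D (opmat_pow n D k v)" by (simp add: opmat_pow_def)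
  then show ?case using apply_contraction[of "opmat_pow n D k v"] Suc.IH by simp
qed (simp add: opmat_pow_0)

lemma pow_bound: "i < n \<Longrightarrow> norm (opmat_pow n D k v i) \<le> sqrt (\<Sum>i<n. (norm (v i))\<^sup>2)"
  by (rule order_trans[OF norm_entry_le real_sqrt_le_mono[OF pow_contraction]])

lemma pow_unit_bound: "i < n \<Longrightarrow> j < n \<Longrightarrow> norm (opmat_pow n D k (unit_tuple j \<xi>) i) \<le> norm \<xi>"
  using pow_bound[of i k "unit_tuple j \<xi>"] by (simp add: unit_tuple_norm)

lemma pow_hermitian: "tuple_inner n (opmat_pow n D k v) w = tuple_inner n v (opmat_pow n D k w)"
proof (induction k arbitrary: v w)
  case (Suc k)
  have "opmat_pow n D (Suc k) v = opmat_apply n D (opmat_pow n D k v)" for v by (simp add: opmat_pow_def)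
  moreover have "opmat_pow n D (Suc k) v = opmat_pow n D k (opmat_apply n D v)" for v
    by (simp add: opmat_pow_def funpow_swap1)
  ultimately show ?case using Suc.IH apply_hermitian by metis
qed (simp add: opmat_pow_0)

lemma pow_sum: "i < n \<Longrightarrow> opmat_pow n D k (\<lambda>i. \<Sum>l\<in>F. w l i) i = (\<Sum>l\<in>F. opmat_pow n D k (w l) i)"
proof (induction k arbitrary: i)
  case (Suc k)
  have "opmat_pow n D (Suc k) (\<lambda>i. \<Sum>l\<in>F. w l i) i = (\<Sum>j<n. \<Sum>l\<in>F. D i j (opmat_pow n D k (w l) j))"
    unfolding opmat_pow_Suc using Suc.prems
    by (intro sum.cong refl) (simp add: Suc.IH bounded_opD(7)[OF bounded])
  then show ?case unfolding opmat_pow_Suc by (subst (asm) sum.swap) simp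
qed (simp add: opmat_pow_0)

lemma pow_add: "i < n \<Longrightarrow> opmat_pow n D k (\<lambda>i. v i + w i) i = opmat_pow n D k v i + opmat_pow n D k w i"
  using pow_sum[of i k "\<lambda>l. if l then v else w" UNIV] by (simp add: UNIV_bool add.commute)

lemma pow_scaleC: "i < n \<Longrightarrow> opmat_pow n D k (\<lambda>i. scaleC c (v i)) i = scaleC c (opmat_pow n D k v i)"
  by (induction k arbitrary: i)
     (simp_all add: opmat_pow_0 opmat_pow_Suc bounded_opD(3)[OF bounded] scaleC_sum_right)

lemma pow_cong: "i < n \<Longrightarrow> (\<And>j. j < n \<Longrightarrow> v j = w j) \<Longrightarrow> opmat_pow n D k v i = opmat_pow n D k w i"
  by (induction k arbitrary: i) (simp_all add: opmat_pow_0 opmat_pow_Suc)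

lemma series_summable:
  assumes "i < n"
  shows "summable (\<lambda>k. norm (sqrt_coeff k *\<^sub>R opmat_pow n D k v i))"
    and "summable (\<lambda>k. sqrt_coeff k *\<^sub>R opmat_pow n D k v i)"
proof -
  show s: "summable (\<lambda>k. norm (sqrt_coeff k *\<^sub>R opmat_pow n D k v i))"
    by (rule summable_comparison_test[OF _ summable_mult2[OF sqrt_coeff_summable, of "sqrt (\<Sum>i<n. (norm (v i))\<^sup>2)"]])
       (use pow_bound[OF assms] in \<open>auto intro!: mult_left_mono\<close>)
  show "summable (\<lambda>k. sqrt_coeff k *\<^sub>R opmat_pow n D k v i)"
    by (rule summable_norm_cancel[OF s])
qed

lemma sqrt_sums:
  "i < n \<Longrightarrow> (\<lambda>k. sqrt_coeff k *\<^sub>R opmat_pow n D k (unit_tuple j \<xi>) i) sums opmat_sqrt n D i j \<xi>"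
  unfolding opmat_sqrt_def by (rule summable_sums[OF series_summable(2)])

lemma sqrt_norm_le: 
  assumes i: "i < n" and j: "j < n"
  shows "norm (opmat_sqrt n D i j \<xi>) \<le> 2 * norm \<xi>"
proof -
  have "norm (opmat_sqrt n D i j \<xi>) \<le> (\<Sum>k. norm (sqrt_coeff k *\<^sub>R opmat_pow n D k (unit_tuple j \<xi>) i))"
    unfolding opmat_sqrt_def by (rule summable_norm[OF series_summable(1)[OF i]])
  also have "\<dots> \<le> (\<Sum>k. \<bar>sqrt_coeff k\<bar> * norm \<xi>)"
    by (rule suminf_le[OF _ series_summable(1)[OF i] summable_mult2[OF sqrt_coeff_summable]])
       (use pow_unit_bound[OF i j] in \<open>auto intro!: mult_left_mono\<close>)
  also have "\<dots> = (\<Sum>k. \<bar>sqrt_coeff k\<bar>) * norm \<xi>"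
    by (rule suminf_mult2[OF sqrt_coeff_summable, symmetric])
  also have "\<dots> \<le> 2 * norm \<xi>" by (intro mult_right_mono sqrt_coeff_suminf) simp
  finally show ?thesis .
qed

lemma sqrt_bounded_op:
  assumes i: "i < n" and j: "j < n"
  shows "bounded_op (opmat_sqrt n D i j)"
proof (rule bounded_opI[OF _ _ sqrt_norm_le[OF i j]])
  fix x y :: 'h
  have "unit_tuple j (x + y) = (\<lambda>i. unit_tuple j x i + unit_tuple j y i)" by (auto simp: unit_tuple_def)
  then have "(\<lambda>k. sqrt_coeff k *\<^sub>R opmat_pow n D k (unit_tuple j (x + y)) i) sums
     (opmat_sqrt n D i j x + opmat_sqrt n D i j y)"
    using sums_add[OF sqrt_sums[OF i, of j x] sqrt_sums[OF i, of j y]]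
    by (simp add: pow_add[OF i] scaleR_add_right)
  then show "opmat_sqrt n D i j (x + y) = opmat_sqrt n D i j x + opmat_sqrt n D i j y"
    by (rule sums_unique2[OF sqrt_sums[OF i]])
next
  fix c and x :: 'h
  have "unit_tuple j (scaleC c x) = (\<lambda>i. scaleC c (unit_tuple j x i))" by (auto simp: unit_tuple_def)
  then have "opmat_pow n D k (unit_tuple j (scaleC c x)) i = scaleC c (opmat_pow n D k (unit_tuple j x) i)" for k
    by (simp add: pow_scaleC[OF i])
  moreover have "r *\<^sub>R scaleC c z = scaleC c (r *\<^sub>R z)" for r and z :: 'h
    by (simp add: scaleC_scaleC mult.commute flip: scaleC_of_real)
  ultimately have "(\<lambda>k. sqrt_coeff k *\<^sub>R opmat_pow n D k (unit_tuple j (scaleC c x)) i) sums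
     scaleC c (opmat_sqrt n D i j x)"
    using bounded_linear.sums[OF bounded_linear_scaleC sqrt_sums[OF i, of j x], of c]
    by simp
  then show "opmat_sqrt n D i j (scaleC c x) = scaleC c (opmat_sqrt n D i j x)"
    by (rule sums_unique2[OF sqrt_sums[OF i]])
qed

lemma sqrt_hermitian:
  assumes i: "i < n" and j: "j < n"
  shows "cinner (opmat_sqrt n D i j \<xi>) \<eta> = cinner \<xi> (opmat_sqrt n D j i \<eta>)"
proof -
  have "(\<lambda>k. cinner (sqrt_coeff k *\<^sub>R opmat_pow n D k (unit_tuple j \<xi>) i) \<eta>) sums cinner (opmat_sqrt n D i j \<xi>) \<eta>"
    by (rule bounded_linear.sums[OF bounded_linear_cinner_left sqrt_sums[OF i]])
  moreover have "(\<lambda>k. cinner \<xi> (sqrt_coeff k *\<^sub>R opmat_pow n D k (unit_tuple i \<eta>) j)) sums cinner \<xi> (opmat_sqrt n D j i \<eta>)"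
    by (rule bounded_linear.sums[OF bounded_linear_cinner_right sqrt_sums[OF j]])
  moreover have "cinner (opmat_pow n D k (unit_tuple j \<xi>) i) \<eta> = cinner \<xi> (opmat_pow n D k (unit_tuple i \<eta>) j)" for k
    using pow_hermitian[of k "unit_tuple j \<xi>" "unit_tuple i \<eta>"]
    by (simp add: tuple_inner_unit_right[OF i] tuple_inner_unit_left[OF j])
  ultimately show ?thesis
    using sums_unique2 by (simp add: cinner_scaleR_left cinner_scaleR_right)
qed

text \<open>Applied to a tuple supported at index \<open>j\<close>, the double series of the squared root is the one of
  \<open>sqrt_series_squared\<close>; by linearity the matrix product can be computed on such tuples.\<close>

lemma sqrt_squared:
  assumes i: "i < n" and j: "j < n"
  shows "(\<Sum>m<n. opmat_sqrt n D i m (opmat_sqrt n D m j \<xi>)) = (if i = j then \<xi> else 0) - D i j \<xi>"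
proof -
  let ?e = "unit_tuple j \<xi>"
  define w where "w = (\<lambda>m. opmat_sqrt n D m j \<xi>)"
  have inner: "(\<lambda>l. sqrt_coeff l *\<^sub>R opmat_pow n D (k + l) ?e i) sums opmat_pow n D k w i" if "i < n" for k i
    using that
  proof (induction k arbitrary: i)
    case 0
    then show ?case unfolding w_def opmat_pow_0 by (simp add: sqrt_sums)
  next
    case (Suc k)
    have "(\<lambda>l. \<Sum>j<n. D i j (sqrt_coeff l *\<^sub>R opmat_pow n D (k + l) ?e j)) sums opmat_pow n D (Suc k) w i"
      unfolding opmat_pow_Suc
      using Suc.prems by (intro sums_sum bounded_linear.sums[OF bounded_opD(1)[OF bounded]] Suc.IH) auto
    moreover have "(\<Sum>j<n. D i j (sqrt_coeff l *\<^sub>R opmat_pow n D (k + l) ?e j)) = sqrt_coeff l *\<^sub>R opmat_pow n D (Suc k + l) ?e i" for l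
      using Suc.prems
      by (simp add: opmat_pow_Suc scaleR_sum_right bounded_opD(3)[OF bounded] flip: scaleC_of_real)
         (simp add: scaleC_sum_right)
    ultimately show ?case by simp
  qed
  have pw: "opmat_pow n D k w i = (\<Sum>m<n. opmat_pow n D k (unit_tuple m (w m)) i)" for k
  proof -
    have "w l = (\<Sum>m<n. unit_tuple m (w m) l)" if "l < n" for l
      using that by (simp add: unit_tuple_def)
    then have "opmat_pow n D k w i = opmat_pow n D k (\<lambda>l. \<Sum>m<n. unit_tuple m (w m) l) i"
      by (rule pow_cong[OF i])
    then show ?thesis unfolding pow_sum[OF i] .
  qed
  have "(\<lambda>k. \<Sum>m<n. sqrt_coeff k *\<^sub>R opmat_pow n D k (unit_tuple m (w m)) i) sums (\<Sum>m<n. opmat_sqrt n D i m (w m))"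
    by (intro sums_sum sqrt_sums i)
  then have outer: "(\<lambda>k. sqrt_coeff k *\<^sub>R opmat_pow n D k w i) sums (\<Sum>m<n. opmat_sqrt n D i m (w m))"
    unfolding pw scaleR_sum_right .
  have "(\<Sum>m<n. opmat_sqrt n D i m (w m)) = opmat_pow n D 0 ?e i - opmat_pow n D 1 ?e i"
    by (rule sqrt_series_squared[OF pow_unit_bound[OF i j] inner[OF i] outer])
  moreover have "opmat_pow n D 1 ?e i = D i j \<xi>"
  proof -
    have "opmat_pow n D 1 ?e i = (\<Sum>l<n. D i l (?e l))"
      using opmat_pow_Suc[of n D 0 ?e i] by (simp add: opmat_pow_0)
    also have "\<dots> = (\<Sum>l<n. if l = j then D i j \<xi> else 0)"
      by (intro sum.cong refl) (auto simp: unit_tuple_def bounded_opD(5)[OF bounded] i)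
    finally show ?thesis using j by simp
  qed
  ultimately show ?thesis by (simp add: w_def opmat_pow_0 unit_tuple_def)
qed

end

text \<open>The square root is a weak limit of polynomials in the matrix, so it depends measurably on a
  parameter.\<close>

theorem positive_opmat_factorization:
  fixes P :: "'x \<Rightarrow> nat \<Rightarrow> nat \<Rightarrow> 'h \<Rightarrow> 'h::complex_hilbert_space"
  assumes sep: "separable_space (euclidean :: 'h topology)"
    and bounded: "\<And>x i j. x \<in> space M \<Longrightarrow> i < n \<Longrightarrow> j < n \<Longrightarrow> bounded_op (P x i j)"
    and meas: "\<And>i j \<xi> \<eta>. i < n \<Longrightarrow> j < n \<Longrightarrow> (\<lambda>x. cinner (P x i j \<xi>) \<eta>) \<in> borel_measurable M"
    and hermitian: "\<And>x i j \<xi> \<eta>. x \<in> space M \<Longrightarrow> i < n \<Longrightarrow> j < n \<Longrightarrow> cinner (P x i j \<xi>) \<eta> = cinner \<xi> (P x j i \<eta>)"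
    and nonneg: "\<And>x v. x \<in> space M \<Longrightarrow> 0 \<le> Re (\<Sum>i<n. \<Sum>j<n. cinner (P x i j (v j)) (v i))"
    and upper: "\<And>x v. x \<in> space M \<Longrightarrow> Re (\<Sum>i<n. \<Sum>j<n. cinner (P x i j (v j)) (v i)) \<le> c * (\<Sum>i<n. (norm (v i))\<^sup>2)"
    and c: "c > 0"
  shows "\<exists>R. (\<forall>i<n. \<forall>j<n. R i j \<in> Linf_fun M) \<and>
    (\<forall>x\<in>space M. \<forall>i<n. \<forall>j<n. P x i j = (\<lambda>\<xi>. \<Sum>k<n. adjoint_op (R k i x) (R k j x \<xi>)))"
proof -
  define D where "D x i j \<xi> = scaleC (if i = j then 1 else 0) \<xi> + scaleC (complex_of_real (- 1 / c)) (P x i j \<xi>)" for x i j \<xi>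
  have Db: "bounded_op (D x i j)" if "x \<in> space M" "i < n" "j < n" for x i j
    unfolding D_def by (intro bounded_op_add bounded_op_scaleC bounded_op_id bounded that)
  have quad: "Re (tuple_inner n (opmat_apply n (D x) v) v) =
      (\<Sum>i<n. (norm (v i))\<^sup>2) - 1 / c * Re (\<Sum>i<n. \<Sum>j<n. cinner (P x i j (v j)) (v i))" for x v
  proof -
    have "tuple_inner n (opmat_apply n (D x) v) v = (\<Sum>i<n. \<Sum>j<n. (if i = j then cinner (v i) (v i) else 0)
        + complex_of_real (- 1 / c) * cinner (P x i j (v j)) (v i))"
      unfolding tuple_inner_def opmat_apply_def cinner_sum_left D_def
      by (intro sum.cong refl) (auto simp: cinner_add_left cinner_scaleC_left cinner_minus_left)
    also have "\<dots> = complex_of_real (\<Sum>i<n. (norm (v i))\<^sup>2)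
        + complex_of_real (- 1 / c) * (\<Sum>i<n. \<Sum>j<n. cinner (P x i j (v j)) (v i))"
    proof -
      have "(\<Sum>i<n. \<Sum>j<n. if i = j then cinner (v i) (v i) else 0) = complex_of_real (\<Sum>i<n. (norm (v i))\<^sup>2)"
        by (simp add: cinner_self)
      then show ?thesis by (simp only: sum.distrib sum_distrib_left)
    qed
    finally show ?thesis by (simp del: of_real_sum)
  qed
  have D: "contractive_opmat n (D x)" if x: "x \<in> space M" for x
  proof
    show "bounded_op (D x i j)" if "i < n" "j < n" for i j by (rule Db[OF x that])
    show "cinner (D x i j \<xi>) \<eta> = cinner \<xi> (D x j i \<eta>)" if "i < n" "j < n" for i j \<xi> \<eta>
      unfolding D_def by (simp add: cinner_add_left cinner_add_right cinner_scaleC_left cinner_scaleC_right hermitian[OF x that])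
    show "0 \<le> Re (tuple_inner n (opmat_apply n (D x) v) v)" for v
      unfolding quad using upper[OF x, of v] c by (simp add: field_simps)
    show "Re (tuple_inner n (opmat_apply n (D x) v) v) \<le> (\<Sum>i<n. (norm (v i))\<^sup>2)" for v
      unfolding quad using nonneg[OF x, of v] c by simp
  qed
  define R where "R i j x \<xi> = scaleC (complex_of_real (sqrt c)) (opmat_sqrt n (D x) i j \<xi>)" for i j x \<xi>
  have Rb: "bounded_op (R i j x)" if "x \<in> space M" "i < n" "j < n" for i j x
    unfolding R_def by (intro bounded_op_scaleC contractive_opmat.sqrt_bounded_op[OF D] that)
  have Dm: "(\<lambda>x. cinner (D x i j \<xi>) \<eta>) \<in> borel_measurable M" if "i < n" "j < n" for i j \<xi> \<eta>
    unfolding D_def cinner_add_left cinner_scaleC_left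
    by (intro borel_measurable_add borel_measurable_times meas that) auto
  have pm: "(\<lambda>x. cinner (opmat_pow n (D x) k v i) \<eta>) \<in> borel_measurable M" if "i < n" for k v i \<eta>
    using that
  proof (induction k arbitrary: i \<eta>)
    case (Suc k)
    show ?case
      unfolding opmat_pow_Suc cinner_sum_left
    proof (rule borel_measurable_sum)
      fix j assume "j \<in> {..<n}"
      then have j: "j < n" by simp
      show "(\<lambda>x. cinner (D x i j (opmat_pow n (D x) k v j)) \<eta>) \<in> borel_measurable M"
        by (rule weakly_measurable_apply[OF sep, where g = "\<lambda>x. D x i j" and v = "\<lambda>x. opmat_pow n (D x) k v j",
              OF Db[OF _ Suc.prems j] Dm[OF Suc.prems j] Suc.IH[OF j]])
    qed
  qed (simp add: opmat_pow_0)
  have Rm: "(\<lambda>x. cinner (R i j x \<xi>) \<eta>) \<in> borel_measurable M" if ij: "i < n" "j < n" for i j \<xi> \<eta>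
  proof -
    have "(\<lambda>x. complex_of_real (sqrt c) * (\<Sum>k. sqrt_coeff k *\<^sub>R cinner (opmat_pow n (D x) k (unit_tuple j \<xi>) i) \<eta>)) \<in> borel_measurable M"
      by (intro borel_measurable_times borel_measurable_suminf borel_measurable_scaleR pm ij) auto
    moreover have "complex_of_real (sqrt c) * (\<Sum>k. sqrt_coeff k *\<^sub>R cinner (opmat_pow n (D x) k (unit_tuple j \<xi>) i) \<eta>) = cinner (R i j x \<xi>) \<eta>"
      if x: "x \<in> space M" for x
      unfolding R_def cinner_scaleC_left
      using sums_unique[OF bounded_linear.sums[OF bounded_linear_cinner_left contractive_opmat.sqrt_sums[OF D[OF x] ij(1), of j \<xi>], of \<eta>]]
      by (simp add: cinner_scaleR_left)
    ultimately show ?thesis by (subst measurable_cong[OF sym]) auto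
  qed
  have RL: "R i j \<in> Linf_fun M" if ij: "i < n" "j < n" for i j
  proof (rule Linf_funI[OF sep Rb[OF _ ij] Rm[OF ij]])
    show "norm (R i j x \<xi>) \<le> sqrt c * 2 * norm \<xi>" if "x \<in> space M" for x \<xi>
      using contractive_opmat.sqrt_norm_le[OF D[OF that] ij, of \<xi>] c
      unfolding R_def norm_scaleC by (simp add: mult_left_mono)
  qed (use c in auto)
  moreover have "P x i j \<xi> = (\<Sum>k<n. adjoint_op (R k i x) (R k j x \<xi>))"
    if x: "x \<in> space M" and ij: "i < n" "j < n" for x i j \<xi>
  proof -
    interpret contractive_opmat n "D x" by (rule D[OF x])
    have adj: "adjoint_op (R k i x) \<zeta> = scaleC (complex_of_real (sqrt c)) (opmat_sqrt n (D x) i k \<zeta>)" if k: "k < n" for k \<zeta>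
    proof (rule cinner_ext_right)
      fix z
      show "cinner z (adjoint_op (R k i x) \<zeta>) = cinner z (scaleC (complex_of_real (sqrt c)) (opmat_sqrt n (D x) i k \<zeta>))"
        unfolding adjoint_op(1)[OF Rb[OF x k ij(1)], symmetric]
        by (simp add: R_def cinner_scaleC_left cinner_scaleC_right sqrt_hermitian[OF k ij(1)])
    qed
    have "(\<Sum>k<n. adjoint_op (R k i x) (R k j x \<xi>)) = (\<Sum>k<n. scaleC (complex_of_real c) (opmat_sqrt n (D x) i k (opmat_sqrt n (D x) k j \<xi>)))"
    proof (rule sum.cong[OF refl])
      fix k assume "k \<in> {..<n}"
      then have k: "k < n" by simp
      show "adjoint_op (R k i x) (R k j x \<xi>) = scaleC (complex_of_real c) (opmat_sqrt n (D x) i k (opmat_sqrt n (D x) k j \<xi>))"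
        unfolding adj[OF k] unfolding R_def bounded_opD(3)[OF sqrt_bounded_op[OF ij(1) k]] scaleC_scaleC
        using c by (simp flip: of_real_mult)
    qed
    also have "\<dots> = scaleC (complex_of_real c) ((if i = j then \<xi> else 0) - D x i j \<xi>)"
      unfolding scaleC_sum_right[symmetric] sqrt_squared[OF ij] ..
    also have "\<dots> = P x i j \<xi>"
      unfolding D_def using c by (simp add: scaleC_diff_right scaleC_add_right scaleC_scaleC scaleC_minus_left)
    finally show ?thesis by simp
  qed
  ultimately show ?thesis by (intro exI[of _ R]) auto
qed

section \<open>The Riesz--Markov theorem on a compact second countable space\<close>

subsection \<open>Open sets are cozero sets\<close>

lemma normal_space_compact:
  assumes "compact (UNIV :: 'a::t2_space set)"
  shows "normal_space (euclidean :: 'a topology)"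
proof (rule compact_Hausdorff_or_regular_imp_normal_space)
  show "compact_space (euclidean :: 'a topology)"
    using assms by (simp add: compact_space_def)
  show "Hausdorff_space (euclidean :: 'a topology) \<or> regular_space (euclidean :: 'a topology)"
  proof (rule disjI1, unfold Hausdorff_space_def, intro allI impI)
    fix x y :: 'a assume "x \<in> topspace euclidean \<and> y \<in> topspace euclidean \<and> x \<noteq> y"
    then show "\<exists>U V. openin euclidean U \<and> openin euclidean V \<and> x \<in> U \<and> y \<in> V \<and> disjnt U V"
      using hausdorff[of x y] by (simp add: disjnt_def)
  qed
qed

lemma urysohn_point:
  assumes "compact (UNIV :: 'a::t2_space set)" "open U" "a \<in> (U :: 'a set)"
  shows "\<exists>f::'a \<Rightarrow> real. continuous_on UNIV f \<and> (\<forall>x. 0 \<le> f x \<and> f x \<le> 1) \<and> (\<forall>x. x \<notin> U \<longrightarrow> f x = 0) \<and> f a = 1"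
proof -
  obtain f where f: "continuous_map euclidean (top_of_set {0..1::real}) f"
    "f ` (- U) \<subseteq> {0}" "f ` {a} \<subseteq> {1}"
    using Urysohn_lemma[OF normal_space_compact[OF assms(1)], of "- U" "{a}" 0 1] assms(2,3)
    by (auto simp: disjnt_def closed_closedin[symmetric])
  have "continuous_on UNIV f" "\<And>x. f x \<in> {0..1}"
    using f(1) by (auto simp: continuous_map_in_subtopology)
  with f(2,3) show ?thesis by (intro exI[of _ f]) auto
qed

text \<open>Urysohn functions of the points of \<open>U\<close> cover \<open>U\<close>; by Lindelof countably many do, and they are
  added with weights \<open>2\<^sup>-\<^sup>n\<close>.\<close>

lemma open_cozero:
  assumes compact: "compact (UNIV :: 'a::{t2_space, second_countable_topology} set)" and U: "open (U :: 'a set)"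
  shows "\<exists>f::'a \<Rightarrow> real. continuous_on UNIV f \<and> (\<forall>a. 0 \<le> f a \<and> f a \<le> 1) \<and> U = {a. f a > 0}"
proof (cases "U = {}")
  case True
  then show ?thesis by (intro exI[of _ "\<lambda>_. 0"]) auto
next
  case False
  have "\<forall>a. \<exists>f::'a \<Rightarrow> real. a \<in> U \<longrightarrow> continuous_on UNIV f \<and> (\<forall>x. 0 \<le> f x \<and> f x \<le> 1) \<and> (\<forall>x. x \<notin> U \<longrightarrow> f x = 0) \<and> f a = 1"
    using urysohn_point[OF compact U] by blast
  then obtain h :: "'a \<Rightarrow> 'a \<Rightarrow> real" where h: "\<And>a. a \<in> U \<Longrightarrow> continuous_on UNIV (h a)"
    "\<And>a x. a \<in> U \<Longrightarrow> 0 \<le> h a x \<and> h a x \<le> 1" "\<And>a x. a \<in> U \<Longrightarrow> x \<notin> U \<Longrightarrow> h a x = 0"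
    "\<And>a. a \<in> U \<Longrightarrow> h a a = 1"
    by metis
  have "\<exists>F'\<subseteq>(\<lambda>a. {x. h a x > 0}) ` U. countable F' \<and> \<Union>F' = \<Union>((\<lambda>a. {x. h a x > 0}) ` U)"
    by (rule Lindelof[of "(\<lambda>a. {x. h a x > 0}) ` U"])
       (auto intro!: open_Collect_less h(1) continuous_on_const)
  then obtain F' where F': "F' \<subseteq> (\<lambda>a. {x. h a x > 0}) ` U" "countable F'"
    "\<Union>F' = \<Union>((\<lambda>a. {x. h a x > 0}) ` U)" by blast
  obtain A where A: "A \<subseteq> U" "countable A" "F' = (\<lambda>a. {x. h a x > 0}) ` A"
    using countable_subset_image[of F' "\<lambda>a. {x. h a x > 0}" U] F'(1,2) by blast
  have cover: "\<exists>a\<in>A. h a x > 0" if "x \<in> U" for x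
  proof -
    have "x \<in> \<Union>F'" unfolding F'(3) using that h(4)[OF that] by (auto intro!: bexI[of _ x])
    then show ?thesis unfolding A(3) by auto
  qed
  with False have "A \<noteq> {}" by blast
  define b where "b = from_nat_into A"
  have b: "range b = A" unfolding b_def using \<open>A \<noteq> {}\<close> A(2) by (rule range_from_nat_into)
  have bU: "b n \<in> U" for n using b A(1) by blast
  define f where "f x = (\<Sum>n. (1/2) ^ Suc n * h (b n) x)" for x
  have nn: "0 \<le> (1/2) ^ Suc n * h (b n) x" "(1/2) ^ Suc n * h (b n) x \<le> (1/2) ^ Suc n" for n x
    using h(2)[OF bU, of n x] by (auto intro: mult_left_le)
  have sm: "summable (\<lambda>n. (1/2::real) ^ Suc n)"
    using power_half_series by (rule sums_summable)
  have s: "summable (\<lambda>n. (1/2) ^ Suc n * h (b n) x)" for x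
    by (rule summable_comparison_test[OF _ sm]) (use nn in auto)
  have "continuous_on UNIV f"
  proof (rule uniform_limit_theorem)
    show "uniform_limit UNIV (\<lambda>n x. \<Sum>i<n. (1/2) ^ Suc i * h (b i) x) f sequentially"
      unfolding f_def by (rule Weierstrass_m_test[OF _ sm]) (use nn in \<open>simp del: power_Suc\<close>)
    show "\<forall>\<^sub>F n in sequentially. continuous_on UNIV (\<lambda>x. \<Sum>i<n. (1/2) ^ Suc i * h (b i) x)"
      by (intro always_eventually allI continuous_intros h(1) bU)
  qed simp
  moreover have "0 \<le> f x" for x unfolding f_def by (intro suminf_nonneg s nn)
  moreover have "f x \<le> 1" for x
    using suminf_le[OF nn(2) s sm] sums_unique[OF power_half_series] unfolding f_def by simp
  moreover have "U = {a. f a > 0}"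
  proof (intro equalityI subsetI)
    fix x assume "x \<in> U"
    then obtain a where "a \<in> A" "h a x > 0" using cover by blast
    then obtain n where "h (b n) x > 0" using b by auto
    then have "0 < (1/2) ^ Suc n * h (b n) x" by simp
    then show "x \<in> {a. f a > 0}"
      unfolding f_def mem_Collect_eq by (rule suminf_pos2[OF s nn(1)])
  next
    fix x assume x: "x \<in> {a. f a > 0}"
    show "x \<in> U"
    proof (rule ccontr)
      assume "x \<notin> U"
      then have "f x = 0" unfolding f_def using h(3)[OF bU] by simp
      with x show False by simp
    qed
  qed
  ultimately show ?thesis by blast
qed

subsection \<open>Construction of the measure\<close>

text \<open>Dini's theorem: the open sets \<open>{a. h n a < e}\<close> increase and cover the compact space.\<close>

lemma dini_zero:
  fixes h :: "nat \<Rightarrow> 'a::topological_space \<Rightarrow> real"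
  assumes compact: "compact (UNIV :: 'a set)" and h: "\<And>n. continuous_on UNIV (h n)"
    and mono: "\<And>m n a. m \<le> n \<Longrightarrow> h n a \<le> h m a" and lim: "\<And>a. (\<lambda>n. h n a) \<longlonglongrightarrow> 0" and e: "e > 0"
  shows "\<exists>n. \<forall>a. h n a < e"
proof -
  have cover: "UNIV \<subseteq> (\<Union>n\<in>UNIV. {a. h n a < e})"
  proof
    fix a
    have "eventually (\<lambda>n. h n a < e) sequentially" using order_tendstoD(2)[OF lim e] .
    then show "a \<in> (\<Union>n\<in>UNIV. {a. h n a < e})" unfolding eventually_sequentially by auto
  qed
  obtain N where N: "finite N" "UNIV \<subseteq> (\<Union>n\<in>N. {a. h n a < e})"
    by (rule compactE_image[OF compact _ cover]) (auto intro!: open_Collect_less h continuous_on_const)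
  have "h (Max (insert 0 N)) a < e" for a
  proof -
    obtain n where n: "n \<in> N" "h n a < e" using N(2) by blast
    have "h (Max (insert 0 N)) a \<le> h n a" using N(1) n(1) by (intro mono) simp
    with n(2) show ?thesis by simp
  qed
  then show ?thesis by blast
qed

text \<open>Cutting the range of a function into slices of height 1 writes it as a sum of functions with values in
  \<open>[0, 1]\<close>, each of which is almost an indicator.\<close>

lemma sum_unit_slices:
  fixes y :: real
  assumes "y \<ge> 0"
  shows "(\<Sum>k<m. min (max (y - real k) 0) 1) = min y (real m)"
  using assms by (induction m) (auto simp: min_def max_def)

text \<open>The measure is obtained from a positive functional \<open>L\<close> in the manner of Daniell and Kakutani.  The
  strips \<open>{(a, t). f a \<le> t < g a}\<close> between continuous functions form a semiring of subsets of
  \<open>A \<times> \<real>\<close>, on which the value \<open>L (g - f)\<close> is countably additive by Dini's theorem.  Caratheodory extends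
  it, and the measure of \<open>B\<close> is the value at \<open>B \<times> [0, 1)\<close>.\<close>

context
  fixes L :: "('a::{t2_space, second_countable_topology} \<Rightarrow> real) \<Rightarrow> real"
  assumes compact: "compact (UNIV :: 'a set)"
    and L_add: "\<And>f g. continuous_on UNIV f \<Longrightarrow> continuous_on UNIV g \<Longrightarrow> L (\<lambda>a. f a + g a) = L f + L g"
    and L_scale: "\<And>c f. continuous_on UNIV f \<Longrightarrow> L (\<lambda>a. c * f a) = c * L f"
    and L_nonneg: "\<And>f. continuous_on UNIV f \<Longrightarrow> (\<And>a. 0 \<le> f a) \<Longrightarrow> 0 \<le> L f"
begin

private lemma L_zero: "L (\<lambda>_. 0) = 0"
  using L_scale[of "\<lambda>_. 0" 0] by simp

private lemma L_diff: "continuous_on UNIV f \<Longrightarrow> continuous_on UNIV g \<Longrightarrow> L (\<lambda>a. f a - g a) = L f - L g"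
  using L_add[of f "\<lambda>a. (-1) * g a"] L_scale[of g "-1"] by (simp add: continuous_on_minus)

private lemma L_mono: "continuous_on UNIV f \<Longrightarrow> continuous_on UNIV g \<Longrightarrow> (\<And>a. f a \<le> g a) \<Longrightarrow> L f \<le> L g"
  using L_nonneg[of "\<lambda>a. g a - f a"] L_diff[of g f] by (simp add: continuous_on_diff)

private lemma L_sum: "(\<And>i. i \<in> I \<Longrightarrow> continuous_on UNIV (f i)) \<Longrightarrow> L (\<lambda>a. \<Sum>i\<in>I. f i a) = (\<Sum>i\<in>I. L (f i))"
  by (induction I rule: infinite_finite_induct) (auto simp: L_zero L_add continuous_on_sum)

private definition strip :: "('a \<Rightarrow> real) \<Rightarrow> ('a \<Rightarrow> real) \<Rightarrow> ('a \<times> real) set"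
  where "strip f g = {(a, t). f a \<le> t \<and> t < g a}"

private definition strips :: "('a \<times> real) set set"
  where "strips = {strip f g | f g. continuous_on UNIV f \<and> continuous_on UNIV g \<and> (\<forall>a. f a \<le> g a)}"

text \<open>The length of the vertical section.  Taking the content of a strip to be \<open>L (width A)\<close> makes it
  independent of the two functions bounding the strip, and makes the widths additive because Lebesgue
  measure is.\<close>

private definition width :: "('a \<times> real) set \<Rightarrow> 'a \<Rightarrow> real"
  where "width A a = measure lborel (Pair a -` A)"

private lemma stripsI:
  "continuous_on UNIV f \<Longrightarrow> continuous_on UNIV g \<Longrightarrow> (\<And>a. f a \<le> g a) \<Longrightarrow> strip f g \<in> strips"
  unfolding strips_def by blast

private lemma stripsE:
  assumes "A \<in> strips"
  obtains f g where "A = strip f g" "continuous_on UNIV f" "continuous_on UNIV g" "\<And>a. f a \<le> g a"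
  using assms unfolding strips_def by blast

private lemma strip_section: "Pair a -` strip f g = {f a..<g a}"
  unfolding strip_def by auto

private lemma width_strip: "f a \<le> g a \<Longrightarrow> width (strip f g) a = g a - f a"
  unfolding width_def strip_section by simp

private lemma width_continuous: "A \<in> strips \<Longrightarrow> continuous_on UNIV (width A)"
proof (erule stripsE)
  fix f g assume fg: "A = strip f g" "continuous_on UNIV f" "continuous_on UNIV g" "\<And>a. f a \<le> g a"
  then have "width A = (\<lambda>a. g a - f a)" by (simp add: fun_eq_iff width_strip)
  with fg show ?thesis by (simp add: continuous_on_diff)
qed

private lemma width_nonneg: "0 \<le> width A a"
  unfolding width_def by simp

private lemma semiring_strips: "semiring_of_sets UNIV strips"
proof
  show "strips \<subseteq> Pow UNIV" by simp
  show "{} \<in> strips"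
  proof -
    have "strip (\<lambda>_. 0) (\<lambda>_. 0) = {}" by (auto simp: strip_def)
    then show ?thesis using stripsI[of "\<lambda>_. 0" "\<lambda>_. 0"] by (simp add: continuous_on_const)
  qed
next
  fix A B assume "A \<in> strips" "B \<in> strips"
  then obtain f g f' g' where A: "A = strip f g" "continuous_on UNIV f" "continuous_on UNIV g" "\<And>a. f a \<le> g a"
    and B: "B = strip f' g'" "continuous_on UNIV f'" "continuous_on UNIV g'" "\<And>a. f' a \<le> g' a"
    by (metis stripsE)
  have "A \<inter> B = strip (\<lambda>a. max (f a) (f' a)) (\<lambda>a. max (max (f a) (f' a)) (min (g a) (g' a)))"
    unfolding A(1) B(1) strip_def by auto
  then show "A \<inter> B \<in> strips"
    by (simp only:) (intro stripsI continuous_intros A B, simp)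
  let ?l = "strip f (\<lambda>a. max (f a) (min (g a) (f' a)))" and ?u = "strip (\<lambda>a. min (max (f a) (g' a)) (g a)) g"
  have "A - B = ?l \<union> ?u"
    unfolding A(1) B(1) strip_def using A(4) B(4) by auto
  moreover have "?l \<in> strips" "?u \<in> strips"
    by (intro stripsI continuous_intros A B; simp)+
  moreover have "?l \<inter> ?u = {}"
  proof -
    have False if "(a, t) \<in> ?l" "(a, t) \<in> ?u" for a t
      using that B(4)[of a] unfolding strip_def by (auto simp: max_def min_def split: if_splits)
    then show ?thesis by auto
  qed
  then have "disjoint {?l, ?u}"
    by (auto simp: disjoint_def pairwise_def disjnt_def)
  ultimately show "\<exists>C\<subseteq>strips. finite C \<and> disjoint C \<and> A - B = \<Union> C"
    by (intro exI[of _ "{?l, ?u}"]) auto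
qed

text \<open>The remainders \<open>width (\<Union>i. A i) - (\<Sum>i<n. width (A i))\<close> are continuous and decrease to \<open>0\<close>, hence
  uniformly, hence so do their values under \<open>L\<close>.\<close>

private lemma strips_countably_additive: "countably_additive strips (\<lambda>A. ennreal (L (width A)))"
  unfolding countably_additive_def
proof (intro allI impI)
  fix A :: "nat \<Rightarrow> ('a \<times> real) set"
  assume A: "range A \<subseteq> strips" and disj: "disjoint_family A" and U: "(\<Union>i. A i) \<in> strips"
  have cA: "continuous_on UNIV (width (A i))" for i using A by (intro width_continuous) auto
  have cU: "continuous_on UNIV (width (\<Union>i. A i))" using U by (rule width_continuous)
  have sums: "(\<lambda>i. width (A i) a) sums width (\<Union>i. A i) a" for a
  proof -
    have meas: "Pair a -` B \<in> sets lborel \<and> emeasure lborel (Pair a -` B) \<noteq> \<infinity>" if "B \<in> strips" for B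
      using that by (rule stripsE) (auto simp: strip_section)
    have "(\<lambda>i. measure lborel (Pair a -` A i)) sums measure lborel (\<Union>i. Pair a -` A i)"
    proof (rule measure_UNION)
      show "range (\<lambda>i. Pair a -` A i) \<subseteq> sets lborel" using A meas by auto
      show "disjoint_family (\<lambda>i. Pair a -` A i)"
        using disj unfolding disjoint_family_on_def by blast
      show "emeasure lborel (\<Union>i. Pair a -` A i) \<noteq> \<infinity>"
        using meas[OF U] by (simp add: vimage_UN)
    qed
    then show ?thesis unfolding width_def by (simp add: vimage_UN)
  qed
  define h where "h n a = width (\<Union>i. A i) a - (\<Sum>i<n. width (A i) a)" for n a
  have ch: "continuous_on UNIV (h n)" for n
    unfolding h_def by (intro continuous_intros cA cU)
  have h0: "0 \<le> h n a" for n a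
    using sum_le_suminf[OF sums_summable[OF sums[of a]], of "{..<n}"] sums_unique[OF sums[of a]]
    unfolding h_def by (simp add: width_nonneg)
  have Lh: "L (h n) = L (width (\<Union>i. A i)) - (\<Sum>i<n. L (width (A i)))" for n
    unfolding h_def by (subst L_diff) (auto intro!: continuous_intros cA cU simp: L_sum[OF cA])
  have "(\<lambda>i. L (width (A i))) sums L (width (\<Union>i. A i))"
    unfolding sums_def
  proof (rule LIMSEQ_I)
    fix r :: real assume r: "r > 0"
    define e where "e = r / (2 * (L (\<lambda>_. 1) + 1))"
    have L1: "0 \<le> L (\<lambda>_. 1)" by (rule L_nonneg) (auto intro: continuous_on_const)
    then have e: "e > 0" using r by (simp add: e_def)
    have hm: "h n a \<le> h m a" if "m \<le> n" for m n a
      unfolding h_def using that by (intro diff_mono sum_mono2) (auto simp: width_nonneg)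
    have hl: "(\<lambda>n. h n a) \<longlonglongrightarrow> 0" for a
      using tendsto_diff[OF tendsto_const sums[of a, unfolded sums_def], of "width (\<Union>i. A i) a"]
      unfolding h_def by simp
    obtain N where N: "\<And>a. h N a < e"
      using dini_zero[OF compact ch hm hl e] by blast
    show "\<exists>no. \<forall>n\<ge>no. norm ((\<Sum>i<n. L (width (A i))) - L (width (\<Union>i. A i))) < r"
    proof (intro exI[of _ N] allI impI)
      fix n assume n: "n \<ge> N"
      have "L (h n) \<le> L (\<lambda>a. e * 1)"
        by (rule L_mono[OF ch]) (use hm[OF n] N in \<open>auto intro: less_imp_le le_less_trans continuous_on_const\<close>)
      also have "\<dots> = e * L (\<lambda>_. 1)" by (rule L_scale) (rule continuous_on_const)
      also have "\<dots> \<le> e * (L (\<lambda>_. 1) + 1)" using e by simp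
      also have "\<dots> = r / 2" using L1 by (simp add: e_def field_simps)
      also have "\<dots> < r" using r by simp
      finally have "L (h n) < r" .
      moreover have "0 \<le> L (h n)" by (rule L_nonneg[OF ch h0])
      ultimately show "norm ((\<Sum>i<n. L (width (A i))) - L (width (\<Union>i. A i))) < r"
        unfolding Lh by simp
    qed
  qed
  then show "(\<Sum>i. ennreal (L (width (A i)))) = ennreal (L (width (\<Union>i. A i)))"
    by (rule suminf_ennreal_eq[rotated]) (rule L_nonneg[OF cA width_nonneg])
qed

theorem riesz_markov:
  "\<exists>M. sets M = sets borel \<and> finite_measure M \<and> (\<forall>f. continuous_on UNIV f \<longrightarrow> integral\<^sup>L M f = L f)"
proof -
  interpret semiring_of_sets UNIV strips by (rule semiring_strips)
  have "positive strips (\<lambda>A. ennreal (L (width A)))"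
    unfolding positive_def width_def by (simp add: L_zero)
  from caratheodory[OF this strips_countably_additive]
  obtain \<nu> where \<nu>: "\<And>s. s \<in> strips \<Longrightarrow> \<nu> s = ennreal (L (width s))"
    "measure_space UNIV (sigma_sets UNIV strips) \<nu>" by auto
  define N where "N = measure_of UNIV strips \<nu>"
  have setsN: "sets N = sigma_sets UNIV strips" and spaceN: "space N = UNIV"
    unfolding N_def by (simp_all add: sets_measure_of space_measure_of)
  have emN: "emeasure N X = \<nu> X" if "X \<in> sets N" for X
    using \<nu>(2) that setsN unfolding measure_space_def
    by (intro emeasure_measure_of[OF N_def]) auto
  have stripN: "strip f g \<in> sets N" "measure N (strip f g) = L (\<lambda>a. g a - f a)"
    "emeasure N (strip f g) \<noteq> \<infinity>"
    if fg: "continuous_on UNIV f" "continuous_on UNIV g" "\<And>a. f a \<le> g a" for f g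
  proof -
    have s: "strip f g \<in> strips" by (rule stripsI[OF fg])
    then show "strip f g \<in> sets N" unfolding setsN by auto
    then have em: "emeasure N (strip f g) = ennreal (L (width (strip f g)))"
      using emN \<nu>(1)[OF s] by simp
    then show "emeasure N (strip f g) \<noteq> \<infinity>" by simp
    have w: "width (strip f g) = (\<lambda>a. g a - f a)" using fg(3) by (auto simp: width_strip)
    have "0 \<le> L (\<lambda>a. g a - f a)" by (rule L_nonneg) (auto intro: continuous_on_diff fg)
    then show "measure N (strip f g) = L (\<lambda>a. g a - f a)" unfolding measure_def em w by simp
  qed
  define Q where "Q = (UNIV :: 'a set) \<times> {0..<1::real}"
  have Q: "Q = strip (\<lambda>_. 0) (\<lambda>_. 1)" unfolding Q_def strip_def by auto
  have QN: "Q \<in> sets N" and Qfin: "emeasure N Q \<noteq> \<infinity>"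
    unfolding Q by (rule stripN; auto intro: continuous_on_const)+
  define M where "M = distr (restrict_space N Q) borel fst"
  have fst_meas: "fst \<in> measurable (restrict_space N Q) borel"
  proof (rule borel_measurableI)
    fix U :: "'a set" assume "open U"
    then obtain \<phi> :: "'a \<Rightarrow> real" where \<phi>: "continuous_on UNIV \<phi>" "\<And>a. 0 \<le> \<phi> a" "U = {a. \<phi> a > 0}"
      using open_cozero[OF compact] by metis
    have "fst -` U \<inter> Q = (\<Union>n. strip (\<lambda>_. 0) (\<lambda>a. min 1 (real n * \<phi> a)))"
    proof (intro equalityI subsetI)
      fix p assume p: "p \<in> fst -` U \<inter> Q"
      obtain a t where at: "p = (a, t)" by (cases p)
      have "\<phi> a > 0" "0 \<le> t" "t < 1" using p at unfolding \<phi>(3) Q_def by auto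
      moreover obtain n where "t < real n * \<phi> a"
        using reals_Archimedean3[OF \<open>\<phi> a > 0\<close>] by blast
      ultimately have "p \<in> strip (\<lambda>_. 0) (\<lambda>a. min 1 (real n * \<phi> a))"
        unfolding at strip_def by simp
      then show "p \<in> (\<Union>n. strip (\<lambda>_. 0) (\<lambda>a. min 1 (real n * \<phi> a)))" by blast
    next
      fix p assume "p \<in> (\<Union>n. strip (\<lambda>_. 0) (\<lambda>a. min 1 (real n * \<phi> a)))"
      then obtain a t n where at: "p = (a, t)" "0 \<le> t" "t < 1" "t < real n * \<phi> a"
        unfolding strip_def by auto
      then have "\<phi> a \<noteq> 0" by auto
      with \<phi>(2)[of a] have "\<phi> a > 0" by simp
      with at show "p \<in> fst -` U \<inter> Q" unfolding Q_def \<phi>(3) by simp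
    qed
    also have "\<dots> \<in> sets N"
      by (intro sets.countable_UN image_subsetI stripN(1)) (auto intro!: continuous_intros \<phi>(1) mult_nonneg_nonneg \<phi>(2))
    finally show "fst -` U \<inter> space (restrict_space N Q) \<in> sets (restrict_space N Q)"
      using QN by (auto simp: sets_restrict_space_iff space_restrict_space spaceN)
  qed
  have setsM: "sets M = sets borel" unfolding M_def by simp
  have preN: "fst -` B \<inter> Q \<in> sets N" and emM: "emeasure M B = emeasure N (fst -` B \<inter> Q)" if "B \<in> sets borel" for B
  proof -
    have "fst -` B \<inter> space (restrict_space N Q) \<in> sets (restrict_space N Q)"
      using fst_meas that by (rule measurable_sets)
    then show 1: "fst -` B \<inter> Q \<in> sets N"
      using QN by (auto simp: sets_restrict_space_iff space_restrict_space spaceN)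
    show "emeasure M B = emeasure N (fst -` B \<inter> Q)"
      unfolding M_def using that QN fst_meas
      by (simp add: emeasure_distr emeasure_restrict_space space_restrict_space spaceN)
  qed
  have mM: "measure M B = measure N (fst -` B \<inter> Q)" if "B \<in> sets borel" for B
    using emM[OF that] by (simp add: measure_def)
  have fin: "emeasure N X \<noteq> \<infinity>" if "X \<subseteq> Q" for X
    using emeasure_mono[OF that QN] Qfin by (metis infinity_ennreal_def neq_top_trans)
  have spaceM: "space M = UNIV" unfolding M_def by simp
  have finM: "finite_measure M"
    by (rule finite_measureI) (use emM[of UNIV] fin spaceM in simp)
  interpret finite_measure M by (rule finM)
  \<comment> \<open>Comparing the strip below \<open>h\<close> with \<open>B \<times> [0, 1)\<close> bounds \<open>L h\<close> by measures of sets.\<close>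
  have upper: "L h \<le> measure M B"
    if h: "continuous_on UNIV h" "\<And>a. 0 \<le> h a" "\<And>a. h a \<le> 1" and B: "B \<in> sets borel" "\<And>a. a \<notin> B \<Longrightarrow> h a = 0" for h B
  proof -
    have "L h = measure N (strip (\<lambda>_. 0) h)"
      using stripN(2)[of "\<lambda>_. 0" h] h by (simp add: continuous_on_const)
    also have "\<dots> \<le> measure N (fst -` B \<inter> Q)"
    proof (rule measure_mono_fmeasurable)
      show "strip (\<lambda>_. 0) h \<subseteq> fst -` B \<inter> Q"
        using B(2) h(3) unfolding strip_def Q_def by (force intro: less_le_trans)
      show "strip (\<lambda>_. 0) h \<in> sets N" by (rule stripN) (use h in \<open>auto intro: continuous_on_const\<close>)
      show "fst -` B \<inter> Q \<in> fmeasurable N"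
        using preN[OF B(1)] fin[of "fst -` B \<inter> Q"] by (auto intro!: fmeasurableI simp: less_top)
    qed
    finally show ?thesis unfolding mM[OF B(1)] .
  qed
  have lower: "measure M B \<le> L h"
    if h: "continuous_on UNIV h" "\<And>a. 0 \<le> h a" and B: "B \<in> sets borel" "\<And>a. a \<in> B \<Longrightarrow> h a = 1" for h B
  proof -
    have "measure N (fst -` B \<inter> Q) \<le> measure N (strip (\<lambda>_. 0) h)"
    proof (rule measure_mono_fmeasurable)
      show "fst -` B \<inter> Q \<subseteq> strip (\<lambda>_. 0) h"
        using B(2) unfolding strip_def Q_def by force
      show "fst -` B \<inter> Q \<in> sets N" by (rule preN[OF B(1)])
      show "strip (\<lambda>_. 0) h \<in> fmeasurable N"
        using stripN(1,3)[of "\<lambda>_. 0" h] h by (auto intro!: fmeasurableI simp: less_top continuous_on_const)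
    qed
    also have "\<dots> = L h"
      using stripN(2)[of "\<lambda>_. 0" h] h by (simp add: continuous_on_const)
    finally show ?thesis unfolding mM[OF B(1)] .
  qed
  have meas: "f \<in> borel_measurable M" if "continuous_on UNIV f" for f :: "'a \<Rightarrow> real"
    using borel_measurable_continuous_onI[OF that] setsM measurable_cong_sets by blast
  have int: "integrable M f" if "continuous_on UNIV f" for f :: "'a \<Rightarrow> real"
  proof -
    have "bounded (range f)" using compact_continuous_image[OF that compact] by (rule compact_imp_bounded)
    then obtain K where "\<And>a. \<bar>f a\<bar> \<le> K" unfolding bounded_iff by auto
    then show ?thesis using meas[OF that] by (intro integrable_const_bound[of _ K]) auto
  qed
  have unit: "integral\<^sup>L M f = L f" if f: "continuous_on UNIV f" "\<And>a. 0 \<le> f a" "\<And>a. f a \<le> 1" for f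
  proof -
    \<comment> \<open>Both \<open>L\<close> and the integral take each slice of \<open>n f\<close> between two consecutive level sets, so the errors telescope.\<close>
    have bound: "real n * \<bar>L f - integral\<^sup>L M f\<bar> \<le> measure M UNIV" for n
    proof -
      define h where "h k a = min (max (real n * f a - real k) 0) 1" for k a
      define B where "B k = {a. real n * f a > real k}" for k
      have ch: "continuous_on UNIV (h k)" for k unfolding h_def by (intro continuous_intros f)
      have h: "0 \<le> h k a" "h k a \<le> 1" for k a unfolding h_def by auto
      have B: "B k \<in> sets borel" for k
        unfolding B_def by (intro borel_open open_Collect_less continuous_intros f)
      have off: "a \<notin> B k \<Longrightarrow> h k a = 0" for k a unfolding B_def h_def by auto
      have on: "a \<in> B (Suc k) \<Longrightarrow> h k a = 1" for k a unfolding B_def h_def by auto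
      have ii: "integrable M (indicator (B k) :: 'a \<Rightarrow> real)" for k
        using B[of k] setsM by (intro integrable_real_indicator) (auto simp: less_top[symmetric])
      have iu: "integral\<^sup>L M (h k) \<le> measure M (B k)" for k
      proof -
        have "integral\<^sup>L M (h k) \<le> integral\<^sup>L M (indicator (B k))"
          using h off by (intro integral_mono int[OF ch] ii) (auto simp: indicator_def)
        then show ?thesis using B setsM by simp
      qed
      have il: "measure M (B (Suc k)) \<le> integral\<^sup>L M (h k)" for k
      proof -
        have "integral\<^sup>L M (indicator (B (Suc k))) \<le> integral\<^sup>L M (h k)"
          using h on by (intro integral_mono int[OF ch] ii) (auto simp: indicator_def)
        then show ?thesis using B setsM by simp
      qed
      have slices: "(\<Sum>k<n. h k a) = real n * f a" for a
        unfolding h_def using f(2,3)[of a] by (subst sum_unit_slices) (auto simp: mult_left_le)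
      have "real n * L f = (\<Sum>k<n. L (h k))"
        unfolding L_scale[OF f(1), symmetric] slices[symmetric] by (rule L_sum[OF ch])
      moreover have "real n * integral\<^sup>L M f = (\<Sum>k<n. integral\<^sup>L M (h k))"
        unfolding integral_mult_right_zero[symmetric] slices[symmetric] by (rule Bochner_Integration.integral_sum[OF int[OF ch]])
      ultimately have "(\<Sum>k<n. L (h k) - integral\<^sup>L M (h k)) = real n * (L f - integral\<^sup>L M f)"
        by (simp add: sum_subtractf right_diff_distrib)
      then have "real n * \<bar>L f - integral\<^sup>L M f\<bar> = \<bar>\<Sum>k<n. L (h k) - integral\<^sup>L M (h k)\<bar>"
        by (simp add: abs_mult)
      also have "\<dots> \<le> (\<Sum>k<n. \<bar>L (h k) - integral\<^sup>L M (h k)\<bar>)" by (rule sum_abs)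
      also have "\<dots> \<le> (\<Sum>k<n. measure M (B k) - measure M (B (Suc k)))"
      proof (rule sum_mono)
        fix k
        show "\<bar>L (h k) - integral\<^sup>L M (h k)\<bar> \<le> measure M (B k) - measure M (B (Suc k))"
          using iu[of k] il[of k] upper[of "h k" "B k", OF ch h B off] lower[of "h k" "B (Suc k)", OF ch h(1) B on]
          by simp
      qed
      also have "\<dots> = measure M (B 0) - measure M (B n)"
        by (rule sum_lessThan_telescope')
      also have "\<dots> \<le> measure M UNIV"
        using bounded_measure[of "B 0"] measure_nonneg[of M "B n"] unfolding spaceM by linarith
      finally show ?thesis .
    qed
    show ?thesis
    proof (rule ccontr)
      assume "\<not> ?thesis"
      then have "\<bar>L f - integral\<^sup>L M f\<bar> > 0" by simp
      then obtain n where "measure M UNIV < real n * \<bar>L f - integral\<^sup>L M f\<bar>"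
        using reals_Archimedean3 by blast
      with bound[of n] show False by simp
    qed
  qed
  have "integral\<^sup>L M f = L f" if f: "continuous_on UNIV f" for f
  proof -
    have "bounded (range f)" using compact_continuous_image[OF f compact] by (rule compact_imp_bounded)
    then obtain K where K: "\<And>a. \<bar>f a\<bar> \<le> K" unfolding bounded_iff by auto
    \<comment> \<open>Shifting and scaling brings the values of \<open>f\<close> into \<open>[0, 1]\<close>.\<close>
    define c where "c = 2 * (\<bar>K\<bar> + 1)"
    have c: "c > 0" unfolding c_def by simp
    define g where "g a = 1 / c * (f a + c / 2)" for a
    have cg: "continuous_on UNIV g" unfolding g_def by (intro continuous_intros f)
    have "0 \<le> g a" "g a \<le> 1" for a
      using K[of a] unfolding g_def c_def by (auto simp: field_simps)
    then have eq: "integral\<^sup>L M g = L g" by (rule unit[OF cg])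
    have one: "integral\<^sup>L M (\<lambda>_. 1) = L (\<lambda>_. 1)" by (rule unit) (auto intro: continuous_on_const)
    have fg: "f a = c * g a - c / 2 * 1" for a unfolding g_def using c by (simp add: field_simps)
    have "L f = L (\<lambda>a. c * g a - c / 2 * 1)" by (simp only: fg[symmetric])
    also have "\<dots> = c * L g - c / 2 * L (\<lambda>_. 1)"
      unfolding L_scale[OF cg, of c, symmetric] L_scale[OF continuous_on_const, of "c / 2" 1, symmetric]
      by (rule L_diff) (intro continuous_intros cg)+
    also have "\<dots> = integral\<^sup>L M (\<lambda>a. c * g a) - integral\<^sup>L M (\<lambda>a. c / 2 * 1)"
      by (simp only: integral_mult_right_zero eq one)
    also have "\<dots> = integral\<^sup>L M (\<lambda>a. c * g a - c / 2 * 1)"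
      by (rule Bochner_Integration.integral_diff[symmetric]) (intro int continuous_intros cg)+
    also have "\<dots> = integral\<^sup>L M f" by (simp only: fg[symmetric])
    finally show ?thesis by simp
  qed
  with setsM finM show ?thesis by blast
qed

end

section \<open>Integration against quantum probability measures\<close>

subsection \<open>Approximation by finitely valued functions\<close>

definition finite_borel_measure :: "'a::topological_space measure \<Rightarrow> bool"
  where "finite_borel_measure M \<longleftrightarrow> finite_measure M \<and> sets M = sets borel"

lemma finite_borel_measureD:
  assumes "finite_borel_measure M"
  shows "finite_measure M" "sets M = sets borel" "space M = UNIV"
    "f \<in> borel_measurable borel \<Longrightarrow> f \<in> borel_measurable M"
  using assms sets_eq_imp_space_eq[of M borel] measurable_cong_sets[of M borel borel borel]
  by (auto simp: finite_borel_measure_def)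

lemma finite_borel_integrable:
  fixes f :: "'a::topological_space \<Rightarrow> 'b::{banach, second_countable_topology}"
  assumes M: "finite_borel_measure M" and f: "f \<in> borel_measurable borel" "\<And>a. norm (f a) \<le> K"
  shows "integrable M f"
proof -
  interpret finite_measure M using M by (rule finite_borel_measureD)
  show ?thesis using f(2) finite_borel_measureD(4)[OF M f(1)] by (intro integrable_const_bound[of _ K]) auto
qed

lemma finite_borel_dominated:
  fixes f :: "'a::topological_space \<Rightarrow> 'b::{banach, second_countable_topology}"
  assumes M: "finite_borel_measure M" and F: "\<And>m. F m \<in> borel_measurable borel" "\<And>m a. norm (F m a) \<le> K"
    and lim: "\<And>a. (\<lambda>m. F m a) \<longlonglongrightarrow> f a"
  shows "(\<lambda>m. integral\<^sup>L M (F m)) \<longlonglongrightarrow> integral\<^sup>L M f"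
proof -
  interpret finite_measure M using M by (rule finite_borel_measureD)
  have "f \<in> borel_measurable borel" using F(1) lim by (rule borel_measurable_LIMSEQ_metric)
  then show ?thesis
    using F lim by (intro integral_dominated_convergence[where w = "\<lambda>_. K"] finite_borel_measureD(4)[OF M]) auto
qed

lemma integral_finitely_valued:
  fixes \<phi> :: "'z \<Rightarrow> complex"
  assumes M: "finite_borel_measure M" and G: "finite (range G)" "\<And>z. G -` {z} \<in> sets borel"
  shows "integral\<^sup>L M (\<lambda>a. \<phi> (G a)) = (\<Sum>z\<in>range G. \<phi> z * complex_of_real (measure M (G -` {z})))"
proof -
  interpret finite_measure M using M by (rule finite_borel_measureD)
  have eq: "\<phi> (G a) = (\<Sum>z\<in>range G. indicator (G -` {z}) a *\<^sub>R \<phi> z)" for a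
  proof -
    have "(\<Sum>z\<in>range G. indicator (G -` {z}) a *\<^sub>R \<phi> z) = (\<Sum>z\<in>range G. if z = G a then \<phi> (G a) else 0)"
      by (intro sum.cong) (auto simp: indicator_def)
    also have "\<dots> = \<phi> (G a)" using G(1) by simp
    finally show ?thesis by simp
  qed
  have Gm: "G -` {z} \<in> sets M" for z using G(2) finite_borel_measureD(2)[OF M] by simp
  have i: "integrable M (\<lambda>a. indicator (G -` {z}) a *\<^sub>R \<phi> z)" for z
    using Gm emeasure_finite by (intro integrable_scaleR_left integrable_real_indicator) (auto simp: less_top[symmetric])
  have "integral\<^sup>L M (\<lambda>a. \<phi> (G a)) = (\<Sum>z\<in>range G. integral\<^sup>L M (\<lambda>a. indicator (G -` {z}) a *\<^sub>R \<phi> z))"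
    unfolding eq by (rule Bochner_Integration.integral_sum[OF i])
  also have "\<dots> = (\<Sum>z\<in>range G. \<phi> z * complex_of_real (measure M (G -` {z})))"
    using Gm finite_borel_measureD(3)[OF M] by (intro sum.cong) (auto simp: scaleR_conv_of_real)
  finally show ?thesis .
qed

lemma finitely_valued_approximation:
  fixes f :: "'a::topological_space \<Rightarrow> complex"
  assumes "f \<in> borel_measurable borel" "\<And>a. cmod (f a) \<le> K"
  shows "\<exists>F. (\<forall>m. finite (range (F m)) \<and> F m \<in> borel_measurable borel) \<and>
    (\<forall>m a. cmod (F m a) \<le> 2 * K) \<and> (\<forall>a. (\<lambda>m. F m a) \<longlonglongrightarrow> f a)"
proof -
  obtain F where F: "\<And>i. simple_function borel (F i)" "\<And>a. (\<lambda>i. F i a) \<longlonglongrightarrow> f a"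
    "\<And>i a. dist (F i a) 0 \<le> 2 * dist (f a) 0"
    using borel_measurable_implies_sequence_metric[OF assms(1), of 0] by auto
  have "cmod (F i a) \<le> 2 * K" for i a
    using F(3)[of i a] assms(2)[of a] by simp
  moreover have "finite (range (F i))" "F i \<in> borel_measurable borel" for i
    using simple_functionD(1)[OF F(1)] borel_measurable_simple_function[OF F(1)] by auto
  ultimately show ?thesis using F(2) by blast
qed

text \<open>Finitely many functions are approximated simultaneously along one finite partition.  The
  weights and the partition do not depend on the measure, so the approximation transfers to
  operator-valued measures.\<close>

lemma joint_partition_approximation:
  fixes h :: "nat \<Rightarrow> 'a::topological_space \<Rightarrow> complex"
  assumes h: "\<And>i. h i \<in> borel_measurable borel" "\<And>i a. cmod (h i a) \<le> K"
  obtains Z :: "nat \<Rightarrow> (nat \<Rightarrow> complex) set" and T where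
    "\<And>m. finite (Z m)" "\<And>m z. T m z \<in> sets borel"
    "\<And>M i. finite_borel_measure M \<Longrightarrow> i < n \<Longrightarrow>
      (\<lambda>m. \<Sum>z\<in>Z m. z i * complex_of_real (measure M (T m z))) \<longlonglongrightarrow> integral\<^sup>L M (h i)"
    "\<And>M i j. finite_borel_measure M \<Longrightarrow> i < n \<Longrightarrow> j < n \<Longrightarrow>
      (\<lambda>m. \<Sum>z\<in>Z m. (cnj (z i) * z j) * complex_of_real (measure M (T m z)))
        \<longlonglongrightarrow> integral\<^sup>L M (\<lambda>a. cnj (h i a) * h j a)"
proof -
  have "\<forall>i. \<exists>F. (\<forall>m. finite (range (F m)) \<and> F m \<in> borel_measurable borel) \<and>
    (\<forall>m a. cmod (F m a) \<le> 2 * K) \<and> (\<forall>a. (\<lambda>m. F m a) \<longlonglongrightarrow> h i a)"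
    using finitely_valued_approximation[OF h] by blast
  then obtain F where F: "\<And>i m. finite (range (F i m))" "\<And>i m. F i m \<in> borel_measurable borel"
    "\<And>i m a. cmod (F i m a) \<le> 2 * K" "\<And>i a. (\<lambda>m. F i m a) \<longlonglongrightarrow> h i a" by metis
  define G where "G m a = (\<lambda>i. if i < n then F i m a else 0)" for m a
  have GF: "i < n \<Longrightarrow> G m a i = F i m a" for m a i by (simp add: G_def)
  have fin: "finite (range (G m))" for m
  proof (rule finite_subset)
    show "range (G m) \<subseteq> {g. \<forall>i. (i \<in> {..<n} \<longrightarrow> g i \<in> (\<Union>i<n. range (F i m))) \<and> (i \<notin> {..<n} \<longrightarrow> g i = 0)}"
    proof (rule image_subsetI, rule CollectI, intro allI conjI impI)
      fix a i assume "i \<in> {..<n}"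
      then show "G m a i \<in> (\<Union>i<n. range (F i m))"
        by (intro UN_I[of i]) (auto simp: G_def)
    qed (simp add: G_def)
    show "finite {g. \<forall>i. (i \<in> {..<n} \<longrightarrow> g i \<in> (\<Union>i<n. range (F i m))) \<and> (i \<notin> {..<n} \<longrightarrow> g i = 0)}"
      by (rule finite_set_of_finite_funs) (use F(1) in auto)
  qed
  have meas: "G m -` {z} \<in> sets borel" for m z
  proof (cases "\<forall>i. i \<ge> n \<longrightarrow> z i = 0")
    case True
    then have "G m -` {z} = (\<Inter>i\<in>{..<n}. F i m -` {z i}) \<inter> UNIV"
      by (auto simp: G_def fun_eq_iff not_less)
    also have "\<dots> \<in> sets borel"
    proof (cases "n = 0")
      case False
      have "F i m -` {z i} \<in> sets borel" for i
        using measurable_sets[OF F(2), of "{z i}" i m] by simp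
      with False show ?thesis by (intro sets.Int sets.finite_INT) auto
    qed simp
    finally show ?thesis .
  next
    case False
    then have "G m -` {z} = {}" by (auto simp: G_def fun_eq_iff)
    then show ?thesis by simp
  qed
  show ?thesis
  proof (rule that[of "\<lambda>m. range (G m)" "\<lambda>m z. G m -` {z}"])
    fix M :: "'a measure" and i assume M: "finite_borel_measure M" and i: "i < n"
    have "(\<lambda>m. integral\<^sup>L M (\<lambda>a. F i m a)) \<longlonglongrightarrow> integral\<^sup>L M (h i)"
      by (rule finite_borel_dominated[OF M F(2,3,4)])
    then show "(\<lambda>m. \<Sum>z\<in>range (G m). z i * complex_of_real (measure M (G m -` {z}))) \<longlonglongrightarrow> integral\<^sup>L M (h i)"
      unfolding integral_finitely_valued[OF M fin meas, symmetric, where \<phi> = "\<lambda>z. z i"] GF[OF i] .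
  next
    fix M :: "'a measure" and i j assume M: "finite_borel_measure M" and i: "i < n" and j: "j < n"
    have "(\<lambda>m. integral\<^sup>L M (\<lambda>a. cnj (F i m a) * F j m a)) \<longlonglongrightarrow> integral\<^sup>L M (\<lambda>a. cnj (h i a) * h j a)"
    proof (rule finite_borel_dominated[OF M])
      show "(\<lambda>a. cnj (F i m a) * F j m a) \<in> borel_measurable borel" for m
        by (intro borel_measurable_times F(2) measurable_compose[OF F(2)] borel_measurable_continuous_onI continuous_intros)
      show "norm (cnj (F i m a) * F j m a) \<le> (2 * K) * (2 * K)" for m a
        unfolding norm_mult complex_mod_cnj by (intro mult_mono F(3)) (use order_trans[OF norm_ge_zero F(3)] in auto)
      show "(\<lambda>m. cnj (F i m a) * F j m a) \<longlonglongrightarrow> cnj (h i a) * h j a" for a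
        by (intro tendsto_intros F(4))
    qed
    then show "(\<lambda>m. \<Sum>z\<in>range (G m). (cnj (z i) * z j) * complex_of_real (measure M (G m -` {z})))
        \<longlonglongrightarrow> integral\<^sup>L M (\<lambda>a. cnj (h i a) * h j a)"
      unfolding integral_finitely_valued[OF M fin meas, symmetric, where \<phi> = "\<lambda>z. cnj (z i) * z j"] GF[OF i] GF[OF j] .
  qed (use fin meas in auto)
qed

subsection \<open>The scalar measures of a quantum probability measure\<close>

definition qmeasure :: "('a::topological_space set \<Rightarrow> 'h \<Rightarrow> 'h::complex_hilbert_space) \<Rightarrow> 'h \<Rightarrow> 'a measure"
  where "qmeasure E \<xi> = measure_of UNIV (sets borel) (\<lambda>\<alpha>. ennreal (Re (cinner (E \<alpha> \<xi>) \<xi>)))"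

text \<open>The value of \<open>\<integral> f dE\<^bsub>\<xi>,\<eta>\<^esub>\<close>, by polarization from the positive measures \<open>E\<^bsub>\<zeta>,\<zeta>\<^esub>\<close>.\<close>

definition qintegral :: "('a::topological_space set \<Rightarrow> 'h \<Rightarrow> 'h::complex_hilbert_space) \<Rightarrow> ('a \<Rightarrow> complex) \<Rightarrow> 'h \<Rightarrow> 'h \<Rightarrow> complex"
  where "qintegral E f \<xi> \<eta> = (\<Sum>k<4. \<i> ^ k * integral\<^sup>L (qmeasure E (\<xi> + scaleC (\<i> ^ k) \<eta>)) f) / 4"

lemma quantum_probD:
  assumes "E \<in> quantum_prob"
  shows "\<alpha> \<in> sets borel \<Longrightarrow> positive_op (E \<alpha>)" "E {} = (\<lambda>\<xi>. 0)" "E UNIV = (\<lambda>\<xi>. \<xi>)"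
    "range \<delta> \<subseteq> sets borel \<Longrightarrow> disjoint_family \<delta> \<Longrightarrow> (\<lambda>n. E (\<delta> n) \<xi>) sums E (\<Union>n. \<delta> n) \<xi>"
  using assms unfolding quantum_prob_def by blast+

lemma qmeasure:
  assumes E: "E \<in> quantum_prob"
  shows "finite_borel_measure (qmeasure E \<xi>)"
    and "\<alpha> \<in> sets borel \<Longrightarrow> complex_of_real (measure (qmeasure E \<xi>) \<alpha>) = cinner (E \<alpha> \<xi>) \<xi>"
    and "measure (qmeasure E \<xi>) UNIV = (norm \<xi>)\<^sup>2"
proof -
  have sets: "sets (qmeasure E \<xi>) = sets borel" and space: "space (qmeasure E \<xi>) = UNIV"
    unfolding qmeasure_def using sets.sets_measure_of_eq[of borel] sets.space_measure_of_eq[of borel] by simp_all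
  have em: "emeasure (qmeasure E \<xi>) \<alpha> = ennreal (Re (cinner (E \<alpha> \<xi>) \<xi>))" if "\<alpha> \<in> sets borel" for \<alpha>
  proof (rule emeasure_measure_of[OF qmeasure_def])
    show "positive (sets (qmeasure E \<xi>)) (\<lambda>\<alpha>. ennreal (Re (cinner (E \<alpha> \<xi>) \<xi>)))"
      unfolding positive_def by (simp add: quantum_probD(2)[OF E])
    show "countably_additive (sets (qmeasure E \<xi>)) (\<lambda>\<alpha>. ennreal (Re (cinner (E \<alpha> \<xi>) \<xi>)))"
      unfolding countably_additive_def sets
    proof (intro allI impI)
      fix \<delta> :: "nat \<Rightarrow> 'a set" assume \<delta>: "range \<delta> \<subseteq> sets borel" "disjoint_family \<delta>"
      have "bounded_linear (\<lambda>v. Re (cinner v \<xi>))"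
        by (rule bounded_linear_compose[OF bounded_linear_Re bounded_linear_cinner_left])
      then have "(\<lambda>n. Re (cinner (E (\<delta> n) \<xi>) \<xi>)) sums Re (cinner (E (\<Union>n. \<delta> n) \<xi>) \<xi>)"
        by (rule bounded_linear.sums[OF _ quantum_probD(4)[OF E \<delta>]])
      then show "(\<Sum>n. ennreal (Re (cinner (E (\<delta> n) \<xi>) \<xi>))) = ennreal (Re (cinner (E (\<Union>n. \<delta> n) \<xi>) \<xi>))"
        by (rule suminf_ennreal_eq[rotated]) (use \<delta>(1) quantum_probD(1)[OF E] positive_op_cinner(2) in blast)
    qed
  qed (use that sets in auto)
  show "finite_borel_measure (qmeasure E \<xi>)"
    unfolding finite_borel_measure_def using sets by (auto intro!: finite_measureI simp: space em)
  show m: "complex_of_real (measure (qmeasure E \<xi>) \<alpha>) = cinner (E \<alpha> \<xi>) \<xi>" if "\<alpha> \<in> sets borel" for \<alpha>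
    unfolding measure_def em[OF that] using positive_op_cinner[OF quantum_probD(1)[OF E that], of \<xi>] by simp
  have "complex_of_real (measure (qmeasure E \<xi>) UNIV) = complex_of_real ((norm \<xi>)\<^sup>2)"
    using m[of UNIV] unfolding quantum_probD(3)[OF E] cinner_self by simp
  then show "measure (qmeasure E \<xi>) UNIV = (norm \<xi>)\<^sup>2" unfolding of_real_eq_iff .
qed

text \<open>By polarization every limit formula valid for all finite positive measures holds for \<open>E\<^bsub>\<xi>,\<eta>\<^esub>\<close>.\<close>

lemma qintegral_limit:
  assumes E: "E \<in> quantum_prob" and T: "\<And>m z. T m z \<in> sets borel"
    and lim: "\<And>M. finite_borel_measure M \<Longrightarrow>
      (\<lambda>m. \<Sum>z\<in>Z m. w z * complex_of_real (measure M (T m z))) \<longlonglongrightarrow> integral\<^sup>L M f"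
  shows "(\<lambda>m. \<Sum>z\<in>Z m. w z * cinner (E (T m z) \<xi>) \<eta>) \<longlonglongrightarrow> qintegral E f \<xi> \<eta>"
proof -
  have "(\<Sum>z\<in>Z m. w z * cinner (E (T m z) \<xi>) \<eta>)
    = (\<Sum>k<4. \<i> ^ k * (\<Sum>z\<in>Z m. w z * complex_of_real (measure (qmeasure E (\<xi> + scaleC (\<i> ^ k) \<eta>)) (T m z)))) / 4" for m
  proof -
    have "w z * cinner (E (T m z) \<xi>) \<eta> = (\<Sum>k<4. \<i> ^ k * (w z * complex_of_real (measure (qmeasure E (\<xi> + scaleC (\<i> ^ k) \<eta>)) (T m z)))) / 4" for z
      unfolding polarization[OF positive_op_bounded[OF quantum_probD(1)[OF E T[of m z]]], of \<xi> \<eta>] qmeasure(2)[OF E T]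
      by (simp add: sum_distrib_left mult.left_commute)
    then have "(\<Sum>z\<in>Z m. w z * cinner (E (T m z) \<xi>) \<eta>) = (\<Sum>z\<in>Z m. \<Sum>k<4. \<i> ^ k * (w z * complex_of_real (measure (qmeasure E (\<xi> + scaleC (\<i> ^ k) \<eta>)) (T m z)))) / 4"
      by (simp add: sum_divide_distrib)
    then show ?thesis by (subst (asm) sum.swap) (simp add: sum_distrib_left)
  qed
  then show ?thesis
    unfolding qintegral_def by (simp only:) (intro tendsto_intros lim qmeasure(1)[OF E], simp)
qed

lemma qintegral_approx:
  fixes f :: "'a::topological_space \<Rightarrow> complex"
  assumes f: "f \<in> borel_measurable borel" "\<And>a. cmod (f a) \<le> K"
  obtains Z :: "nat \<Rightarrow> (nat \<Rightarrow> complex) set" and w T where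
    "\<And>m. finite (Z m)" "\<And>m z. T m z \<in> sets borel"
    "\<And>M. finite_borel_measure M \<Longrightarrow>
      (\<lambda>m. \<Sum>z\<in>Z m. w z * complex_of_real (measure M (T m z))) \<longlonglongrightarrow> integral\<^sup>L M f"
    "\<And>(E :: 'a set \<Rightarrow> 'h \<Rightarrow> 'h::complex_hilbert_space) \<xi> \<eta>. E \<in> quantum_prob \<Longrightarrow>
       (\<lambda>m. \<Sum>z\<in>Z m. w z * cinner (E (T m z) \<xi>) \<eta>) \<longlonglongrightarrow> qintegral E f \<xi> \<eta>"
proof -
  obtain Z :: "nat \<Rightarrow> (nat \<Rightarrow> complex) set" and T where ZT:
    "\<And>m. finite (Z m)" "\<And>m z. T m z \<in> sets borel"
    "\<And>M i. finite_borel_measure M \<Longrightarrow> i < 1 \<Longrightarrow>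
      (\<lambda>m. \<Sum>z\<in>Z m. z i * complex_of_real (measure M (T m z))) \<longlonglongrightarrow> integral\<^sup>L M f"
    by (rule joint_partition_approximation[of "\<lambda>_. f" K 1, OF f]) blast
  show ?thesis
    by (rule that[of Z T "\<lambda>z. z 0"]) (use ZT in \<open>auto intro!: qintegral_limit\<close>)
qed

context
  fixes E :: "'a::topological_space set \<Rightarrow> 'h \<Rightarrow> 'h::complex_hilbert_space" and f :: "'a \<Rightarrow> complex" and K :: real
  assumes E: "E \<in> quantum_prob" and f: "f \<in> borel_measurable borel" "\<And>a. cmod (f a) \<le> K"
begin

text \<open>All these hold for each \<open>\<langle>E(T) \<xi>, \<eta>\<rangle>\<close>, hence for the approximating sums and in the limit.\<close>

lemma qintegral_sesquilinear:
  "qintegral E f (\<xi> + \<xi>') \<eta> = qintegral E f \<xi> \<eta> + qintegral E f \<xi>' \<eta>"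
  "qintegral E f (scaleC c \<xi>) \<eta> = c * qintegral E f \<xi> \<eta>"
  "qintegral E f \<xi> (\<eta> + \<eta>') = qintegral E f \<xi> \<eta> + qintegral E f \<xi> \<eta>'"
  "qintegral E f \<xi> (scaleC c \<eta>) = cnj c * qintegral E f \<xi> \<eta>"
  "qintegral E f \<xi> \<xi> = integral\<^sup>L (qmeasure E \<xi>) f"
  "qintegral E (\<lambda>a. cnj (f a)) \<eta> \<xi> = cnj (qintegral E f \<xi> \<eta>)"
proof -
  obtain Z :: "nat \<Rightarrow> (nat \<Rightarrow> complex) set" and w T where T: "\<And>m z. T m z \<in> sets borel"
    and M: "\<And>M. finite_borel_measure M \<Longrightarrow>
      (\<lambda>m. \<Sum>z\<in>Z m. w z * complex_of_real (measure M (T m z))) \<longlonglongrightarrow> integral\<^sup>L M f"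
    and l: "\<And>(E :: 'a set \<Rightarrow> 'h \<Rightarrow> 'h) \<xi> \<eta>. E \<in> quantum_prob \<Longrightarrow>
       (\<lambda>m. \<Sum>z\<in>Z m. w z * cinner (E (T m z) \<xi>) \<eta>) \<longlonglongrightarrow> qintegral E f \<xi> \<eta>"
    by (rule qintegral_approx[OF f, where 'h = 'h]) blast
  note l = l[OF E] and B = bounded_opD[OF positive_op_bounded[OF quantum_probD(1)[OF E T]]]
  show "qintegral E f (\<xi> + \<xi>') \<eta> = qintegral E f \<xi> \<eta> + qintegral E f \<xi>' \<eta>"
    by (rule LIMSEQ_unique[OF l]) (use tendsto_add[OF l[of \<xi> \<eta>] l[of \<xi>' \<eta>]] in
      \<open>simp add: B(2) cinner_add_left distrib_left sum.distrib\<close>)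
  show "qintegral E f (scaleC c \<xi>) \<eta> = c * qintegral E f \<xi> \<eta>"
    by (rule LIMSEQ_unique[OF l]) (use tendsto_mult_left[OF l[of \<xi> \<eta>], of c] in
      \<open>simp add: B(3) cinner_scaleC_left sum_distrib_left mult.left_commute\<close>)
  show "qintegral E f \<xi> (\<eta> + \<eta>') = qintegral E f \<xi> \<eta> + qintegral E f \<xi> \<eta>'"
    by (rule LIMSEQ_unique[OF l]) (use tendsto_add[OF l[of \<xi> \<eta>] l[of \<xi> \<eta>']] in
      \<open>simp add: cinner_add_right distrib_left sum.distrib\<close>)
  show "qintegral E f \<xi> (scaleC c \<eta>) = cnj c * qintegral E f \<xi> \<eta>"
    by (rule LIMSEQ_unique[OF l]) (use tendsto_mult_left[OF l[of \<xi> \<eta>], of "cnj c"] in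
      \<open>simp add: cinner_scaleC_right sum_distrib_left mult.left_commute\<close>)
  show "qintegral E f \<xi> \<xi> = integral\<^sup>L (qmeasure E \<xi>) f"
    by (rule LIMSEQ_unique[OF l]) (use M[OF qmeasure(1)[OF E, of \<xi>]] in \<open>simp add: qmeasure(2)[OF E T]\<close>)
  have c: "(\<lambda>m. \<Sum>z\<in>Z m. cnj (w z) * cinner (E (T m z) \<eta>) \<xi>) \<longlonglongrightarrow> qintegral E (\<lambda>a. cnj (f a)) \<eta> \<xi>"
  proof (rule qintegral_limit[OF E T])
    show "(\<lambda>m. \<Sum>z\<in>Z m. cnj (w z) * complex_of_real (measure M' (T m z))) \<longlonglongrightarrow> (\<integral>a. cnj (f a) \<partial>M')"
      if "finite_borel_measure M'" for M'
      using tendsto_cnj[OF M[OF that]] by (simp add: integral_cnj)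
  qed
  show "qintegral E (\<lambda>a. cnj (f a)) \<eta> \<xi> = cnj (qintegral E f \<xi> \<eta>)"
  proof (rule LIMSEQ_unique[OF c])
    have "cinner (E (T m z) \<eta>) \<xi> = cnj (cinner (E (T m z) \<xi>) \<eta>)" for m z
      using positive_op_self_adjoint[OF quantum_probD(1)[OF E T], of m z \<eta> \<xi>] cinner_commute[of \<eta> "E (T m z) \<xi>"]
      by simp
    then show "(\<lambda>m. \<Sum>z\<in>Z m. cnj (w z) * cinner (E (T m z) \<eta>) \<xi>) \<longlonglongrightarrow> cnj (qintegral E f \<xi> \<eta>)"
      using tendsto_cnj[OF l[of \<xi> \<eta>]] by simp
  qed
qed

end

lemma sesquilinear_polarization:
  fixes s :: "'h::complex_hilbert_space \<Rightarrow> 'h \<Rightarrow> complex"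
  assumes s: "\<And>x y z. s (x + y) z = s x z + s y z" "\<And>c x z. s (scaleC c x) z = c * s x z"
    "\<And>x y z. s x (y + z) = s x y + s x z" "\<And>c x z. s x (scaleC c z) = cnj c * s x z"
  shows "s u v = (\<Sum>k<4. \<i> ^ k * s (u + scaleC (\<i> ^ k) v) (u + scaleC (\<i> ^ k) v)) / 4"
  by (simp only: s) (simp add: eval_nat_numeral algebra_simps)

text \<open>For unit vectors the four polarization terms have norm at most \<open>K 2\<^sup>2\<close> each, whence the factor 4.\<close>

lemma form_bound_from_quadratic:
  fixes s :: "'h::complex_hilbert_space \<Rightarrow> 'h \<Rightarrow> complex"
  assumes s: "\<And>x y z. s (x + y) z = s x z + s y z" "\<And>c x z. s (scaleC c x) z = c * s x z"
    "\<And>x y z. s x (y + z) = s x y + s x z" "\<And>c x z. s x (scaleC c z) = cnj c * s x z"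
    and q: "\<And>x. cmod (s x x) \<le> K * (norm x)\<^sup>2"
  shows "cmod (s x y) \<le> 4 * K * norm x * norm y"
proof -
  note pol = sesquilinear_polarization[where s = s, OF s]
  have unit: "cmod (s u v) \<le> 4 * K" if u: "norm u = 1" and v: "norm v = 1" for u v
  proof -
    have K: "K \<ge> 0" using order_trans[OF norm_ge_zero q[of u]] u by simp
    have n: "norm (u + scaleC (\<i> ^ k) v) \<le> 2" for k
      using norm_triangle_ineq[of u "scaleC (\<i> ^ k) v"] by (simp add: norm_scaleC norm_power u v)
    have "cmod (s u v) * 4 = cmod (\<Sum>k<4. \<i> ^ k * s (u + scaleC (\<i> ^ k) v) (u + scaleC (\<i> ^ k) v))"
      unfolding pol[of u v] by (simp add: norm_divide)
    also have "\<dots> \<le> (\<Sum>k<(4::nat). K * 2\<^sup>2)"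
    proof (rule sum_norm_le)
      fix k :: nat
      have "norm (\<i> ^ k * s (u + scaleC (\<i> ^ k) v) (u + scaleC (\<i> ^ k) v)) \<le> K * (norm (u + scaleC (\<i> ^ k) v))\<^sup>2"
        using q by (simp add: norm_mult norm_power)
      also have "\<dots> \<le> K * 2\<^sup>2" by (intro mult_left_mono power_mono n K) simp
      finally show "norm (\<i> ^ k * s (u + scaleC (\<i> ^ k) v) (u + scaleC (\<i> ^ k) v)) \<le> K * 2\<^sup>2" .
    qed
    finally show ?thesis by simp
  qed
  show ?thesis
  proof (cases "x = 0 \<or> y = 0")
    case True
    have "s 0 y = 0" "s x 0 = 0" using s(2)[of 0 0 y] s(4)[of x 0 0] by simp_all
    with True show ?thesis by auto
  next
    case False
    define u where "u = scaleC (complex_of_real (1 / norm x)) x"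
    define v where "v = scaleC (complex_of_real (1 / norm y)) y"
    have uv: "norm u = 1" "norm v = 1" using False by (simp_all add: u_def v_def norm_scaleC norm_divide)
    have x: "x = scaleC (complex_of_real (norm x)) u" and y: "y = scaleC (complex_of_real (norm y)) v"
      using False by (simp_all add: u_def v_def scaleC_scaleC)
    have "cmod (s x y) = norm x * norm y * cmod (s u v)"
      by (subst x, subst y) (simp add: s norm_mult)
    also have "\<dots> \<le> norm x * norm y * (4 * K)"
      by (intro mult_left_mono unit uv) simp
    finally show ?thesis by (simp add: mult_ac)
  qed
qed

definition qop :: "('a::topological_space set \<Rightarrow> 'h \<Rightarrow> 'h::complex_hilbert_space) \<Rightarrow> ('a \<Rightarrow> complex) \<Rightarrow> 'h \<Rightarrow> 'h"
  where "qop E f = (SOME T. bounded_op T \<and> (\<forall>\<xi> \<eta>. cinner (T \<xi>) \<eta> = qintegral E f \<xi> \<eta>))"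

lemma qop:
  fixes E :: "'a::topological_space set \<Rightarrow> 'h \<Rightarrow> 'h::complex_hilbert_space"
  assumes E: "E \<in> quantum_prob" and f: "f \<in> borel_measurable borel" "\<And>a. cmod (f a) \<le> K"
  shows "bounded_op (qop E f)" "cinner (qop E f \<xi>) \<eta> = qintegral E f \<xi> \<eta>" "norm (qop E f \<xi>) \<le> 4 * K * norm \<xi>"
proof -
  note S = qintegral_sesquilinear[OF E f]
  have q: "cmod (qintegral E f x x) \<le> K * (norm x)\<^sup>2" for x
  proof -
    interpret finite_measure "qmeasure E x" by (rule finite_borel_measureD[OF qmeasure(1)[OF E]])
    note M = qmeasure(1)[OF E, of x]
    have "cmod (qintegral E f x x) \<le> (\<integral>a. cmod (f a) \<partial>qmeasure E x)"
      unfolding S(5) by (rule integral_norm_bound)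
    also have "\<dots> \<le> (\<integral>a. K \<partial>qmeasure E x)"
      using f by (intro integral_mono integrable_norm finite_borel_integrable[OF M f]) auto
    also have "\<dots> = K * (norm x)\<^sup>2" using qmeasure(3)[OF E, of x] finite_borel_measureD(3)[OF M] by simp
    finally show ?thesis .
  qed
  have b: "cmod (qintegral E f x y) \<le> 4 * K * norm x * norm y" for x y
    by (rule form_bound_from_quadratic[where s = "qintegral E f", OF S(1,2,3,4) q])
  have ex: "\<exists>T. bounded_op T \<and> (\<forall>\<xi> \<eta>. cinner (T \<xi>) \<eta> = qintegral E f \<xi> \<eta>) \<and> (\<forall>\<xi>. norm (T \<xi>) \<le> 4 * K * norm \<xi>)"
    by (rule sesquilinear_form_op[where s = "qintegral E f", OF S(1,2,3,4) b])
  then obtain T where T: "bounded_op T" "\<And>\<xi> \<eta>. cinner (T \<xi>) \<eta> = qintegral E f \<xi> \<eta>"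
    "\<And>\<xi>. norm (T \<xi>) \<le> 4 * K * norm \<xi>" by blast
  have "bounded_op (qop E f) \<and> (\<forall>\<xi> \<eta>. cinner (qop E f \<xi>) \<eta> = qintegral E f \<xi> \<eta>)"
    unfolding qop_def by (rule someI[of _ T]) (use T in blast)
  then have q: "bounded_op (qop E f)" "\<And>\<xi> \<eta>. cinner (qop E f \<xi>) \<eta> = qintegral E f \<xi> \<eta>" by blast+
  have "qop E f \<xi> = T \<xi>" for \<xi> by (rule cinner_ext_left) (simp add: q T)
  with q T(3) show "bounded_op (qop E f)" "cinner (qop E f \<xi>) \<eta> = qintegral E f \<xi> \<eta>" "norm (qop E f \<xi>) \<le> 4 * K * norm \<xi>"
    by auto
qed

text \<open>On a partition with values \<open>z\<close> the double sum is \<open>\<langle>E(T\<^sub>z) u, u\<rangle>\<close> with \<open>u = \<Sum>\<^sub>j z\<^sub>j v\<^sub>j\<close>,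
  summed over the cells.\<close>

lemma qintegral_completely_positive:
  fixes E :: "'a::topological_space set \<Rightarrow> 'h \<Rightarrow> 'h::complex_hilbert_space"
    and h :: "nat \<Rightarrow> 'a \<Rightarrow> complex"
  assumes E: "E \<in> quantum_prob" and h: "\<And>i. h i \<in> borel_measurable borel" "\<And>i a. cmod (h i a) \<le> K"
  shows "0 \<le> Re (\<Sum>i<n. \<Sum>j<n. qintegral E (\<lambda>a. cnj (h i a) * h j a) (v j) (v i))"
proof -
  obtain Z :: "nat \<Rightarrow> (nat \<Rightarrow> complex) set" and T where T: "\<And>m z. T m z \<in> sets borel"
    and l: "\<And>M i j. finite_borel_measure M \<Longrightarrow> i < n \<Longrightarrow> j < n \<Longrightarrow>
      (\<lambda>m. \<Sum>z\<in>Z m. (cnj (z i) * z j) * complex_of_real (measure M (T m z)))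
        \<longlonglongrightarrow> integral\<^sup>L M (\<lambda>a. cnj (h i a) * h j a)"
    by (rule joint_partition_approximation[of h K n, OF h]) blast
  have "(\<lambda>m. \<Sum>z\<in>Z m. (cnj (z i) * z j) * cinner (E (T m z) (v j)) (v i))
      \<longlonglongrightarrow> qintegral E (\<lambda>a. cnj (h i a) * h j a) (v j) (v i)" if "i < n" "j < n" for i j
    by (rule qintegral_limit[where w = "\<lambda>z. cnj (z i) * z j", OF E T l[OF _ that]])
  then have lim: "(\<lambda>m. Re (\<Sum>i<n. \<Sum>j<n. \<Sum>z\<in>Z m. (cnj (z i) * z j) * cinner (E (T m z) (v j)) (v i)))
      \<longlonglongrightarrow> Re (\<Sum>i<n. \<Sum>j<n. qintegral E (\<lambda>a. cnj (h i a) * h j a) (v j) (v i))"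
    by (intro tendsto_Re tendsto_sum) auto
  have "0 \<le> Re (\<Sum>i<n. \<Sum>j<n. \<Sum>z\<in>Z m. (cnj (z i) * z j) * cinner (E (T m z) (v j)) (v i))" for m
  proof -
    have "(\<Sum>i<n. \<Sum>j<n. \<Sum>z\<in>Z m. (cnj (z i) * z j) * cinner (E (T m z) (v j)) (v i))
        = (\<Sum>i<n. \<Sum>z\<in>Z m. \<Sum>j<n. (cnj (z i) * z j) * cinner (E (T m z) (v j)) (v i))"
      by (intro sum.cong refl sum.swap)
    also have "\<dots> = (\<Sum>z\<in>Z m. \<Sum>i<n. \<Sum>j<n. (cnj (z i) * z j) * cinner (E (T m z) (v j)) (v i))"
      by (rule sum.swap)
    also have "\<dots> = (\<Sum>z\<in>Z m. cinner (E (T m z) (\<Sum>j<n. scaleC (z j) (v j))) (\<Sum>j<n. scaleC (z j) (v j)))"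
    proof (rule sum.cong[OF refl])
      fix z
      show "(\<Sum>i<n. \<Sum>j<n. (cnj (z i) * z j) * cinner (E (T m z) (v j)) (v i))
        = cinner (E (T m z) (\<Sum>j<n. scaleC (z j) (v j))) (\<Sum>j<n. scaleC (z j) (v j))"
        unfolding bounded_opD(7)[OF positive_op_bounded[OF quantum_probD(1)[OF E T]]]
          bounded_opD(3)[OF positive_op_bounded[OF quantum_probD(1)[OF E T]]]
        unfolding cinner_sum_right cinner_sum_left cinner_scaleC_right cinner_scaleC_left sum_distrib_left
        by (simp add: mult.assoc)
    qed
    finally have eq: "(\<Sum>i<n. \<Sum>j<n. \<Sum>z\<in>Z m. (cnj (z i) * z j) * cinner (E (T m z) (v j)) (v i))
      = (\<Sum>z\<in>Z m. cinner (E (T m z) (\<Sum>j<n. scaleC (z j) (v j))) (\<Sum>j<n. scaleC (z j) (v j)))" .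
    show ?thesis
      unfolding eq Re_sum by (intro sum_nonneg positive_op_cinner(2)[OF quantum_probD(1)[OF E T]])
  qed
  then show ?thesis by (intro LIMSEQ_le_const[OF lim]) auto
qed

subsection \<open>Integration against complex measures\<close>

text \<open>A relation between finite measures carries over to their integrals because it does so for the
  approximating sums.  It yields that an integral does not depend on the decomposition of a complex measure.\<close>

lemma integral_combination_eq_0:
  fixes c :: "nat \<Rightarrow> complex" and f :: "'a::topological_space \<Rightarrow> complex"
  assumes M: "\<And>i. i < n \<Longrightarrow> finite_borel_measure (M i)"
    and zero: "\<And>\<alpha>. \<alpha> \<in> sets borel \<Longrightarrow> (\<Sum>i<n. c i * complex_of_real (measure (M i) \<alpha>)) = 0"
    and f: "f \<in> borel_measurable borel" "\<And>a. cmod (f a) \<le> K"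
  shows "(\<Sum>i<n. c i * integral\<^sup>L (M i) f) = 0"
proof -
  obtain Z :: "nat \<Rightarrow> (nat \<Rightarrow> complex) set" and w T where T: "\<And>m z. T m z \<in> sets borel"
    and l: "\<And>M. finite_borel_measure M \<Longrightarrow>
      (\<lambda>m. \<Sum>z\<in>Z m. w z * complex_of_real (measure M (T m z))) \<longlonglongrightarrow> integral\<^sup>L M f"
    by (rule qintegral_approx[OF f, where 'h = complex]) blast
  have "(\<lambda>m. \<Sum>i<n. c i * (\<Sum>z\<in>Z m. w z * complex_of_real (measure (M i) (T m z)))) \<longlonglongrightarrow> (\<Sum>i<n. c i * integral\<^sup>L (M i) f)"
    by (intro tendsto_intros l M) simp
  moreover have "(\<Sum>i<n. c i * (\<Sum>z\<in>Z m. w z * complex_of_real (measure (M i) (T m z)))) = 0" for m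
  proof -
    have "(\<Sum>i<n. c i * (\<Sum>z\<in>Z m. w z * complex_of_real (measure (M i) (T m z))))
       = (\<Sum>i<n. \<Sum>z\<in>Z m. w z * (c i * complex_of_real (measure (M i) (T m z))))"
      by (simp add: sum_distrib_left mult.left_commute)
    also have "\<dots> = (\<Sum>z\<in>Z m. w z * (\<Sum>i<n. c i * complex_of_real (measure (M i) (T m z))))"
      by (subst sum.swap) (simp add: sum_distrib_left)
    finally show ?thesis by (simp add: zero[OF T])
  qed
  ultimately show ?thesis by (simp add: LIMSEQ_const_iff)
qed

lemma has_cmeasure_integral_unique:
  fixes f :: "'a::topological_space \<Rightarrow> complex"
  assumes f: "f \<in> borel_measurable borel" "\<And>a. cmod (f a) \<le> K"
    and I: "has_cmeasure_integral \<nu> f I" and J: "has_cmeasure_integral \<nu> f J"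
  shows "I = J"
proof -
  obtain M1 M2 M3 M4 where M: "\<And>M. M \<in> {M1, M2, M3, M4} \<Longrightarrow> finite_borel_measure M"
    and \<nu>: "\<And>\<alpha>. \<alpha> \<in> sets borel \<Longrightarrow> \<nu> \<alpha> = complex_of_real (measure M1 \<alpha> - measure M2 \<alpha>) + \<i> * complex_of_real (measure M3 \<alpha> - measure M4 \<alpha>)"
    and I: "I = (integral\<^sup>L M1 f - integral\<^sup>L M2 f) + \<i> * (integral\<^sup>L M3 f - integral\<^sup>L M4 f)"
    using I unfolding has_cmeasure_integral_def finite_borel_measure_def by blast
  obtain N1 N2 N3 N4 where N: "\<And>M. M \<in> {N1, N2, N3, N4} \<Longrightarrow> finite_borel_measure M"
    and \<nu>': "\<And>\<alpha>. \<alpha> \<in> sets borel \<Longrightarrow> \<nu> \<alpha> = complex_of_real (measure N1 \<alpha> - measure N2 \<alpha>) + \<i> * complex_of_real (measure N3 \<alpha> - measure N4 \<alpha>)"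
    and J: "J = (integral\<^sup>L N1 f - integral\<^sup>L N2 f) + \<i> * (integral\<^sup>L N3 f - integral\<^sup>L N4 f)"
    using J unfolding has_cmeasure_integral_def finite_borel_measure_def by blast
  let ?M = "\<lambda>i. [M1, M2, M3, M4, N1, N2, N3, N4] ! i" and ?c = "\<lambda>i. [1, - 1, \<i>, - \<i>, - 1, 1, - \<i>, \<i>] ! i"
  have "(\<Sum>i<8. ?c i * integral\<^sup>L (?M i) f) = 0"
  proof (rule integral_combination_eq_0[OF _ _ f])
    fix i :: nat assume "i < 8"
    then have "?M i \<in> set [M1, M2, M3, M4, N1, N2, N3, N4]" by (intro nth_mem) simp
    then show "finite_borel_measure (?M i)" using M N by auto
  next
    fix \<alpha> :: "'a set" assume "\<alpha> \<in> sets borel"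
    from \<nu>[OF this] \<nu>'[OF this]
    show "(\<Sum>i<8. ?c i * complex_of_real (measure (?M i) \<alpha>)) = 0"
      by (simp add: eval_nat_numeral algebra_simps)
  qed
  then show ?thesis unfolding I J by (simp add: eval_nat_numeral algebra_simps)
qed

lemma cmeasure_integral_quantum:
  fixes E :: "'a::topological_space set \<Rightarrow> 'h \<Rightarrow> 'h::complex_hilbert_space"
  assumes E: "E \<in> quantum_prob" and f: "f \<in> borel_measurable borel" "\<And>a. cmod (f a) \<le> K"
  shows "cmeasure_integral (\<lambda>\<alpha>. cinner (E \<alpha> \<xi>) \<eta>) f = qintegral E f \<xi> \<eta>"
proof -
  \<comment> \<open>Halving the vectors absorbs the factor \<open>1/4\<close> of the polarization identity.\<close>
  define M where "M k = qmeasure E (scaleC (1 / 2) (\<xi> + scaleC (\<i> ^ k) \<eta>))" for k :: nat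
  have M: "finite_borel_measure (M k)" for k unfolding M_def by (rule qmeasure(1)[OF E])
  have meas: "complex_of_real (measure (M k) \<alpha>) = cinner (E \<alpha> (\<xi> + scaleC (\<i> ^ k) \<eta>)) (\<xi> + scaleC (\<i> ^ k) \<eta>) / 4"
    if "\<alpha> \<in> sets borel" for k \<alpha>
    unfolding M_def qmeasure(2)[OF E that] bounded_opD(3)[OF positive_op_bounded[OF quantum_probD(1)[OF E that]]]
    by (simp add: cinner_scaleC_left cinner_scaleC_right)
  have int: "integral\<^sup>L (M k) f = integral\<^sup>L (qmeasure E (\<xi> + scaleC (\<i> ^ k) \<eta>)) f / 4" for k
    unfolding M_def qintegral_sesquilinear(5)[OF E f, symmetric]
    by (simp add: qintegral_sesquilinear(2,4)[OF E f])
  have H: "has_cmeasure_integral (\<lambda>\<alpha>. cinner (E \<alpha> \<xi>) \<eta>) f (qintegral E f \<xi> \<eta>)"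
    unfolding has_cmeasure_integral_def
  proof (intro exI conjI ballI)
    fix N assume "N \<in> {M 0, M 2, M 1, M 3}"
    then have N: "finite_borel_measure N" using M by auto
    show "finite_measure N" "sets N = sets borel" using finite_borel_measureD[OF N] by blast+
    show "integrable N f" by (rule finite_borel_integrable[OF N f])
  next
    fix \<alpha> :: "'a set" assume \<alpha>: "\<alpha> \<in> sets borel"
    show "cinner (E \<alpha> \<xi>) \<eta> = complex_of_real (measure (M 0) \<alpha> - measure (M 2) \<alpha>) + \<i> * complex_of_real (measure (M 1) \<alpha> - measure (M 3) \<alpha>)"
      unfolding of_real_diff meas[OF \<alpha>] polarization[OF positive_op_bounded[OF quantum_probD(1)[OF E \<alpha>]], of \<xi> \<eta>]
      by (simp add: eval_nat_numeral algebra_simps diff_divide_distrib add_divide_distrib)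
  next
    show "qintegral E f \<xi> \<eta> = integral\<^sup>L (M 0) f - integral\<^sup>L (M 2) f + \<i> * (integral\<^sup>L (M 1) f - integral\<^sup>L (M 3) f)"
      unfolding int qintegral_def by (simp add: eval_nat_numeral algebra_simps diff_divide_distrib add_divide_distrib)
  qed
  show ?thesis
    unfolding cmeasure_integral_def
    by (rule the_equality, rule H, erule has_cmeasure_integral_unique[OF f _ H])
qed

section \<open>From positive operator-valued functionals to quantum probability measures\<close>

lemma borel_dynkin_induct [consumes 1, case_names basic compl union]:
  fixes \<alpha> :: "'a::topological_space set"
  assumes \<alpha>: "\<alpha> \<in> sets borel"
    and op: "\<And>U. open U \<Longrightarrow> P U"
    and compl: "\<And>\<beta>. \<beta> \<in> sets borel \<Longrightarrow> P \<beta> \<Longrightarrow> P (- \<beta>)"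
    and union: "\<And>\<delta>. range \<delta> \<subseteq> sets borel \<Longrightarrow> disjoint_family \<delta> \<Longrightarrow> (\<And>n. P (\<delta> n)) \<Longrightarrow> P (\<Union>n::nat. \<delta> n)"
  shows "P \<alpha>"
proof -
  have b: "sets (borel :: 'a measure) = sigma_sets UNIV {U. open U}"
    unfolding borel_def by (rule sets_measure_of) simp
  have "Int_stable {U :: 'a set. open U}" unfolding Int_stable_def by auto
  moreover have "{U :: 'a set. open U} \<subseteq> Pow UNIV" by simp
  moreover have "\<alpha> \<in> sigma_sets UNIV {U. open U}" using \<alpha> unfolding b .
  ultimately show ?thesis
  proof (induction rule: sigma_sets_induct_disjoint)
    case (compl A)
    then show ?case using assms(3)[of A] unfolding b by (simp add: Compl_eq_Diff_UNIV)
  next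
    case (union A)
    then show ?case using assms(4)[of A] unfolding b by auto
  qed (use op in auto)
qed

text \<open>If \<open>U\<close> is the set where \<open>\<phi> > 0\<close>, the functions \<open>min 1 (n \<phi>)\<close> increase to its indicator.\<close>

lemma open_indicator_limit:
  fixes U :: "'a::{t2_space, second_countable_topology} set"
  assumes compact: "compact (UNIV :: 'a set)" and U: "open U"
  obtains f :: "nat \<Rightarrow> 'a \<Rightarrow> real" where
    "\<And>n. continuous_on UNIV (f n)" "\<And>n a. 0 \<le> f n a" "\<And>n a. f n a \<le> 1"
    "\<And>M. finite_borel_measure M \<Longrightarrow> (\<lambda>n. integral\<^sup>L M (f n)) \<longlonglongrightarrow> measure M U"
proof -
  obtain \<phi> :: "'a \<Rightarrow> real" where \<phi>: "continuous_on UNIV \<phi>" "\<And>a. 0 \<le> \<phi> a" "U = {a. \<phi> a > 0}"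
    using open_cozero[OF compact U] by blast
  define f where "f n a = min 1 (real n * \<phi> a)" for n a
  have c: "continuous_on UNIV (f n)" for n unfolding f_def by (intro continuous_intros \<phi>)
  have b: "0 \<le> f n a" "f n a \<le> 1" for n a using \<phi>(2) by (auto simp: f_def)
  have l: "(\<lambda>n. f n a) \<longlonglongrightarrow> indicator U a" for a
  proof (cases "a \<in> U")
    case True
    then have "\<phi> a > 0" unfolding \<phi>(3) by simp
    then obtain N where N: "1 < real N * \<phi> a" using reals_Archimedean3 by blast
    have "f n a = 1" if "n \<ge> N" for n
    proof -
      have "real N * \<phi> a \<le> real n * \<phi> a" using that \<open>\<phi> a > 0\<close> by simp
      then show ?thesis using N by (simp add: f_def)
    qed
    then have "eventually (\<lambda>n. f n a = 1) sequentially" by (auto simp: eventually_sequentially)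
    then show ?thesis using True by (simp add: tendsto_eventually)
  next
    case False
    then have "\<phi> a = 0" using \<phi>(2)[of a] unfolding \<phi>(3) by simp
    then show ?thesis using False by (simp add: f_def)
  qed
  show ?thesis
  proof (rule that[OF c b])
    fix M :: "'a measure" assume M: "finite_borel_measure M"
    have "(\<lambda>n. integral\<^sup>L M (f n)) \<longlonglongrightarrow> integral\<^sup>L M (indicator U :: 'a \<Rightarrow> real)"
      by (rule finite_borel_dominated[OF M borel_measurable_continuous_onI[OF c] _ l, of 1]) (use b in simp)
    moreover have "integral\<^sup>L M (indicator U :: 'a \<Rightarrow> real) = measure M U"
      using finite_borel_measureD(3)[OF M] by simp
    ultimately show "(\<lambda>n. integral\<^sup>L M (f n)) \<longlonglongrightarrow> measure M U" by simp
  qed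
qed

lemma compact_continuous_bounded:
  fixes f :: "'a::topological_space \<Rightarrow> 'b::real_normed_vector"
  assumes "compact (UNIV :: 'a set)" "continuous_on UNIV f"
  obtains K where "K \<ge> 0" "\<And>a. norm (f a) \<le> K"
proof -
  have "bounded (range f)" using compact_continuous_image[OF assms(2,1)] by (rule compact_imp_bounded)
  then obtain K where "\<And>a. norm (f a) \<le> K" unfolding bounded_iff by auto
  then show ?thesis by (intro that[of "max 0 K"]) (auto intro: le_max_iff_disj[THEN iffD2])
qed

subsection \<open>Sesquilinear forms obtained from measures\<close>

text \<open>The diagonal is recorded with the form, so that the values \<open>s \<xi> \<xi>\<close> of a form obtained by polarization
  are identified by the same closure argument as sesquilinearity.\<close>

definition form_with_diagonal :: "('h::complex_hilbert_space \<Rightarrow> 'h \<Rightarrow> complex) \<Rightarrow> ('h \<Rightarrow> real) \<Rightarrow> bool"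
  where "form_with_diagonal s q \<longleftrightarrow>
    (\<forall>x y z. s (x + y) z = s x z + s y z) \<and> (\<forall>c x z. s (scaleC c x) z = c * s x z) \<and>
    (\<forall>x y z. s x (y + z) = s x y + s x z) \<and> (\<forall>c x z. s x (scaleC c z) = cnj c * s x z) \<and>
    (\<forall>x. s x x = complex_of_real (q x))"

lemma form_with_diagonalD:
  assumes "form_with_diagonal s q"
  shows "s (x + y) z = s x z + s y z" "s (scaleC c x) z = c * s x z"
    "s x (y + z) = s x y + s x z" "s x (scaleC c z) = cnj c * s x z" "s x x = complex_of_real (q x)"
  using assms unfolding form_with_diagonal_def by blast+

lemma form_with_diagonal_diff:
  "form_with_diagonal s q \<Longrightarrow> form_with_diagonal t r \<Longrightarrow>
   form_with_diagonal (\<lambda>x y. s x y - t x y) (\<lambda>x. q x - r x)"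
  unfolding form_with_diagonal_def by (simp add: algebra_simps)

lemma form_with_diagonal_sum:
  fixes s :: "'i \<Rightarrow> 'h::complex_hilbert_space \<Rightarrow> 'h \<Rightarrow> complex"
  shows "(\<And>i. form_with_diagonal (s i) (q i)) \<Longrightarrow>
   form_with_diagonal (\<lambda>x y. \<Sum>i\<in>I. s i x y) (\<lambda>x. \<Sum>i\<in>I. q i x)"
  unfolding form_with_diagonal_def by (simp add: sum.distrib sum_distrib_left)

lemma form_with_diagonal_limit:
  fixes s :: "nat \<Rightarrow> 'h::complex_hilbert_space \<Rightarrow> 'h \<Rightarrow> complex"
  assumes f: "\<And>n. form_with_diagonal (s n) (q n)"
    and s: "\<And>x y. (\<lambda>n. s n x y) \<longlonglongrightarrow> t x y" and q: "\<And>x. (\<lambda>n. q n x) \<longlonglongrightarrow> r x"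
  shows "form_with_diagonal t r"
  unfolding form_with_diagonal_def
proof (intro conjI allI)
  note D = form_with_diagonalD[OF f]
  show "t (x + y) z = t x z + t y z" for x y z
    by (rule LIMSEQ_unique[OF s]) (use tendsto_add[OF s[of x z] s[of y z]] in \<open>simp add: D(1)\<close>)
  show "t (scaleC c x) z = c * t x z" for c x z
    by (rule LIMSEQ_unique[OF s]) (use tendsto_mult_left[OF s[of x z], of c] in \<open>simp add: D(2)\<close>)
  show "t x (y + z) = t x y + t x z" for x y z
    by (rule LIMSEQ_unique[OF s]) (use tendsto_add[OF s[of x y] s[of x z]] in \<open>simp add: D(3)\<close>)
  show "t x (scaleC c z) = cnj c * t x z" for c x z
    by (rule LIMSEQ_unique[OF s]) (use tendsto_mult_left[OF s[of x z], of "cnj c"] in \<open>simp add: D(4)\<close>)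
  show "t x x = complex_of_real (r x)" for x
    by (rule LIMSEQ_unique[OF s]) (use tendsto_of_real[OF q[of x], where 'a = complex] in \<open>simp add: D(5)\<close>)
qed

text \<open>Polarization of a family of measures \<open>m \<xi>\<close> indexed by vectors.  If the polarized integrals of
  continuous functions are sesquilinear with the given diagonal, then so are the polarized measures of
  Borel sets: the property passes to increasing limits, complements and disjoint unions.\<close>

lemma form_with_diagonal_measure:
  fixes m :: "'h::complex_hilbert_space \<Rightarrow> 'a::{t2_space, second_countable_topology} measure"
  assumes compact: "compact (UNIV :: 'a set)" and m: "\<And>\<xi>. finite_borel_measure (m \<xi>)"
    and int: "\<And>f::'a \<Rightarrow> real. continuous_on UNIV f \<Longrightarrow>
      form_with_diagonal (\<lambda>\<xi> \<eta>. (\<Sum>k<4. \<i> ^ k * complex_of_real (integral\<^sup>L (m (\<xi> + scaleC (\<i> ^ k) \<eta>)) f)) / 4)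
        (\<lambda>\<xi>. integral\<^sup>L (m \<xi>) f)"
    and \<alpha>: "\<alpha> \<in> sets borel"
  shows "form_with_diagonal (\<lambda>\<xi> \<eta>. (\<Sum>k<4. \<i> ^ k * complex_of_real (measure (m (\<xi> + scaleC (\<i> ^ k) \<eta>)) \<alpha>)) / 4)
        (\<lambda>\<xi>. measure (m \<xi>) \<alpha>)"
  using \<alpha>
proof (induction rule: borel_dynkin_induct)
  case (basic U)
  obtain f :: "nat \<Rightarrow> 'a \<Rightarrow> real" where f: "\<And>n. continuous_on UNIV (f n)"
    and lim: "\<And>M. finite_borel_measure M \<Longrightarrow> (\<lambda>n. integral\<^sup>L M (f n)) \<longlonglongrightarrow> measure M U"
    by (rule open_indicator_limit[OF compact basic]) blast
  show ?case
    by (rule form_with_diagonal_limit[where q = "\<lambda>n \<xi>. integral\<^sup>L (m \<xi>) (f n)"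
      and s = "\<lambda>n \<xi> \<eta>. (\<Sum>k<4. \<i> ^ k * complex_of_real (integral\<^sup>L (m (\<xi> + scaleC (\<i> ^ k) \<eta>)) (f n))) / 4"])
      (intro tendsto_intros lim m int f, simp?)+
next
  case (compl \<beta>)
  have e: "measure (m \<xi>) (- \<beta>) = integral\<^sup>L (m \<xi>) (\<lambda>_. 1) - measure (m \<xi>) \<beta>" for \<xi>
  proof -
    interpret finite_measure "m \<xi>" by (rule finite_borel_measureD[OF m])
    show ?thesis
      using finite_measure_compl[of \<beta>] compl(1) finite_borel_measureD(2,3)[OF m, of \<xi>] by (simp add: Compl_eq_Diff_UNIV)
  qed
  show ?case
    using form_with_diagonal_diff[OF int[OF continuous_on_const, of 1] compl(2)]
    unfolding e by (simp add: sum_subtractf algebra_simps diff_divide_distrib)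
next
  case (union \<delta>)
  have l: "(\<lambda>n. \<Sum>i<n. measure (m \<xi>) (\<delta> i)) \<longlonglongrightarrow> measure (m \<xi>) (\<Union>i. \<delta> i)" for \<xi>
  proof -
    interpret finite_measure "m \<xi>" by (rule finite_borel_measureD[OF m])
    show ?thesis
      using finite_measure_UNION[of \<delta>] union(1,2) finite_borel_measureD(2)[OF m, of \<xi>] unfolding sums_def by simp
  qed
  show ?case
  proof (rule form_with_diagonal_limit[OF form_with_diagonal_sum[OF union(3)] _ l])
    fix \<xi> \<eta>
    have "(\<lambda>n. (\<Sum>k<4. \<i> ^ k * complex_of_real (\<Sum>i<n. measure (m (\<xi> + scaleC (\<i> ^ k) \<eta>)) (\<delta> i))) / 4)
       \<longlonglongrightarrow> (\<Sum>k<4. \<i> ^ k * complex_of_real (measure (m (\<xi> + scaleC (\<i> ^ k) \<eta>)) (\<Union>i. \<delta> i))) / 4"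
      by (intro tendsto_intros l) simp
    moreover have "(\<Sum>k<4. \<i> ^ k * complex_of_real (\<Sum>i<n. measure (m (\<xi> + scaleC (\<i> ^ k) \<eta>)) (\<delta> i))) / 4
      = (\<Sum>i<n. (\<Sum>k<4. \<i> ^ k * complex_of_real (measure (m (\<xi> + scaleC (\<i> ^ k) \<eta>)) (\<delta> i))) / 4)" for n
      by (simp add: sum_distrib_left sum_divide_distrib) (rule sum.swap)
    ultimately show "(\<lambda>n. \<Sum>i<n. (\<Sum>k<4. \<i> ^ k * complex_of_real (measure (m (\<xi> + scaleC (\<i> ^ k) \<eta>)) (\<delta> i))) / 4)
       \<longlonglongrightarrow> (\<Sum>k<4. \<i> ^ k * complex_of_real (measure (m (\<xi> + scaleC (\<i> ^ k) \<eta>)) (\<Union>i. \<delta> i))) / 4"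
      by simp
  qed
qed

subsection \<open>Strong countable additivity\<close>

text \<open>The remainder \<open>T = E((\<Union>i. \<delta> i) - (\<Union>i<n. \<delta> i))\<close> satisfies \<open>\<parallel>T \<xi>\<parallel>\<^sup>2 \<le> \<langle>T \<xi>, \<xi>\<rangle>\<close>, which is the scalar
  remainder.\<close>

lemma strong_countable_additivity:
  fixes E :: "'a::topological_space set \<Rightarrow> 'h \<Rightarrow> 'h::complex_hilbert_space"
  assumes pos: "\<And>\<alpha>. \<alpha> \<in> sets borel \<Longrightarrow> positive_op (E \<alpha>)"
    and m: "\<And>\<xi> \<alpha>. \<alpha> \<in> sets borel \<Longrightarrow> cinner (E \<alpha> \<xi>) \<xi> = complex_of_real (measure (m \<xi>) \<alpha>)"
    and fm: "\<And>\<xi>. finite_borel_measure (m \<xi>)" and one: "\<And>\<xi>. measure (m \<xi>) UNIV = (norm \<xi>)\<^sup>2"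
    and \<delta>: "range \<delta> \<subseteq> sets borel" "disjoint_family \<delta>"
  shows "(\<lambda>n. E (\<delta> n) \<xi>) sums E (\<Union>n. \<delta> n) \<xi>"
proof -
  have \<delta>': "\<delta> n \<in> sets borel" for n using \<delta>(1) by auto
  have U: "(\<Union>n. \<delta> n) \<in> sets borel" using \<delta>' by blast
  have R: "(\<Union>i. \<delta> i) - (\<Union>i<n. \<delta> i) \<in> sets borel" for n using \<delta>' by blast
  have split: "measure (m \<zeta>) (\<Union>i. \<delta> i) = (\<Sum>i<n. measure (m \<zeta>) (\<delta> i)) + measure (m \<zeta>) ((\<Union>i. \<delta> i) - (\<Union>i<n. \<delta> i))" for n \<zeta>
  proof -
    interpret finite_measure "m \<zeta>" by (rule finite_borel_measureD[OF fm])
    note s = finite_borel_measureD(2)[OF fm, of \<zeta>]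
    have "measure (m \<zeta>) (\<Union>i<n. \<delta> i) = (\<Sum>i<n. measure (m \<zeta>) (\<delta> i))"
      using \<delta>' \<delta>(2) s by (intro finite_measure_finite_Union) (auto simp: disjoint_family_on_def)
    moreover have "measure (m \<zeta>) ((\<Union>i. \<delta> i) - (\<Union>i<n. \<delta> i)) = measure (m \<zeta>) (\<Union>i. \<delta> i) - measure (m \<zeta>) (\<Union>i<n. \<delta> i)"
      using U \<delta>' s by (intro finite_measure_Diff) auto
    ultimately show ?thesis by simp
  qed
  have rest: "E (\<Union>i. \<delta> i) \<xi> - (\<Sum>i<n. E (\<delta> i) \<xi>) = E ((\<Union>i. \<delta> i) - (\<Union>i<n. \<delta> i)) \<xi>" for n
  proof -
    have b: "bounded_op (\<lambda>\<zeta>. \<Sum>i\<in>I. E (\<delta> i) \<zeta>)" for I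
      by (induction I rule: infinite_finite_induct)
         (simp_all add: bounded_op_add bounded_op_zero positive_op_bounded pos \<delta>')
    have "E (\<Union>i. \<delta> i) = (\<lambda>\<zeta>. (\<Sum>i<n. E (\<delta> i) \<zeta>) + E ((\<Union>i. \<delta> i) - (\<Union>i<n. \<delta> i)) \<zeta>)"
    proof (rule bounded_op_eqI)
      fix \<zeta>
      show "cinner (E (\<Union>i. \<delta> i) \<zeta>) \<zeta> = cinner ((\<Sum>i<n. E (\<delta> i) \<zeta>) + E ((\<Union>i. \<delta> i) - (\<Union>i<n. \<delta> i)) \<zeta>) \<zeta>"
        unfolding cinner_add_left cinner_sum_left m[OF U] m[OF R] m[OF \<delta>'] split[of \<zeta> n] by simp
    qed (intro bounded_op_add b positive_op_bounded pos U R)+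
    then have "E (\<Union>i. \<delta> i) \<xi> = (\<Sum>i<n. E (\<delta> i) \<xi>) + E ((\<Union>i. \<delta> i) - (\<Union>i<n. \<delta> i)) \<xi>"
      by (rule fun_cong)
    then show ?thesis by simp
  qed
  have le: "(norm (E (\<Union>i. \<delta> i) \<xi> - (\<Sum>i<n. E (\<delta> i) \<xi>)))\<^sup>2 \<le> measure (m \<xi>) (\<Union>i. \<delta> i) - (\<Sum>i<n. measure (m \<xi>) (\<delta> i))" for n
  proof -
    have "(norm (E ((\<Union>i. \<delta> i) - (\<Union>i<n. \<delta> i)) \<xi>))\<^sup>2 \<le> Re (cinner (E ((\<Union>i. \<delta> i) - (\<Union>i<n. \<delta> i)) \<xi>) \<xi>)"
    proof (rule positive_contraction_norm_le[OF pos[OF R]])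
      fix \<zeta>
      interpret finite_measure "m \<zeta>" by (rule finite_borel_measureD[OF fm])
      show "Re (cinner (E ((\<Union>i. \<delta> i) - (\<Union>i<n. \<delta> i)) \<zeta>) \<zeta>) \<le> (norm \<zeta>)\<^sup>2"
        unfolding m[OF R] one[symmetric] using bounded_measure finite_borel_measureD(3)[OF fm, of \<zeta>] by simp
    qed
    then show ?thesis unfolding rest m[OF R] using split[of \<xi> n] by simp
  qed
  have "(\<lambda>n. measure (m \<xi>) (\<Union>i. \<delta> i) - (\<Sum>i<n. measure (m \<xi>) (\<delta> i))) \<longlonglongrightarrow> 0"
  proof -
    interpret finite_measure "m \<xi>" by (rule finite_borel_measureD[OF fm])
    have "(\<lambda>n. \<Sum>i<n. measure (m \<xi>) (\<delta> i)) \<longlonglongrightarrow> measure (m \<xi>) (\<Union>i. \<delta> i)"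
      using finite_measure_UNION[of \<delta>] \<delta> finite_borel_measureD(2)[OF fm, of \<xi>] unfolding sums_def by simp
    from tendsto_diff[OF tendsto_const this, of "measure (m \<xi>) (\<Union>i. \<delta> i)"] show ?thesis by simp
  qed
  from tendsto_real_sqrt[OF this]
  have lim: "(\<lambda>n. sqrt (measure (m \<xi>) (\<Union>i. \<delta> i) - (\<Sum>i<n. measure (m \<xi>) (\<delta> i)))) \<longlonglongrightarrow> 0" by simp
  have "(\<lambda>n. E (\<Union>i. \<delta> i) \<xi> - (\<Sum>i<n. E (\<delta> i) \<xi>)) \<longlonglongrightarrow> 0"
    by (rule Lim_null_comparison[OF always_eventually[OF allI[OF real_le_rsqrt[OF le]]] lim])
  from tendsto_diff[OF tendsto_const this, of "E (\<Union>i. \<delta> i) \<xi>"] show ?thesis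
    unfolding sums_def by simp
qed

subsection \<open>The operator-valued Riesz--Markov theorem\<close>

text \<open>Riesz--Markov gives a measure for each vector.  The polarized measures of a Borel set form a bounded
  sesquilinear form, and its operator is the value of the quantum probability measure at that set.\<close>

lemma quantum_prob_from_forms:
  fixes B :: "('a::{t2_space, second_countable_topology} \<Rightarrow> real) \<Rightarrow> 'h::complex_hilbert_space \<Rightarrow> 'h \<Rightarrow> complex"
  assumes compact: "compact (UNIV :: 'a set)"
    and add: "\<And>f g \<xi> \<eta>. continuous_on UNIV f \<Longrightarrow> continuous_on UNIV g \<Longrightarrow> B (\<lambda>a. f a + g a) \<xi> \<eta> = B f \<xi> \<eta> + B g \<xi> \<eta>"
    and scale: "\<And>c f \<xi> \<eta>. continuous_on UNIV f \<Longrightarrow> B (\<lambda>a. c * f a) \<xi> \<eta> = complex_of_real c * B f \<xi> \<eta>"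
    and form: "\<And>f. continuous_on UNIV f \<Longrightarrow> form_with_diagonal (B f) (\<lambda>\<xi>. Re (B f \<xi> \<xi>))"
    and pos: "\<And>f \<xi>. continuous_on UNIV f \<Longrightarrow> (\<And>a. 0 \<le> f a) \<Longrightarrow> 0 \<le> Re (B f \<xi> \<xi>)"
    and one: "\<And>\<xi> \<eta>. B (\<lambda>_. 1) \<xi> \<eta> = cinner \<xi> \<eta>"
  shows "\<exists>E\<in>quantum_prob. \<forall>f \<xi>. continuous_on UNIV f \<longrightarrow> complex_of_real (integral\<^sup>L (qmeasure E \<xi>) f) = B f \<xi> \<xi>"
proof -
  have "\<exists>M. sets M = sets borel \<and> finite_measure M \<and> (\<forall>f. continuous_on UNIV f \<longrightarrow> integral\<^sup>L M f = Re (B f \<xi> \<xi>))" for \<xi>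
    by (rule riesz_markov[OF compact]) (use add scale pos in simp_all)
  then obtain m where m: "\<And>\<xi>. finite_borel_measure (m \<xi>)"
    and mB: "\<And>\<xi> f. continuous_on UNIV f \<Longrightarrow> integral\<^sup>L (m \<xi>) f = Re (B f \<xi> \<xi>)"
    unfolding finite_borel_measure_def by metis
  define s where "s \<alpha> \<xi> \<eta> = (\<Sum>k<4. \<i> ^ k * complex_of_real (measure (m (\<xi> + scaleC (\<i> ^ k) \<eta>)) \<alpha>)) / 4" for \<alpha> \<xi> \<eta>
  have pol: "(\<Sum>k<4. \<i> ^ k * complex_of_real (integral\<^sup>L (m (\<xi> + scaleC (\<i> ^ k) \<eta>)) f)) / 4 = B f \<xi> \<eta>"
    if f: "continuous_on UNIV f" for f \<xi> \<eta>
  proof -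
    note D = form_with_diagonalD[OF form[OF f]]
    have "B f \<xi> \<eta> = (\<Sum>k<4. \<i> ^ k * B f (\<xi> + scaleC (\<i> ^ k) \<eta>) (\<xi> + scaleC (\<i> ^ k) \<eta>)) / 4"
      by (rule sesquilinear_polarization[where s = "B f", OF D(1,2,3,4)])
    also have "\<dots> = (\<Sum>k<4. \<i> ^ k * complex_of_real (integral\<^sup>L (m (\<xi> + scaleC (\<i> ^ k) \<eta>)) f)) / 4"
      unfolding mB[OF f] D(5)[symmetric] ..
    finally show ?thesis by simp
  qed
  have s: "form_with_diagonal (s \<alpha>) (\<lambda>\<xi>. measure (m \<xi>) \<alpha>)" if "\<alpha> \<in> sets borel" for \<alpha>
    unfolding s_def[abs_def]
  proof (rule form_with_diagonal_measure[OF compact m _ that])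
    fix f :: "'a \<Rightarrow> real" assume f: "continuous_on UNIV f"
    show "form_with_diagonal (\<lambda>\<xi> \<eta>. (\<Sum>k<4. \<i> ^ k * complex_of_real (integral\<^sup>L (m (\<xi> + scaleC (\<i> ^ k) \<eta>)) f)) / 4)
        (\<lambda>\<xi>. integral\<^sup>L (m \<xi>) f)"
      unfolding pol[OF f] unfolding mB[OF f] by (rule form[OF f])
  qed
  have mU: "measure (m \<xi>) UNIV = (norm \<xi>)\<^sup>2" for \<xi>
    using mB[OF continuous_on_const, of \<xi> 1] finite_borel_measureD(3)[OF m, of \<xi>] by (simp add: one Re_cinner_self)
  have "\<exists>T. bounded_op T \<and> (\<forall>\<xi> \<eta>. cinner (T \<xi>) \<eta> = s \<alpha> \<xi> \<eta>)" if \<alpha>: "\<alpha> \<in> sets borel" for \<alpha>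
  proof -
    note D = form_with_diagonalD[OF s[OF \<alpha>]]
    have q: "cmod (s \<alpha> x x) \<le> 1 * (norm x)\<^sup>2" for x
    proof -
      interpret finite_measure "m x" by (rule finite_borel_measureD[OF m])
      show ?thesis using bounded_measure[of \<alpha>] finite_borel_measureD(3)[OF m, of x] by (simp add: D(5) mU)
    qed
    show ?thesis
      using sesquilinear_form_op[where s = "s \<alpha>", OF D(1,2,3,4) form_bound_from_quadratic[where s = "s \<alpha>", OF D(1,2,3,4) q]]
      by blast
  qed
  then obtain T where T: "\<And>\<alpha>. \<alpha> \<in> sets borel \<Longrightarrow> bounded_op (T \<alpha>)"
    "\<And>\<alpha> \<xi> \<eta>. \<alpha> \<in> sets borel \<Longrightarrow> cinner (T \<alpha> \<xi>) \<eta> = s \<alpha> \<xi> \<eta>" by metis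
  have Tm: "cinner (T \<alpha> \<xi>) \<xi> = complex_of_real (measure (m \<xi>) \<alpha>)" if "\<alpha> \<in> sets borel" for \<alpha> \<xi>
    unfolding T(2)[OF that] by (rule form_with_diagonalD(5)[OF s[OF that]])
  have pos': "positive_op (T \<alpha>)" if "\<alpha> \<in> sets borel" for \<alpha>
    by (rule positive_opI) (simp_all add: T(1)[OF that] Tm[OF that])
  have E: "T \<in> quantum_prob"
    unfolding quantum_prob_def
  proof (intro CollectI conjI ballI allI impI)
    show "positive_op (T \<alpha>)" if "\<alpha> \<in> sets borel" for \<alpha> using that by (rule pos')
    show "T {} = (\<lambda>\<xi>. 0)"
      by (rule bounded_op_eqI) (simp_all add: T(1) bounded_op_zero Tm)
    show "T UNIV = (\<lambda>\<xi>. \<xi>)"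
      by (rule bounded_op_eqI) (simp_all add: T(1) bounded_op_id Tm mU cinner_self)
    show "(\<lambda>n. T (\<delta> n) \<xi>) sums T (\<Union>n. \<delta> n) \<xi>"
      if "range \<delta> \<subseteq> sets borel" "disjoint_family \<delta>" for \<delta> :: "nat \<Rightarrow> 'a set" and \<xi>
      by (rule strong_countable_additivity[OF pos' Tm m mU that])
  qed
  moreover have "complex_of_real (integral\<^sup>L (qmeasure T \<xi>) f) = B f \<xi> \<xi>" if f: "continuous_on UNIV f" for f \<xi>
  proof -
    interpret finite_measure "m \<xi>" by (rule finite_borel_measureD[OF m])
    interpret Q: finite_measure "qmeasure T \<xi>" by (rule finite_borel_measureD[OF qmeasure(1)[OF E]])
    have "qmeasure T \<xi> = m \<xi>"
    proof (rule measure_eqI)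
      show "sets (qmeasure T \<xi>) = sets (m \<xi>)"
        using finite_borel_measureD(2)[OF qmeasure(1)[OF E]] finite_borel_measureD(2)[OF m] by simp
      fix \<alpha> assume "\<alpha> \<in> sets (qmeasure T \<xi>)"
      then have \<alpha>: "\<alpha> \<in> sets borel" using finite_borel_measureD(2)[OF qmeasure(1)[OF E]] by simp
      have "complex_of_real (measure (qmeasure T \<xi>) \<alpha>) = complex_of_real (measure (m \<xi>) \<alpha>)"
        unfolding qmeasure(2)[OF E \<alpha>] by (rule Tm[OF \<alpha>])
      then show "emeasure (qmeasure T \<xi>) \<alpha> = emeasure (m \<xi>) \<alpha>"
        by (simp add: emeasure_eq_measure Q.emeasure_eq_measure)
    qed
    then show ?thesis using mB[OF f] form_with_diagonalD(5)[OF form[OF f]] by simp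
  qed
  ultimately show ?thesis by blast
qed

subsection \<open>Positive functionals on a countable dense set\<close>

definition rational_dense :: "('a::topological_space \<Rightarrow> real) set \<Rightarrow> bool"
  where "rational_dense D \<longleftrightarrow>
    (\<forall>f\<in>D. continuous_on UNIV f) \<and> (\<forall>f\<in>D. \<forall>g\<in>D. (\<lambda>a. f a + g a) \<in> D) \<and>
    (\<forall>q\<in>\<rat>. \<forall>f\<in>D. (\<lambda>a. q * f a) \<in> D) \<and> (\<lambda>_. 1) \<in> D \<and>
    (\<forall>f. continuous_on UNIV f \<longrightarrow> (\<forall>e>0. \<exists>d\<in>D. \<forall>a. \<bar>f a - d a\<bar> < e))"

lemma rational_denseD:
  assumes "rational_dense D"
  shows "f \<in> D \<Longrightarrow> continuous_on UNIV f" "f \<in> D \<Longrightarrow> g \<in> D \<Longrightarrow> (\<lambda>a. f a + g a) \<in> D"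
    "q \<in> \<rat> \<Longrightarrow> f \<in> D \<Longrightarrow> (\<lambda>a. q * f a) \<in> D" "(\<lambda>_. 1) \<in> D" "q \<in> \<rat> \<Longrightarrow> (\<lambda>_. q) \<in> D"
    "continuous_on UNIV f \<Longrightarrow> e > 0 \<Longrightarrow> \<exists>d\<in>D. \<forall>a. \<bar>f a - d a\<bar> < e"
proof -
  have D: "\<forall>f\<in>D. continuous_on UNIV f" "\<forall>f\<in>D. \<forall>g\<in>D. (\<lambda>a. f a + g a) \<in> D"
    "\<forall>q\<in>\<rat>. \<forall>f\<in>D. (\<lambda>a. q * f a) \<in> D" "(\<lambda>_. 1) \<in> D"
    "\<forall>f. continuous_on UNIV f \<longrightarrow> (\<forall>e>0. \<exists>d\<in>D. \<forall>a. \<bar>f a - d a\<bar> < e)"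
    using assms unfolding rational_dense_def by simp_all
  show "f \<in> D \<Longrightarrow> continuous_on UNIV f" "f \<in> D \<Longrightarrow> g \<in> D \<Longrightarrow> (\<lambda>a. f a + g a) \<in> D" "(\<lambda>_. 1) \<in> D"
    "q \<in> \<rat> \<Longrightarrow> f \<in> D \<Longrightarrow> (\<lambda>a. q * f a) \<in> D"
    using D(1,2,3,4) by simp_all
  show "continuous_on UNIV f \<Longrightarrow> e > 0 \<Longrightarrow> \<exists>d\<in>D. \<forall>a. \<bar>f a - d a\<bar> < e"
    using D(5) by simp
  show "q \<in> \<rat> \<Longrightarrow> (\<lambda>_. q) \<in> D"
    using bspec[OF bspec[OF D(3), of q] D(4)] by simp
qed

text \<open>The functions with cozero sets in a countable basis separate points.  Together with the rational
  constants they generate a countable algebra over the rationals, whose uniform closure is an algebra over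
  the reals, so Stone--Weierstrass applies to the closure.\<close>

lemma countable_rational_dense_exists:
  assumes compact: "compact (UNIV :: 'a::{t2_space, second_countable_topology} set)"
  shows "\<exists>D :: ('a \<Rightarrow> real) set. countable D \<and> rational_dense D"
proof -
  obtain B :: "'a set set" where B: "countable B" "topological_basis B" using ex_countable_basis by blast
  have "\<forall>U. \<exists>f::'a \<Rightarrow> real. U \<in> B \<longrightarrow> continuous_on UNIV f \<and> U = {a. f a > 0}"
    using open_cozero[OF compact] topological_basis_open[OF B(2)] by meson
  then obtain \<phi> :: "'a set \<Rightarrow> 'a \<Rightarrow> real" where \<phi>: "\<And>U. U \<in> B \<Longrightarrow> continuous_on UNIV (\<phi> U)"
    "\<And>U. U \<in> B \<Longrightarrow> U = {a. \<phi> U a > 0}" by metis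
  define D0 where "D0 = \<phi> ` B \<union> (\<lambda>q _. q) ` \<rat>"
  define step where "step S = S \<union> (\<lambda>(f, g) a. f a + g a) ` (S \<times> S) \<union> (\<lambda>(f, g) a. f a * g a) ` (S \<times> S)"
    for S :: "('a \<Rightarrow> real) set"
  define Dn where "Dn n = (step ^^ n) D0" for n
  define D where "D = (\<Union>n. Dn n)"
  have DS: "Dn (Suc n) = step (Dn n)" for n by (simp add: Dn_def)
  have cD: "countable (Dn n)" for n
  proof (induction n)
    case 0 show ?case unfolding Dn_def D0_def by (simp only: funpow_0) (intro countable_Un countable_image B(1) countable_rat)
  next
    case (Suc n) then show ?case unfolding DS step_def by (intro countable_Un countable_image countable_SIGMA) auto
  qed
  have contD: "continuous_on UNIV f" if "f \<in> Dn n" for f n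
    using that
  proof (induction n arbitrary: f)
    case 0 then show ?case unfolding Dn_def D0_def using \<phi>(1) by auto
  next
    case (Suc n) then show ?case unfolding DS step_def by (auto intro!: continuous_on_add continuous_on_mult)
  qed
  have mono: "Dn m \<subseteq> Dn n" if "m \<le> n" for m n
    using that by (rule lift_Suc_mono_le[of Dn, rotated]) (auto simp: DS step_def)
  have join: "\<exists>n. f \<in> Dn n \<and> g \<in> Dn n" if fg: "f \<in> D" "g \<in> D" for f g
  proof -
    obtain k l where "f \<in> Dn k" "g \<in> Dn l" using fg unfolding D_def by blast
    then show ?thesis using mono[of k "max k l"] mono[of l "max k l"] by (intro exI[of _ "max k l"]) auto
  qed
  have Dadd: "(\<lambda>a. f a + g a) \<in> D" and Dmult: "(\<lambda>a. f a * g a) \<in> D" if fg: "f \<in> D" "g \<in> D" for f g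
  proof -
    obtain n where n: "f \<in> Dn n" "g \<in> Dn n" using join[OF fg] by blast
    then have "(\<lambda>a. f a + g a) \<in> Dn (Suc n)" "(\<lambda>a. f a * g a) \<in> Dn (Suc n)"
      unfolding DS step_def by force+
    then show "(\<lambda>a. f a + g a) \<in> D" "(\<lambda>a. f a * g a) \<in> D" unfolding D_def by blast+
  qed
  have D0D: "D0 \<subseteq> D" unfolding D_def using Dn_def[of 0] by auto
  then have Dconst: "(\<lambda>_. q) \<in> D" if "q \<in> \<rat>" for q unfolding D0_def using that by blast
  have D\<phi>: "\<phi> U \<in> D" if "U \<in> B" for U using D0D that unfolding D0_def by blast
  have Dcont: "continuous_on UNIV f" if "f \<in> D" for f using contD that unfolding D_def by blast
  define R where "R = {f :: 'a \<Rightarrow> real. continuous_on UNIV f \<and> (\<forall>e>0. \<exists>d\<in>D. \<forall>a. \<bar>f a - d a\<bar> < e)}"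
  have DR: "f \<in> R" if "f \<in> D" for f unfolding R_def using that Dcont by (auto intro!: bexI[of _ f])
  interpret function_ring_on R UNIV
  proof
    show "compact (UNIV :: 'a set)" by (rule compact)
    show "continuous_on UNIV f" if "f \<in> R" for f using that unfolding R_def by blast
    show "(\<lambda>x. f x + g x) \<in> R" if fg: "f \<in> R" "g \<in> R" for f g
      unfolding R_def
    proof (intro CollectI conjI allI impI)
      show "continuous_on UNIV (\<lambda>x. f x + g x)" using fg unfolding R_def by (auto intro: continuous_on_add)
      fix e :: real assume "e > 0"
      then have "e / 2 > 0" by simp
      then obtain d d' where d: "d \<in> D" "d' \<in> D" "\<And>a. \<bar>f a - d a\<bar> < e / 2" "\<And>a. \<bar>g a - d' a\<bar> < e / 2"
        using fg unfolding R_def by blast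
      have "\<bar>f a + g a - (d a + d' a)\<bar> < e" for a using d(3)[of a] d(4)[of a] by linarith
      then show "\<exists>d\<in>D. \<forall>a. \<bar>f a + g a - d a\<bar> < e" by (intro bexI[OF _ Dadd[OF d(1,2)]]) simp
    qed
    show "(\<lambda>x. f x * g x) \<in> R" if fg: "f \<in> R" "g \<in> R" for f g
      unfolding R_def
    proof (intro CollectI conjI allI impI)
      have c: "continuous_on UNIV f" "continuous_on UNIV g" using fg unfolding R_def by auto
      then show "continuous_on UNIV (\<lambda>x. f x * g x)" by (intro continuous_on_mult)
      fix e :: real assume e: "e > 0"
      obtain K where K: "K \<ge> 0" "\<And>a. \<bar>f a\<bar> \<le> K" using compact_continuous_bounded[OF compact c(1)] by auto
      obtain L where L: "L \<ge> 0" "\<And>a. \<bar>g a\<bar> \<le> L" using compact_continuous_bounded[OF compact c(2)] by auto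
      define r where "r = min 1 (e / (K + L + 2))"
      have r: "r > 0" "r \<le> 1" unfolding r_def using e K(1) L(1) by auto
      have "r * (K + L + 2) \<le> e / (K + L + 2) * (K + L + 2)"
        unfolding r_def using K(1) L(1) by (intro mult_right_mono) auto
      also have "\<dots> = e" using K(1) L(1) by simp
      finally have re: "r * (K + L + 2) \<le> e" .
      obtain d d' where d: "d \<in> D" "d' \<in> D" "\<And>a. \<bar>f a - d a\<bar> < r" "\<And>a. \<bar>g a - d' a\<bar> < r"
        using fg r(1) unfolding R_def by blast
      have "\<bar>f a * g a - d a * d' a\<bar> < e" for a
      proof -
        have "\<bar>f a * g a - d a * d' a\<bar> = \<bar>f a * (g a - d' a) + d' a * (f a - d a)\<bar>" by (simp add: algebra_simps)
        also have "\<dots> \<le> \<bar>f a\<bar> * \<bar>g a - d' a\<bar> + \<bar>d' a\<bar> * \<bar>f a - d a\<bar>"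
          unfolding abs_mult[symmetric] by (rule abs_triangle_ineq)
        also have "\<dots> \<le> K * r + (L + 1) * r"
        proof (intro add_mono mult_mono)
          show "\<bar>d' a\<bar> \<le> L + 1" using d(4)[of a] L(2)[of a] r(2) by linarith
        qed (use K L d(3,4)[of a] in \<open>auto intro: less_imp_le\<close>)
        also have "\<dots> < r * (K + L + 2)" using r by (simp add: algebra_simps)
        also note re
        finally show ?thesis .
      qed
      then show "\<exists>d\<in>D. \<forall>a. \<bar>f a * g a - d a\<bar> < e" by (intro bexI[OF _ Dmult[OF d(1,2)]]) simp
    qed
    show "(\<lambda>_. c) \<in> R" for c
      unfolding R_def
    proof (intro CollectI conjI allI impI continuous_on_const)
      fix e :: real assume "e > 0"
      then obtain q where q: "q \<in> \<rat>" "c - e < q" "q < c"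
        using Rats_dense_in_real[of "c - e" c] by auto
      then have "\<bar>c - q\<bar> < e" by linarith
      then show "\<exists>d\<in>D. \<forall>a. \<bar>c - d a\<bar> < e" using Dconst[OF q(1)] by (intro bexI[of _ "\<lambda>_. q"]) auto
    qed
    show "\<exists>f\<in>R. f x \<noteq> f y" if xy: "x \<noteq> y" for x y
    proof -
      obtain V where V: "open V" "x \<in> V" "y \<notin> V" using t1_space[OF xy] by blast
      obtain U where U: "U \<in> B" "x \<in> U" "U \<subseteq> V" using topological_basisE[OF B(2) V(1,2)] by blast
      then have "x \<in> {a. \<phi> U a > 0}" "y \<notin> {a. \<phi> U a > 0}" using \<phi>(2)[OF U(1)] V(3) by auto
      then have "\<phi> U x \<noteq> \<phi> U y" by auto
      then show ?thesis using DR[OF D\<phi>[OF U(1)]] by blast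
    qed
  qed
  have dense: "\<exists>d\<in>D. \<forall>a. \<bar>f a - d a\<bar> < e" if f: "continuous_on UNIV f" and e: "e > 0" for f e
  proof -
    have "e / 2 > 0" using e by simp
    then obtain g where g: "g \<in> R" "\<And>a. \<bar>f a - g a\<bar> < e / 2"
      using Stone_Weierstrass_basic[OF f] by blast
    obtain d where d: "d \<in> D" "\<And>a. \<bar>g a - d a\<bar> < e / 2"
      using g(1) \<open>e / 2 > 0\<close> unfolding R_def by blast
    have "\<bar>f a - d a\<bar> < e" for a using g(2)[of a] d(2)[of a] by linarith
    with d(1) show ?thesis by blast
  qed
  have "countable D" unfolding D_def using cD by blast
  moreover have "rational_dense D"
    unfolding rational_dense_def using Dcont Dadd Dmult[OF Dconst] Dconst dense by (auto simp: Rats_1)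
  ultimately show ?thesis by blast
qed

context
  fixes D :: "('a::{t2_space, second_countable_topology} \<Rightarrow> real) set"
    and T :: "('a \<Rightarrow> real) \<Rightarrow> 'h::complex_hilbert_space \<Rightarrow> 'h"
  assumes compact: "compact (UNIV :: 'a set)" and D: "rational_dense D"
    and T_bounded: "\<And>f. f \<in> D \<Longrightarrow> bounded_op (T f)"
    and T_add: "\<And>f g \<xi>. f \<in> D \<Longrightarrow> g \<in> D \<Longrightarrow> T (\<lambda>a. f a + g a) \<xi> = T f \<xi> + T g \<xi>"
    and T_scale: "\<And>q f \<xi>. q \<in> \<rat> \<Longrightarrow> f \<in> D \<Longrightarrow> T (\<lambda>a. q * f a) \<xi> = scaleC (complex_of_real q) (T f \<xi>)"
    and T_pos: "\<And>f. f \<in> D \<Longrightarrow> (\<And>a. 0 \<le> f a) \<Longrightarrow> positive_op (T f)"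
    and T_one: "\<And>\<xi>. T (\<lambda>_. 1) \<xi> = \<xi>"
begin

private lemma T_const: "q \<in> \<rat> \<Longrightarrow> T (\<lambda>_. q) \<xi> = scaleC (complex_of_real q) \<xi>"
  using T_scale[of q "\<lambda>_. 1"] rational_denseD(4)[OF D] by (simp add: T_one)

private lemma T_diff: "f \<in> D \<Longrightarrow> g \<in> D \<Longrightarrow> (\<lambda>a. f a - g a) \<in> D \<and> T (\<lambda>a. f a - g a) \<xi> = T f \<xi> - T g \<xi>"
  using rational_denseD(2)[OF D, of f "\<lambda>a. (- 1) * g a"] T_add[of f "\<lambda>a. (- 1) * g a" \<xi>]
    rational_denseD(3)[OF D, of "- 1" g] T_scale[of "- 1" g \<xi>] by (simp add: scaleC_minus_left)

text \<open>Positivity of \<open>T (q + f)\<close> and \<open>T (q - f)\<close>; the constant \<open>q\<close> lies in \<open>D\<close> only if it is rational.\<close>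

private lemma T_rational_bound:
  assumes q: "q \<in> \<rat>" and f: "f \<in> D" and b: "\<And>a. \<bar>f a\<bar> \<le> q"
  shows "cmod (cinner (T f \<xi>) \<xi>) \<le> q * (norm \<xi>)\<^sup>2"
proof -
  note qD = rational_denseD(5)[OF D q]
  have "0 \<le> q + f a" "0 \<le> q - f a" for a using b[of a] by auto
  then have p: "positive_op (T (\<lambda>a. q + f a))" "positive_op (T (\<lambda>a. q - f a))"
    using rational_denseD(2)[OF D qD f] T_diff[OF qD f] T_pos by blast+
  have e: "cinner (T (\<lambda>a. q + f a) \<xi>) \<xi> = complex_of_real (q * (norm \<xi>)\<^sup>2) + cinner (T f \<xi>) \<xi>"
    "cinner (T (\<lambda>a. q - f a) \<xi>) \<xi> = complex_of_real (q * (norm \<xi>)\<^sup>2) - cinner (T f \<xi>) \<xi>"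
    unfolding T_add[OF qD f] conjunct2[OF T_diff[OF qD f]] T_const[OF q] cinner_add_left cinner_diff_left
      cinner_scaleC_left cinner_self by simp_all
  have im: "Im (cinner (T f \<xi>) \<xi>) = 0"
    using arg_cong[OF positive_op_cinner(1)[OF p(1), of \<xi>], of Im] unfolding e by simp
  have "0 \<le> q * (norm \<xi>)\<^sup>2 + Re (cinner (T f \<xi>) \<xi>)" "0 \<le> q * (norm \<xi>)\<^sup>2 - Re (cinner (T f \<xi>) \<xi>)"
    using positive_op_cinner(2)[OF p(1), of \<xi>] positive_op_cinner(2)[OF p(2), of \<xi>] unfolding e by simp_all
  then show ?thesis using im by (simp add: cmod_eq_Re abs_le_iff)
qed

private lemma T_bound:
  assumes f: "f \<in> D" and b: "\<And>a. \<bar>f a\<bar> \<le> r"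
  shows "cmod (cinner (T f \<xi>) \<eta>) \<le> 4 * r * norm \<xi> * norm \<eta>"
proof (rule form_bound_from_quadratic[where s = "\<lambda>\<xi> \<eta>. cinner (T f \<xi>) \<eta>"])
  show "cmod (cinner (T f \<xi>) \<xi>) \<le> r * (norm \<xi>)\<^sup>2" for \<xi>
  proof (rule ccontr)
    assume n: "\<not> ?thesis"
    have "\<xi> \<noteq> 0" using n by (auto simp: bounded_opD(5)[OF T_bounded[OF f]])
    then have x: "(norm \<xi>)\<^sup>2 > 0" by simp
    then have "r < cmod (cinner (T f \<xi>) \<xi>) / (norm \<xi>)\<^sup>2" using n by (simp add: field_simps)
    then obtain q where q: "q \<in> \<rat>" "r < q" "q < cmod (cinner (T f \<xi>) \<xi>) / (norm \<xi>)\<^sup>2"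
      using Rats_dense_in_real by blast
    have "\<bar>f a\<bar> \<le> q" for a using b[of a] q(2) by linarith
    then have "cmod (cinner (T f \<xi>) \<xi>) \<le> q * (norm \<xi>)\<^sup>2" by (rule T_rational_bound[OF q(1) f])
    with q(3) x show False by (simp add: field_simps)
  qed
qed (simp_all add: bounded_opD[OF T_bounded[OF f]] cinner_add_left cinner_add_right cinner_scaleC_left cinner_scaleC_right)

private lemma T_uniform_null:
  assumes d: "\<And>n. d n \<in> D" "\<And>n. d' n \<in> D" and u: "uniform_limit UNIV d f sequentially" "uniform_limit UNIV d' f sequentially"
  shows "(\<lambda>n. cinner (T (d n) \<xi>) \<eta> - cinner (T (d' n) \<xi>) \<eta>) \<longlonglongrightarrow> 0"
proof (rule LIMSEQ_I)
  fix r :: real assume r: "r > 0"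
  define c where "c = 4 * norm \<xi> * norm \<eta> + 1"
  have c: "c > 0" unfolding c_def by (simp add: add_nonneg_pos)
  have "uniform_limit UNIV (\<lambda>n a. d n a - d' n a) (\<lambda>a. f a - f a) sequentially"
    by (intro uniform_limit_minus u)
  then have "\<forall>\<^sub>F n in sequentially. \<forall>a\<in>UNIV. dist (d n a - d' n a) (f a - f a) < r / c"
    using r c by (intro uniform_limitD) auto
  then obtain N where N: "\<And>n a. n \<ge> N \<Longrightarrow> \<bar>d n a - d' n a\<bar> \<le> r / c"
    unfolding eventually_sequentially by (auto simp: dist_real_def intro: less_imp_le)
  show "\<exists>N. \<forall>n\<ge>N. norm (cinner (T (d n) \<xi>) \<eta> - cinner (T (d' n) \<xi>) \<eta> - 0) < r"
  proof (intro exI allI impI)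
    fix n assume n: "n \<ge> N"
    note df = T_diff[OF d(1)[of n] d(2)[of n]]
    have "cmod (cinner (T (\<lambda>a. d n a - d' n a) \<xi>) \<eta>) \<le> 4 * (r / c) * norm \<xi> * norm \<eta>"
      by (rule T_bound[OF conjunct1[OF df] N[OF n]])
    also have "\<dots> = r / c * (c - 1)" by (simp add: c_def)
    also have "\<dots> < r / c * c" using r c by (intro mult_strict_left_mono) auto
    also have "\<dots> = r" using c by simp
    finally show "norm (cinner (T (d n) \<xi>) \<eta> - cinner (T (d' n) \<xi>) \<eta> - 0) < r"
      unfolding conjunct2[OF df] by (simp add: cinner_diff_left)
  qed
qed

text \<open>A sequence in \<open>D\<close> converging uniformly to \<open>f\<close>; the limit in the next definition is the same for every
  such sequence.\<close>

private definition approx :: "('a \<Rightarrow> real) \<Rightarrow> nat \<Rightarrow> 'a \<Rightarrow> real"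
  where "approx f n = (SOME d. d \<in> D \<and> (\<forall>a. \<bar>f a - d a\<bar> < 1 / real (Suc n)))"

private definition ext :: "('a \<Rightarrow> real) \<Rightarrow> 'h \<Rightarrow> 'h \<Rightarrow> complex"
  where "ext f \<xi> \<eta> = lim (\<lambda>n. cinner (T (approx f n) \<xi>) \<eta>)"

private lemma approx:
  assumes f: "continuous_on UNIV f"
  shows "approx f n \<in> D" "\<bar>f a - approx f n a\<bar> < 1 / real (Suc n)" "uniform_limit UNIV (approx f) f sequentially"
proof -
  have "approx f n \<in> D \<and> (\<forall>a. \<bar>f a - approx f n a\<bar> < 1 / real (Suc n))" for n
  proof -
    have "\<exists>d\<in>D. \<forall>a. \<bar>f a - d a\<bar> < 1 / real (Suc n)"
      by (rule rational_denseD(6)[OF D f]) simp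
    then show ?thesis unfolding approx_def Bex_def by (rule someI_ex)
  qed
  then show a: "approx f n \<in> D" "\<bar>f a - approx f n a\<bar> < 1 / real (Suc n)" for n a by blast+
  show "uniform_limit UNIV (approx f) f sequentially"
  proof (rule uniform_limitI)
    fix e :: real assume "e > 0"
    then obtain N where N: "inverse (real (Suc N)) < e" using reals_Archimedean by blast
    show "\<forall>\<^sub>F n in sequentially. \<forall>a\<in>UNIV. dist (approx f n a) (f a) < e"
      unfolding eventually_sequentially
    proof (intro exI allI impI ballI)
      fix n a assume "n \<ge> N"
      then have "1 / real (Suc n) \<le> inverse (real (Suc N))" by (simp add: field_simps)
      then show "dist (approx f n a) (f a) < e" using a(2)[of a n] N by (simp add: dist_real_def abs_minus_commute)
    qed
  qed
qed

private lemma ext_limit: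
  assumes f: "continuous_on UNIV f" and d: "\<And>n. d n \<in> D" "uniform_limit UNIV d f sequentially"
  shows "(\<lambda>n. cinner (T (d n) \<xi>) \<eta>) \<longlonglongrightarrow> ext f \<xi> \<eta>"
proof -
  note A = approx[OF f]
  have "Cauchy (\<lambda>n. cinner (T (approx f n) \<xi>) \<eta>)"
    unfolding Cauchy_iff
  proof (intro allI impI)
    fix r :: real assume r: "r > 0"
    define c where "c = 8 * norm \<xi> * norm \<eta> + 1"
    have c: "c > 0" unfolding c_def by (simp add: add_nonneg_pos)
    then obtain N where N: "inverse (real (Suc N)) < r / c" using r reals_Archimedean[of "r / c"] by auto
    show "\<exists>M. \<forall>m\<ge>M. \<forall>n\<ge>M. norm (cinner (T (approx f m) \<xi>) \<eta> - cinner (T (approx f n) \<xi>) \<eta>) < r"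
    proof (intro exI allI impI)
      fix m n assume mn: "m \<ge> N" "n \<ge> N"
      have le: "1 / real (Suc k) \<le> inverse (real (Suc N))" if "k \<ge> N" for k using that by (simp add: field_simps)
      note df = T_diff[OF A(1)[of m] A(1)[of n]]
      have b: "\<bar>approx f m a - approx f n a\<bar> \<le> 2 * (r / c)" for a
        using A(2)[of a m] A(2)[of a n] le[OF mn(1)] le[OF mn(2)] N by linarith
      have "cmod (cinner (T (\<lambda>a. approx f m a - approx f n a) \<xi>) \<eta>) \<le> 4 * (2 * (r / c)) * norm \<xi> * norm \<eta>"
        by (rule T_bound[OF conjunct1[OF df] b])
      also have "\<dots> = r / c * (c - 1)" by (simp add: c_def)
      also have "\<dots> < r / c * c" using r c by (intro mult_strict_left_mono) auto
      also have "\<dots> = r" using c by simp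
      finally show "norm (cinner (T (approx f m) \<xi>) \<eta> - cinner (T (approx f n) \<xi>) \<eta>) < r"
        unfolding conjunct2[OF df] by (simp add: cinner_diff_left)
    qed
  qed
  then have "(\<lambda>n. cinner (T (approx f n) \<xi>) \<eta>) \<longlonglongrightarrow> ext f \<xi> \<eta>"
    unfolding ext_def Cauchy_convergent_iff convergent_LIMSEQ_iff .
  from tendsto_add[OF this T_uniform_null[OF d(1) A(1) d(2) A(3), of \<xi> \<eta>]] show ?thesis by simp
qed

text \<open>The extension by continuity is homogeneous for real scalars because a scalar, too, is a limit of
  rationals, and positive because the approximants of a nonnegative function can be shifted upwards.\<close>

theorem quantum_prob_from_dense:
  "\<exists>E\<in>quantum_prob. \<forall>f\<in>D. \<forall>\<xi>. complex_of_real (integral\<^sup>L (qmeasure E \<xi>) f) = cinner (T f \<xi>) \<xi>"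
proof -
  have tl: "(\<lambda>n. cinner (T (approx f n) \<xi>) \<eta>) \<longlonglongrightarrow> ext f \<xi> \<eta>" if "continuous_on UNIV f" for f \<xi> \<eta>
    by (rule ext_limit[OF that approx(1,3)[OF that]])
  have extD: "ext f \<xi> \<eta> = cinner (T f \<xi>) \<eta>" if "f \<in> D" for f \<xi> \<eta>
    using ext_limit[OF rational_denseD(1)[OF D that], of "\<lambda>_. f" \<xi> \<eta>] that
    by (simp add: LIMSEQ_const_iff uniform_limit_const)
  have nonneg: "0 \<le> Re (ext f \<xi> \<xi>)" and im: "Im (ext f \<xi> \<xi>) = 0" if f: "continuous_on UNIV f" and p: "\<And>a. 0 \<le> f a" for f \<xi>
  proof -
    note A = approx[OF f]
    \<comment> \<open>The shift makes the approximants nonnegative, so that positivity on \<open>D\<close> applies.\<close>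
    define d where "d n a = approx f n a + 1 / real (Suc n)" for n a
    have rat: "1 / real (Suc n) \<in> \<rat>" for n by simp
    have dD: "d n \<in> D" for n unfolding d_def by (rule rational_denseD(2)[OF D A(1) rational_denseD(5)[OF D rat]])
    have "0 \<le> d n a" for n a using A(2)[of a n] p[of a] unfolding d_def by linarith
    then have pos: "positive_op (T (d n))" for n using T_pos[OF dD] by blast
    have "uniform_limit UNIV (\<lambda>n (a::'a). 1 / real (Suc n)) (\<lambda>_. 0) sequentially"
      using LIMSEQ_inverse_real_of_nat by (auto simp: uniform_limit_iff tendsto_iff inverse_eq_divide)
    from uniform_limit_add[OF A(3) this] have "uniform_limit UNIV d f sequentially"
      unfolding d_def[abs_def] by simp
    from ext_limit[OF f dD this] have l: "(\<lambda>n. cinner (T (d n) \<xi>) \<xi>) \<longlonglongrightarrow> ext f \<xi> \<xi>" .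
    show "0 \<le> Re (ext f \<xi> \<xi>)"
      using positive_op_cinner(2)[OF pos] by (intro LIMSEQ_le_const[OF tendsto_Re[OF l]]) auto
    have "Im (cinner (T (d n) \<xi>) \<xi>) = 0" for n
      using arg_cong[OF positive_op_cinner(1)[OF pos[of n], of \<xi>], of Im] by simp
    then show "Im (ext f \<xi> \<xi>) = 0"
      using tendsto_Im[OF l] by (simp add: LIMSEQ_const_iff)
  qed
  have add: "ext (\<lambda>a. f a + g a) \<xi> \<eta> = ext f \<xi> \<eta> + ext g \<xi> \<eta>"
    if f: "continuous_on UNIV f" and g: "continuous_on UNIV g" for f g \<xi> \<eta>
  proof (rule LIMSEQ_unique)
    show "(\<lambda>n. cinner (T (\<lambda>a. approx f n a + approx g n a) \<xi>) \<eta>) \<longlonglongrightarrow> ext (\<lambda>a. f a + g a) \<xi> \<eta>"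
      by (intro ext_limit continuous_on_add f g rational_denseD(2)[OF D] uniform_limit_add approx)
    show "(\<lambda>n. cinner (T (\<lambda>a. approx f n a + approx g n a) \<xi>) \<eta>) \<longlonglongrightarrow> ext f \<xi> \<eta> + ext g \<xi> \<eta>"
      unfolding T_add[OF approx(1)[OF f] approx(1)[OF g]] cinner_add_left
      by (intro tendsto_add tl f g)
  qed
  have scale: "ext (\<lambda>a. c * f a) \<xi> \<eta> = complex_of_real c * ext f \<xi> \<eta>"
    if f: "continuous_on UNIV f" for c f \<xi> \<eta>
  proof -
    have "\<exists>q\<in>\<rat>. c - 1 / real (Suc n) < q \<and> q < c" for n
      using Rats_dense_in_real[of "c - 1 / real (Suc n)" c] by auto
    then obtain q where q: "\<And>n. q n \<in> \<rat>" "\<And>n. c - 1 / real (Suc n) < q n" "\<And>n. q n < c" by metis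
    have qc: "q \<longlonglongrightarrow> c"
    proof (rule tendsto_sandwich[OF _ _ _ tendsto_const])
      show "(\<lambda>n. c - 1 / real (Suc n)) \<longlonglongrightarrow> c"
        using tendsto_diff[OF tendsto_const LIMSEQ_inverse_real_of_nat, of c] by (simp add: inverse_eq_divide)
    qed (intro always_eventually allI less_imp_le q(2,3))+
    obtain K where "\<And>a. norm (f a) \<le> K" using compact_continuous_bounded[OF compact f] by blast
    then have bf: "bounded (range f)" unfolding bounded_iff by auto
    have "uniform_limit UNIV (\<lambda>n (a::'a). q n) (\<lambda>_. c) sequentially"
      using qc by (auto simp: uniform_limit_iff tendsto_iff)
    then have u: "uniform_limit UNIV (\<lambda>n a. q n * approx f n a) (\<lambda>a. c * f a) sequentially"
      using bf by (intro uniform_lim_mult approx(3)[OF f]) auto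
    show ?thesis
    proof (rule LIMSEQ_unique)
      show "(\<lambda>n. cinner (T (\<lambda>a. q n * approx f n a) \<xi>) \<eta>) \<longlonglongrightarrow> ext (\<lambda>a. c * f a) \<xi> \<eta>"
        by (intro ext_limit u rational_denseD(3)[OF D q(1) approx(1)[OF f]] continuous_intros f)
      show "(\<lambda>n. cinner (T (\<lambda>a. q n * approx f n a) \<xi>) \<eta>) \<longlonglongrightarrow> complex_of_real c * ext f \<xi> \<eta>"
        unfolding T_scale[OF q(1) approx(1)[OF f]] cinner_scaleC_left
        by (intro tendsto_mult tendsto_of_real qc tl f)
    qed
  qed
  have one: "ext (\<lambda>_. 1) \<xi> \<eta> = cinner \<xi> \<eta>" for \<xi> \<eta>
    by (simp add: extD rational_denseD(4)[OF D] T_one)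
  have imf: "Im (ext f \<xi> \<xi>) = 0" if f: "continuous_on UNIV f" for f \<xi>
  proof -
    obtain K where K: "\<And>a. norm (f a) \<le> K" using compact_continuous_bounded[OF compact f] by blast
    have "0 \<le> K * 1 + f a" for a using K[of a] by (simp add: abs_le_iff)
    then have "Im (ext (\<lambda>a. K * 1 + f a) \<xi> \<xi>) = 0"
      using f by (intro im continuous_intros)
    also have "ext (\<lambda>a. K * 1 + f a) \<xi> \<xi> = complex_of_real K * cinner \<xi> \<xi> + ext f \<xi> \<xi>"
      by (subst add) (auto intro!: continuous_intros f simp: scale[of "\<lambda>_. 1" K, simplified] one)
    finally show ?thesis by (simp add: cinner_self)
  qed
  have form: "form_with_diagonal (ext f) (\<lambda>\<xi>. Re (ext f \<xi> \<xi>))" if f: "continuous_on UNIV f" for f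
  proof (rule form_with_diagonal_limit)
    show "(\<lambda>n. cinner (T (approx f n) x) y) \<longlonglongrightarrow> ext f x y" for x y by (rule tl[OF f])
    show "(\<lambda>n. Re (ext (approx f n) x x)) \<longlonglongrightarrow> Re (ext f x x)" for x
      unfolding extD[OF approx(1)[OF f]] by (intro tendsto_Re tl f)
    show "form_with_diagonal (\<lambda>x y. cinner (T (approx f n) x) y) (\<lambda>x. Re (ext (approx f n) x x))" for n
      unfolding form_with_diagonal_def extD[OF approx(1)[OF f]]
      using imf[OF rational_denseD(1)[OF D approx(1)[OF f]], of n]
      by (simp add: bounded_opD[OF T_bounded[OF approx(1)[OF f]]] cinner_add_left cinner_add_right
          cinner_scaleC_left cinner_scaleC_right complex_eq_iff extD[OF approx(1)[OF f]])
  qed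
  obtain E where E: "E \<in> quantum_prob"
    "\<And>f \<xi>. continuous_on UNIV f \<Longrightarrow> complex_of_real (integral\<^sup>L (qmeasure E \<xi>) f) = ext f \<xi> \<xi>"
    using quantum_prob_from_forms[where B = ext, OF compact add scale form nonneg one] by blast
  show ?thesis
    using E(2)[OF rational_denseD(1)[OF D]] extD by (intro bexI[OF _ E(1)]) simp
qed

end

section \<open>The algebra of essentially bounded operator functions\<close>

definition Linf_class :: "'x measure \<Rightarrow> ('x \<Rightarrow> 'h \<Rightarrow> 'h) \<Rightarrow> ('x \<Rightarrow> 'h::complex_hilbert_space \<Rightarrow> 'h) set"
  where "Linf_class M g = Linf_rel M `` {g}"

lemma equiv_Linf_rel: "equiv (Linf_fun M) (Linf_rel M)"
proof (rule equivI)
  show "Linf_rel M \<subseteq> Linf_fun M \<times> Linf_fun M" unfolding Linf_rel_def by auto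
  show "refl_on (Linf_fun M) (Linf_rel M)" unfolding Linf_rel_def refl_on_def by auto
  show "sym (Linf_rel M)" unfolding Linf_rel_def sym_def by (auto elim!: eventually_mono)
  show "trans (Linf_rel M)"
    unfolding Linf_rel_def trans_def by (auto elim: eventually_elim2)
qed

lemma in_Linf_class: "g \<in> Linf_fun M \<Longrightarrow> h \<in> Linf_class M g \<longleftrightarrow> h \<in> Linf_fun M \<and> (AE x in M. h x = g x)"
  unfolding Linf_class_def Linf_rel_def by (auto elim!: eventually_mono)

lemma Linf_class_self: "g \<in> Linf_fun M \<Longrightarrow> g \<in> Linf_class M g"
  by (simp add: in_Linf_class)

lemma Linf_class_eqI: "g \<in> Linf_fun M \<Longrightarrow> h \<in> Linf_fun M \<Longrightarrow> AE x in M. g x = h x \<Longrightarrow> Linf_class M g = Linf_class M h"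
  unfolding Linf_class_def by (rule equiv_class_eq[OF equiv_Linf_rel]) (simp add: Linf_rel_def)

lemma Linf_class_eqD: "Linf_class M g = Linf_class M h \<Longrightarrow> g \<in> Linf_fun M \<Longrightarrow> h \<in> Linf_fun M \<Longrightarrow> AE x in M. g x = h x"
  using in_Linf_class[of h M g] Linf_class_self[of g M] by simp

text \<open>Each operation of the algebra is the image of a set of functions under the equivalence relation; it is
  a single class as soon as the functions agree almost everywhere.\<close>

lemma Linf_rel_Image:
  assumes "g \<in> A" "\<And>p. p \<in> A \<Longrightarrow> p \<in> Linf_fun M \<and> (AE x in M. p x = g x)"
  shows "Linf_rel M `` A = Linf_class M g"
proof -
  have "Linf_rel M `` A = (\<Union>p\<in>A. Linf_class M p)" unfolding Linf_class_def by blast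
  also have "\<dots> = (\<Union>p\<in>A. Linf_class M g)"
    using assms by (intro SUP_cong refl Linf_class_eqI) auto
  also have "\<dots> = Linf_class M g" using assms(1) by blast
  finally show ?thesis .
qed

lemma Linf_carrier: "carrier (Linf_alg M) = Linf_fun M // Linf_rel M"
  by (simp add: Linf_alg_def)

lemma Linf_class_carrier: "g \<in> Linf_fun M \<Longrightarrow> Linf_class M g \<in> carrier (Linf_alg M)"
  unfolding Linf_carrier Linf_class_def by (rule quotientI)

lemma Linf_carrierE:
  assumes "P \<in> carrier (Linf_alg M)"
  obtains g where "g \<in> Linf_fun M" "P = Linf_class M g"
  using assms unfolding Linf_carrier Linf_class_def by (rule quotientE)

lemma Linf_one: "\<one>\<^bsub>Linf_alg M\<^esub> = Linf_class M (\<lambda>x \<xi>. \<xi>)"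
  and Linf_zero: "\<zero>\<^bsub>Linf_alg M\<^esub> = Linf_class M (\<lambda>x \<xi>. 0)"
  by (simp_all add: Linf_alg_def Linf_class_def)

context
  fixes M :: "'x measure"
  assumes sep: "separable_space (euclidean :: 'h::complex_hilbert_space topology)"
begin

lemma Linf_add:
  assumes g: "g \<in> Linf_fun M" and h: "(h :: 'x \<Rightarrow> 'h \<Rightarrow> 'h) \<in> Linf_fun M"
  shows "Linf_class M g \<oplus>\<^bsub>Linf_alg M\<^esub> Linf_class M h = Linf_class M (\<lambda>x \<xi>. g x \<xi> + h x \<xi>)"
  unfolding Linf_alg_def ring_record_simps
proof (rule Linf_rel_Image)
  show "(\<lambda>x \<xi>. g x \<xi> + h x \<xi>) \<in> {\<lambda>x \<xi>. p x \<xi> + q x \<xi> |p q. p \<in> Linf_class M g \<and> q \<in> Linf_class M h}"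
    using Linf_class_self[OF g] Linf_class_self[OF h] by blast
  fix r assume "r \<in> {\<lambda>x \<xi>. p x \<xi> + q x \<xi> |p q. p \<in> Linf_class M g \<and> q \<in> Linf_class M h}"
  then obtain p q where r: "r = (\<lambda>x \<xi>. p x \<xi> + q x \<xi>)" and p: "p \<in> Linf_fun M" "AE x in M. p x = g x"
    and q: "q \<in> Linf_fun M" "AE x in M. q x = h x" by (auto simp: in_Linf_class g h)
  have "AE x in M. r x = (\<lambda>\<xi>. g x \<xi> + h x \<xi>)" using p(2) q(2) unfolding r by eventually_elim simp
  then show "r \<in> Linf_fun M \<and> (AE x in M. r x = (\<lambda>\<xi>. g x \<xi> + h x \<xi>))"
    unfolding r using Linf_fun_add[OF sep p(1) q(1)] by simp
qed

lemma Linf_mult: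
  assumes g: "g \<in> Linf_fun M" and h: "(h :: 'x \<Rightarrow> 'h \<Rightarrow> 'h) \<in> Linf_fun M"
  shows "Linf_class M g \<otimes>\<^bsub>Linf_alg M\<^esub> Linf_class M h = Linf_class M (\<lambda>x. g x \<circ> h x)"
  unfolding Linf_alg_def monoid.simps
proof (rule Linf_rel_Image)
  show "(\<lambda>x. g x \<circ> h x) \<in> {\<lambda>x. p x \<circ> q x |p q. p \<in> Linf_class M g \<and> q \<in> Linf_class M h}"
    using Linf_class_self[OF g] Linf_class_self[OF h] by blast
  fix r assume "r \<in> {\<lambda>x. p x \<circ> q x |p q. p \<in> Linf_class M g \<and> q \<in> Linf_class M h}"
  then obtain p q where r: "r = (\<lambda>x. p x \<circ> q x)" and p: "p \<in> Linf_fun M" "AE x in M. p x = g x"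
    and q: "q \<in> Linf_fun M" "AE x in M. q x = h x" by (auto simp: in_Linf_class g h)
  have "AE x in M. r x = g x \<circ> h x" using p(2) q(2) unfolding r by eventually_elim simp
  then show "r \<in> Linf_fun M \<and> (AE x in M. r x = g x \<circ> h x)"
    unfolding r using Linf_fun_comp[OF sep p(1) q(1)] by simp
qed

lemma Linf_smult:
  assumes g: "(g :: 'x \<Rightarrow> 'h \<Rightarrow> 'h) \<in> Linf_fun M"
  shows "c \<odot>\<^bsub>Linf_alg M\<^esub> Linf_class M g = Linf_class M (\<lambda>x \<xi>. scaleC c (g x \<xi>))"
  unfolding Linf_alg_def module.simps
proof (rule Linf_rel_Image)
  show "(\<lambda>x \<xi>. scaleC c (g x \<xi>)) \<in> {\<lambda>x \<xi>. scaleC c (p x \<xi>) |p. p \<in> Linf_class M g}"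
    using Linf_class_self[OF g] by blast
  fix r assume "r \<in> {\<lambda>x \<xi>. scaleC c (p x \<xi>) |p. p \<in> Linf_class M g}"
  then obtain p where r: "r = (\<lambda>x \<xi>. scaleC c (p x \<xi>))" and p: "p \<in> Linf_fun M" "AE x in M. p x = g x"
    by (auto simp: in_Linf_class g)
  have "AE x in M. r x = (\<lambda>\<xi>. scaleC c (g x \<xi>))" using p(2) unfolding r by eventually_elim simp
  then show "r \<in> Linf_fun M \<and> (AE x in M. r x = (\<lambda>\<xi>. scaleC c (g x \<xi>)))"
    unfolding r using Linf_fun_scaleC[OF sep p(1)] by simp
qed

lemma Linf_star:
  assumes g: "(g :: 'x \<Rightarrow> 'h \<Rightarrow> 'h) \<in> Linf_fun M"
  shows "star (Linf_alg M) (Linf_class M g) = Linf_class M (\<lambda>x. adjoint_op (g x))"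
  unfolding Linf_alg_def star_algebra.simps
proof (rule Linf_rel_Image)
  show "(\<lambda>x. adjoint_op (g x)) \<in> {\<lambda>x. adjoint_op (p x) |p. p \<in> Linf_class M g}"
    using Linf_class_self[OF g] by blast
  fix r assume "r \<in> {\<lambda>x. adjoint_op (p x) |p. p \<in> Linf_class M g}"
  then obtain p where r: "r = (\<lambda>x. adjoint_op (p x))" and p: "p \<in> Linf_fun M" "AE x in M. p x = g x"
    by (auto simp: in_Linf_class g)
  have "AE x in M. r x = adjoint_op (g x)" using p(2) unfolding r by eventually_elim simp
  then show "r \<in> Linf_fun M \<and> (AE x in M. r x = adjoint_op (g x))"
    unfolding r using Linf_fun_adjoint[OF sep p(1)] by simp
qed

lemma Linf_star_mult:
  assumes g: "g \<in> Linf_fun M" and h: "(h :: 'x \<Rightarrow> 'h \<Rightarrow> 'h) \<in> Linf_fun M"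
  shows "star (Linf_alg M) (Linf_class M g) \<otimes>\<^bsub>Linf_alg M\<^esub> Linf_class M h
    = Linf_class M (\<lambda>x. adjoint_op (g x) \<circ> h x)"
    "(\<lambda>x. adjoint_op (g x) \<circ> h x) \<in> Linf_fun M"
  using Linf_star[OF g] Linf_mult[OF Linf_fun_adjoint[OF sep g] h] Linf_fun_comp[OF sep Linf_fun_adjoint[OF sep g] h]
  by simp_all

lemma abelian_monoid_Linf: "abelian_monoid (Linf_alg M :: ('x \<Rightarrow> 'h \<Rightarrow> 'h) set star_algebra)"
proof (rule abelian_monoidI)
  have z: "(\<lambda>(x::'x) (\<xi>::'h). 0) \<in> Linf_fun M" by (rule Linf_fun_const[OF sep bounded_op_zero])
  then show "\<zero>\<^bsub>Linf_alg M\<^esub> \<in> carrier (Linf_alg M :: ('x \<Rightarrow> 'h \<Rightarrow> 'h) set star_algebra)"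
    unfolding Linf_zero by (rule Linf_class_carrier)
  fix P Q R :: "('x \<Rightarrow> 'h \<Rightarrow> 'h) set"
  assume P: "P \<in> carrier (Linf_alg M)"
  then obtain p where p: "p \<in> Linf_fun M" "P = Linf_class M p" by (rule Linf_carrierE)
  show "\<zero>\<^bsub>Linf_alg M\<^esub> \<oplus>\<^bsub>Linf_alg M\<^esub> P = P"
    unfolding p(2) Linf_zero Linf_add[OF z p(1)] by simp
  assume "Q \<in> carrier (Linf_alg M)"
  then obtain q where q: "q \<in> Linf_fun M" "Q = Linf_class M q" by (rule Linf_carrierE)
  show "P \<oplus>\<^bsub>Linf_alg M\<^esub> Q \<in> carrier (Linf_alg M)"
    unfolding p(2) q(2) Linf_add[OF p(1) q(1)] by (rule Linf_class_carrier[OF Linf_fun_add[OF sep p(1) q(1)]])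
  show "P \<oplus>\<^bsub>Linf_alg M\<^esub> Q = Q \<oplus>\<^bsub>Linf_alg M\<^esub> P"
    unfolding p(2) q(2) Linf_add[OF p(1) q(1)] Linf_add[OF q(1) p(1)] by (simp add: add.commute)
  assume "R \<in> carrier (Linf_alg M)"
  then obtain r where r: "r \<in> Linf_fun M" "R = Linf_class M r" by (rule Linf_carrierE)
  show "(P \<oplus>\<^bsub>Linf_alg M\<^esub> Q) \<oplus>\<^bsub>Linf_alg M\<^esub> R = P \<oplus>\<^bsub>Linf_alg M\<^esub> (Q \<oplus>\<^bsub>Linf_alg M\<^esub> R)"
    unfolding p(2) q(2) r(2) Linf_add[OF p(1) q(1)] Linf_add[OF q(1) r(1)]
      Linf_add[OF Linf_fun_add[OF sep p(1) q(1)] r(1)] Linf_add[OF p(1) Linf_fun_add[OF sep q(1) r(1)]]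
    by (simp add: add.assoc)
qed

lemma Linf_finsum:
  assumes "finite I" and g: "\<And>i. i \<in> I \<Longrightarrow> (g i :: 'x \<Rightarrow> 'h \<Rightarrow> 'h) \<in> Linf_fun M"
  shows "(\<lambda>x \<xi>. \<Sum>i\<in>I. g i x \<xi>) \<in> Linf_fun M \<and>
    (\<Oplus>\<^bsub>Linf_alg M\<^esub>i\<in>I. Linf_class M (g i)) = Linf_class M (\<lambda>x \<xi>. \<Sum>i\<in>I. g i x \<xi>)"
  using assms
proof (induction I rule: finite_induct)
  case empty
  interpret abelian_monoid "Linf_alg M :: ('x \<Rightarrow> 'h \<Rightarrow> 'h) set star_algebra" by (rule abelian_monoid_Linf)
  show ?case using Linf_fun_const[OF sep bounded_op_zero] by (simp add: Linf_zero)
next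
  case (insert i I)
  interpret abelian_monoid "Linf_alg M :: ('x \<Rightarrow> 'h \<Rightarrow> 'h) set star_algebra" by (rule abelian_monoid_Linf)
  have IH: "(\<lambda>x \<xi>. \<Sum>i\<in>I. g i x \<xi>) \<in> Linf_fun M"
    "(\<Oplus>\<^bsub>Linf_alg M\<^esub>i\<in>I. Linf_class M (g i)) = Linf_class M (\<lambda>x \<xi>. \<Sum>i\<in>I. g i x \<xi>)"
    using insert by auto
  have gi: "g i \<in> Linf_fun M" using insert by simp
  have "(\<Oplus>\<^bsub>Linf_alg M\<^esub>i\<in>insert i I. Linf_class M (g i))
     = Linf_class M (g i) \<oplus>\<^bsub>Linf_alg M\<^esub> (\<Oplus>\<^bsub>Linf_alg M\<^esub>i\<in>I. Linf_class M (g i))"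
    using insert by (intro finsum_insert) (auto intro: Linf_class_carrier)
  also have "\<dots> = Linf_class M (\<lambda>x \<xi>. g i x \<xi> + (\<Sum>i\<in>I. g i x \<xi>))"
    unfolding IH(2) by (rule Linf_add[OF gi IH(1)])
  finally show ?case
    using Linf_fun_add[OF sep gi IH(1)] insert(1,2) by simp
qed

text \<open>The finite sums of the abstract algebra, computed on representatives.\<close>

lemma positive_matrix_Linf_iff:
  fixes P :: "nat \<Rightarrow> nat \<Rightarrow> ('x \<Rightarrow> 'h \<Rightarrow> 'h) set"
  shows "positive_matrix (Linf_alg M) n P \<longleftrightarrow>
    (\<exists>R. (\<forall>i<n. \<forall>j<n. R i j \<in> Linf_fun M) \<and>
      (\<forall>i<n. \<forall>j<n. P i j = Linf_class M (\<lambda>x \<xi>. \<Sum>k<n. adjoint_op (R k i x) (R k j x \<xi>))))"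
proof -
  have eq: "(\<Oplus>\<^bsub>Linf_alg M\<^esub>k\<in>{..<n}. star (Linf_alg M) (S k i) \<otimes>\<^bsub>Linf_alg M\<^esub> S k j)
      = Linf_class M (\<lambda>x \<xi>. \<Sum>k<n. adjoint_op (R k i x) (R k j x \<xi>))"
    if R: "\<And>i j. i < n \<Longrightarrow> j < n \<Longrightarrow> R i j \<in> Linf_fun M" and S: "\<And>i j. i < n \<Longrightarrow> j < n \<Longrightarrow> S i j = Linf_class M (R i j)"
      and ij: "i < n" "j < n" for R :: "nat \<Rightarrow> nat \<Rightarrow> 'x \<Rightarrow> 'h \<Rightarrow> 'h" and S i j
  proof -
    interpret abelian_monoid "Linf_alg M :: ('x \<Rightarrow> 'h \<Rightarrow> 'h) set star_algebra" by (rule abelian_monoid_Linf)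
    have sm: "(\<lambda>x. adjoint_op (R k i x) \<circ> R k j x) \<in> Linf_fun M" if "k < n" for k
      by (rule Linf_star_mult(2)[OF R[OF that ij(1)] R[OF that ij(2)]])
    have "(\<Oplus>\<^bsub>Linf_alg M\<^esub>k\<in>{..<n}. star (Linf_alg M) (S k i) \<otimes>\<^bsub>Linf_alg M\<^esub> S k j)
      = (\<Oplus>\<^bsub>Linf_alg M\<^esub>k\<in>{..<n}. Linf_class M (\<lambda>x. adjoint_op (R k i x) \<circ> R k j x))"
      using sm by (intro finsum_cong' refl)
        (auto simp: S ij Linf_star_mult(1) R intro: Linf_class_carrier)
    then show ?thesis using Linf_finsum[of "{..<n}" "\<lambda>k x. adjoint_op (R k i x) \<circ> R k j x"] sm by simp
  qed
  show ?thesis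
  proof
    assume "positive_matrix (Linf_alg M) n P"
    then obtain S where S: "\<And>i j. i < n \<Longrightarrow> j < n \<Longrightarrow> S i j \<in> carrier (Linf_alg M)"
      "\<And>i j. i < n \<Longrightarrow> j < n \<Longrightarrow> P i j = (\<Oplus>\<^bsub>Linf_alg M\<^esub>k\<in>{..<n}. star (Linf_alg M) (S k i) \<otimes>\<^bsub>Linf_alg M\<^esub> S k j)"
      unfolding positive_matrix_def by blast
    have "\<forall>i j. \<exists>g. i < n \<and> j < n \<longrightarrow> g \<in> Linf_fun M \<and> S i j = Linf_class M g"
      using S(1) Linf_carrierE by metis
    then obtain R where "\<And>i j. i < n \<Longrightarrow> j < n \<Longrightarrow> R i j \<in> Linf_fun M \<and> S i j = Linf_class M (R i j)" by metis
    then show "\<exists>R. (\<forall>i<n. \<forall>j<n. R i j \<in> Linf_fun M) \<and>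
      (\<forall>i<n. \<forall>j<n. P i j = Linf_class M (\<lambda>x \<xi>. \<Sum>k<n. adjoint_op (R k i x) (R k j x \<xi>)))"
      using eq[of R S] S(2) by (intro exI[of _ R]) auto
  next
    assume "\<exists>R. (\<forall>i<n. \<forall>j<n. R i j \<in> Linf_fun M) \<and>
      (\<forall>i<n. \<forall>j<n. P i j = Linf_class M (\<lambda>x \<xi>. \<Sum>k<n. adjoint_op (R k i x) (R k j x \<xi>)))"
    then obtain R where R: "\<And>i j. i < n \<Longrightarrow> j < n \<Longrightarrow> R i j \<in> Linf_fun M"
      "\<And>i j. i < n \<Longrightarrow> j < n \<Longrightarrow> P i j = Linf_class M (\<lambda>x \<xi>. \<Sum>k<n. adjoint_op (R k i x) (R k j x \<xi>))" by blast
    show "positive_matrix (Linf_alg M) n P"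
      unfolding positive_matrix_def
      using R eq[of R "\<lambda>i j. Linf_class M (R i j)"]
      by (intro exI[of _ "\<lambda>i j. Linf_class M (R i j)"]) (auto intro: Linf_class_carrier)
  qed
qed

end

lemma abelian_monoid_cont: "abelian_monoid (cont_alg :: ('a::topological_space \<Rightarrow> complex) star_algebra)"
  by (rule abelian_monoidI) (auto simp: cont_alg_def algebra_simps intro: continuous_on_add)

lemma cont_finsum:
  assumes "finite I" and f: "\<And>i. i \<in> I \<Longrightarrow> continuous_on UNIV (f i :: 'a::topological_space \<Rightarrow> complex)"
  shows "(\<Oplus>\<^bsub>cont_alg\<^esub>i\<in>I. f i) = (\<lambda>a. \<Sum>i\<in>I. f i a)"
  using assms
proof (induction I rule: finite_induct)
  case empty
  interpret abelian_monoid "cont_alg :: ('a \<Rightarrow> complex) star_algebra" by (rule abelian_monoid_cont)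
  show ?case unfolding finsum_empty by (simp add: cont_alg_def)
next
  case (insert i I)
  interpret abelian_monoid "cont_alg :: ('a \<Rightarrow> complex) star_algebra" by (rule abelian_monoid_cont)
  have "(\<Oplus>\<^bsub>cont_alg\<^esub>i\<in>insert i I. f i) = f i \<oplus>\<^bsub>cont_alg\<^esub> (\<Oplus>\<^bsub>cont_alg\<^esub>i\<in>I. f i)"
    using insert by (intro finsum_insert) (auto simp: cont_alg_def)
  then show ?case using insert by (simp add: cont_alg_def)
qed

lemma positive_matrix_cont_iff:
  fixes P :: "nat \<Rightarrow> nat \<Rightarrow> 'a::topological_space \<Rightarrow> complex"
  shows "positive_matrix cont_alg n P \<longleftrightarrow>
    (\<exists>S. (\<forall>i<n. \<forall>j<n. continuous_on UNIV (S i j)) \<and>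
      (\<forall>i<n. \<forall>j<n. P i j = (\<lambda>a. \<Sum>k<n. cnj (S k i a) * S k j a)))"
proof -
  have eq: "(\<Oplus>\<^bsub>cont_alg\<^esub>k\<in>{..<n}. star cont_alg (S k i) \<otimes>\<^bsub>cont_alg\<^esub> S k j) = (\<lambda>a. \<Sum>k<n. cnj (S k i a) * S k j a)"
    if S: "\<And>i j. i < n \<Longrightarrow> j < n \<Longrightarrow> continuous_on UNIV (S i j)" and ij: "i < n" "j < n"
    for S :: "nat \<Rightarrow> nat \<Rightarrow> 'a \<Rightarrow> complex" and i j
  proof -
    have "star cont_alg (S k i) \<otimes>\<^bsub>cont_alg\<^esub> S k j = (\<lambda>a. cnj (S k i a) * S k j a)" for k
      by (simp add: cont_alg_def)
    then have "(\<Oplus>\<^bsub>cont_alg\<^esub>k\<in>{..<n}. star cont_alg (S k i) \<otimes>\<^bsub>cont_alg\<^esub> S k j) = (\<Oplus>\<^bsub>cont_alg\<^esub>k\<in>{..<n}. (\<lambda>a. cnj (S k i a) * S k j a))"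
      by simp
    also have "\<dots> = (\<lambda>a. \<Sum>k<n. cnj (S k i a) * S k j a)"
      using S ij by (intro cont_finsum) (auto intro!: continuous_intros)
    finally show ?thesis .
  qed
  have "positive_matrix cont_alg n P \<longleftrightarrow> (\<exists>S. (\<forall>i<n. \<forall>j<n. continuous_on UNIV (S i j)) \<and>
      (\<forall>i<n. \<forall>j<n. P i j = (\<Oplus>\<^bsub>cont_alg\<^esub>k\<in>{..<n}. star cont_alg (S k i) \<otimes>\<^bsub>cont_alg\<^esub> S k j)))"
    unfolding positive_matrix_def by (simp add: cont_alg_def)
  also have "\<dots> \<longleftrightarrow> (\<exists>S. (\<forall>i<n. \<forall>j<n. continuous_on UNIV (S i j)) \<and>
      (\<forall>i<n. \<forall>j<n. P i j = (\<lambda>a. \<Sum>k<n. cnj (S k i a) * S k j a)))"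
  proof (intro ex_cong1 conj_cong refl)
    fix S :: "nat \<Rightarrow> nat \<Rightarrow> 'a \<Rightarrow> complex"
    assume "\<forall>i<n. \<forall>j<n. continuous_on UNIV (S i j)"
    then show "(\<forall>i<n. \<forall>j<n. P i j = (\<Oplus>\<^bsub>cont_alg\<^esub>k\<in>{..<n}. star cont_alg (S k i) \<otimes>\<^bsub>cont_alg\<^esub> S k j)) \<longleftrightarrow>
      (\<forall>i<n. \<forall>j<n. P i j = (\<lambda>a. \<Sum>k<n. cnj (S k i a) * S k j a))"
      using eq[of S] by simp
  qed
  finally show ?thesis .
qed

section \<open>The channel as a completely positive map\<close>

lemma compact_continuous_borel_bounded:
  fixes f :: "'a::topological_space \<Rightarrow> complex"
  assumes "compact (UNIV :: 'a set)" "continuous_on UNIV f"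
  obtains K where "f \<in> borel_measurable borel" "\<And>a. cmod (f a) \<le> K" "K \<ge> 0"
proof -
  obtain K where "K \<ge> 0" "\<And>a. norm (f a) \<le> K" using compact_continuous_bounded[OF assms] by blast
  then show ?thesis using that borel_measurable_continuous_onI[OF assms(2)] by blast
qed

context
  fixes E :: "'a::topological_space set \<Rightarrow> 'h \<Rightarrow> 'h::complex_hilbert_space"
  assumes compact: "compact (UNIV :: 'a set)" and E: "E \<in> quantum_prob"
begin

lemma continuous_integrable_qmeasure: "continuous_on UNIV f \<Longrightarrow> integrable (qmeasure E \<xi>) (f :: 'a \<Rightarrow> complex)"
  by (rule compact_continuous_borel_bounded[OF compact], assumption) (rule finite_borel_integrable[OF qmeasure(1)[OF E]])

lemma qintegral_sum:
  assumes f: "\<And>i. i \<in> I \<Longrightarrow> continuous_on UNIV (f i :: 'a \<Rightarrow> complex)"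
  shows "qintegral E (\<lambda>a. \<Sum>i\<in>I. f i a) \<xi> \<eta> = (\<Sum>i\<in>I. qintegral E (f i) \<xi> \<eta>)"
proof -
  have "qintegral E (\<lambda>a. \<Sum>i\<in>I. f i a) \<xi> \<eta> = (\<Sum>k<4. \<Sum>i\<in>I. \<i> ^ k * integral\<^sup>L (qmeasure E (\<xi> + scaleC (\<i> ^ k) \<eta>)) (f i)) / 4"
    unfolding qintegral_def
    by (subst Bochner_Integration.integral_sum) (auto intro!: continuous_integrable_qmeasure f simp: sum_distrib_left)
  also have "\<dots> = (\<Sum>i\<in>I. qintegral E (f i) \<xi> \<eta>)"
    unfolding qintegral_def by (subst sum.swap) (simp add: sum_divide_distrib)
  finally show ?thesis .
qed

lemma qop_continuous:
  assumes "continuous_on UNIV (f :: 'a \<Rightarrow> complex)"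
  shows "bounded_op (qop E f)" "cinner (qop E f \<xi>) \<eta> = qintegral E f \<xi> \<eta>"
  using compact_continuous_borel_bounded[OF compact assms] qop(1,2)[OF E, of f] by metis+

lemma qop_add:
  assumes f: "continuous_on UNIV f" and g: "continuous_on UNIV (g :: 'a \<Rightarrow> complex)"
  shows "qop E (\<lambda>a. f a + g a) = (\<lambda>\<xi>. qop E f \<xi> + qop E g \<xi>)"
proof (rule ext, rule cinner_ext_left)
  fix \<xi> \<eta>
  have "qintegral E (\<lambda>a. \<Sum>b\<in>UNIV. if b then f a else g a) \<xi> \<eta>
      = (\<Sum>b\<in>UNIV. qintegral E (\<lambda>a. if b then f a else g a) \<xi> \<eta>)"
  proof (rule qintegral_sum)
    show "continuous_on UNIV (\<lambda>a. if b then f a else g a)" for b using f g by (cases b) auto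
  qed
  then have "qintegral E (\<lambda>a. f a + g a) \<xi> \<eta> = qintegral E f \<xi> \<eta> + qintegral E g \<xi> \<eta>"
    by (simp add: UNIV_bool add.commute)
  then show "cinner (qop E (\<lambda>a. f a + g a) \<xi>) \<eta> = cinner (qop E f \<xi> + qop E g \<xi>) \<eta>"
    by (simp add: cinner_add_left qop_continuous f g continuous_on_add)
qed

lemma qop_smult:
  assumes f: "continuous_on UNIV (f :: 'a \<Rightarrow> complex)"
  shows "qop E (\<lambda>a. c * f a) = (\<lambda>\<xi>. scaleC c (qop E f \<xi>))"
proof (rule ext, rule cinner_ext_left)
  fix \<xi> \<eta>
  have "qintegral E (\<lambda>a. c * f a) \<xi> \<eta> = c * qintegral E f \<xi> \<eta>"
    unfolding qintegral_def by (simp add: sum_distrib_left mult.left_commute)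
  then show "cinner (qop E (\<lambda>a. c * f a) \<xi>) \<eta> = cinner (scaleC c (qop E f \<xi>)) \<eta>"
    by (simp add: cinner_scaleC_left qop_continuous f continuous_on_mult_left)
qed

lemma qop_one: "qop E (\<lambda>_. 1) = (\<lambda>\<xi>. \<xi>)"
proof (rule bounded_op_eqI[OF qop_continuous(1)[OF continuous_on_const] bounded_op_id])
  fix \<xi>
  have "qintegral E (\<lambda>_. 1) \<xi> \<xi> = integral\<^sup>L (qmeasure E \<xi>) (\<lambda>_. 1)"
    by (rule qintegral_sesquilinear(5)[OF E, of _ 1]) auto
  also have "\<dots> = complex_of_real (measure (qmeasure E \<xi>) UNIV)"
    using finite_borel_measureD(3)[OF qmeasure(1)[OF E], of \<xi>] by (simp add: scaleR_conv_of_real)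
  finally show "cinner (qop E (\<lambda>_. 1) \<xi>) \<xi> = cinner \<xi> \<xi>"
    unfolding qop_continuous(2)[OF continuous_on_const] qmeasure(3)[OF E] cinner_self .
qed

end

lemma sum_product_le:
  fixes t :: "nat \<Rightarrow> real"
  shows "(\<Sum>i<n. \<Sum>j<n. t i * t j) \<le> real n * (\<Sum>i<n. (t i)\<^sup>2)"
proof -
  have "(\<Sum>i<n. \<Sum>j<n. t i * t j) \<le> (\<Sum>i<n. \<Sum>j<n. ((t i)\<^sup>2 + (t j)\<^sup>2) / 2)"
  proof (intro sum_mono)
    fix i j
    have "0 \<le> (t i - t j)\<^sup>2" by simp
    then show "t i * t j \<le> ((t i)\<^sup>2 + (t j)\<^sup>2) / 2" by (simp add: power2_diff)
  qed
  also have "\<dots> = real n * (\<Sum>i<n. (t i)\<^sup>2)"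
    by (simp add: sum.distrib flip: sum_divide_distrib sum_distrib_left)
  finally show ?thesis .
qed

lemma channelsD:
  assumes "E \<in> channels"
  shows "E x \<in> quantum_prob" "\<alpha> \<in> sets borel \<Longrightarrow> (\<lambda>x. cinner (E x \<alpha> \<xi>) \<eta>) \<in> borel_measurable borel"
  using assms unfolding channels_def by blast+

context
  fixes M :: "'x::topological_space measure"
    and E :: "'x \<Rightarrow> 'a::topological_space set \<Rightarrow> 'h \<Rightarrow> 'h::complex_hilbert_space"
  assumes compact: "compact (UNIV :: 'a set)" and sep: "separable_space (euclidean :: 'h topology)"
    and borel: "sets M = sets borel" and E: "E \<in> channels"
begin

lemma qintegral_measurable:
  assumes f: "f \<in> borel_measurable borel" "\<And>a. cmod (f a) \<le> K"
  shows "(\<lambda>x. qintegral (E x) f \<xi> \<eta>) \<in> borel_measurable M"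
proof -
  obtain Z :: "nat \<Rightarrow> (nat \<Rightarrow> complex) set" and w T where T: "\<And>m z. T m z \<in> sets borel"
    and l: "\<And>(E :: 'a set \<Rightarrow> 'h \<Rightarrow> 'h) \<xi> \<eta>. E \<in> quantum_prob \<Longrightarrow>
       (\<lambda>m. \<Sum>z\<in>Z m. w z * cinner (E (T m z) \<xi>) \<eta>) \<longlonglongrightarrow> qintegral E f \<xi> \<eta>"
    by (rule qintegral_approx[OF f, where 'h = 'h]) blast
  show ?thesis
  proof (rule borel_measurable_LIMSEQ_metric)
    show "(\<lambda>m. \<Sum>z\<in>Z m. w z * cinner (E x (T m z) \<xi>) \<eta>) \<longlonglongrightarrow> qintegral (E x) f \<xi> \<eta>" for x
      by (rule l[OF channelsD(1)[OF E]])
    show "(\<lambda>x. \<Sum>z\<in>Z m. w z * cinner (E x (T m z) \<xi>) \<eta>) \<in> borel_measurable M" for m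
      unfolding measurable_cong_sets[OF borel refl]
      by (intro borel_measurable_sum borel_measurable_times channelsD(2)[OF E T]) simp
  qed
qed

lemma qop_Linf:
  assumes f: "continuous_on UNIV (f :: 'a \<Rightarrow> complex)"
  shows "(\<lambda>x. qop (E x) f) \<in> Linf_fun M"
proof -
  obtain K where K: "f \<in> borel_measurable borel" "\<And>a. cmod (f a) \<le> K" "K \<ge> 0"
    using compact_continuous_borel_bounded[OF compact f] by blast
  note q = qop[OF channelsD(1)[OF E] K(1,2)]
  show ?thesis
    by (rule Linf_funI[OF sep q(1) _ q(3)]) (use qintegral_measurable[OF K(1,2)] K(3) in \<open>simp_all add: q(2)\<close>)
qed

definition ucp_of_channel :: "('a \<Rightarrow> complex) \<Rightarrow> ('x \<Rightarrow> 'h \<Rightarrow> 'h) set"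
  where "ucp_of_channel = (\<lambda>f\<in>carrier cont_alg. Linf_class M (\<lambda>x. qop (E x) f))"

text \<open>The matrix of operators \<open>\<integral> P i j dE(\<cdot>|x)\<close> is positive and bounded by a constant independent of \<open>x\<close>, at
  every point \<open>x\<close>, so its measurable square root factorizes it.\<close>

lemma ucp_of_channel_positive:
  assumes P: "positive_matrix cont_alg n P"
  shows "positive_matrix (Linf_alg M) n (\<lambda>i j. Linf_class M (\<lambda>x. qop (E x) (P i j)))"
proof -
  obtain S where S: "\<And>i j. i < n \<Longrightarrow> j < n \<Longrightarrow> continuous_on UNIV (S i j)"
    and PS: "\<And>i j. i < n \<Longrightarrow> j < n \<Longrightarrow> P i j = (\<lambda>a. \<Sum>k<n. cnj (S k i a) * S k j a)"
    using P unfolding positive_matrix_cont_iff by blast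
  have cSS: "continuous_on UNIV (\<lambda>a. cnj (S k i a) * S k j a)" if "i < n" "j < n" "k < n" for i j k
    using S that by (intro continuous_intros)
  have cP: "continuous_on UNIV (P i j)" if "i < n" "j < n" for i j
    unfolding PS[OF that] using cSS that by (intro continuous_on_sum) auto
  have "\<forall>i j. \<exists>K\<ge>0. i < n \<and> j < n \<longrightarrow> (\<forall>a. cmod (P i j a) \<le> K)"
    using compact_continuous_bounded[OF compact cP] by (metis order_refl)
  then obtain K where K: "\<And>i j. K i j \<ge> 0" "\<And>i j a. i < n \<Longrightarrow> j < n \<Longrightarrow> cmod (P i j a) \<le> K i j" by metis
  define B where "B = (\<Sum>i<n. \<Sum>j<n. K i j)"
  have B0: "B \<ge> 0" unfolding B_def by (intro sum_nonneg K)
  have B: "cmod (P i j a) \<le> B" if ij: "i < n" "j < n" for i j a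
  proof -
    have "cmod (P i j a) \<le> K i j" by (rule K(2)[OF ij])
    also have "\<dots> \<le> (\<Sum>j<n. K i j)" using ij by (intro member_le_sum) (auto intro: K)
    also have "\<dots> \<le> B" unfolding B_def using ij by (intro member_le_sum[of i _ "\<lambda>i. \<Sum>j<n. K i j"]) (auto intro: sum_nonneg K)
    finally show ?thesis .
  qed
  note bm = borel_measurable_continuous_onI[OF cP]
  note qP = qop[OF channelsD(1)[OF E] bm B]
  \<comment> \<open>Entries have norm at most \<open>4 B\<close> and \<open>\<Sum> t\<^sub>i t\<^sub>j \<le> n \<Sum> t\<^sub>i\<^sup>2\<close>; adding 1 makes the bound positive.\<close>
  define c where "c = 4 * B * real n + 1"
  have "\<exists>R. (\<forall>i<n. \<forall>j<n. R i j \<in> Linf_fun M) \<and>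
    (\<forall>x\<in>space M. \<forall>i<n. \<forall>j<n. qop (E x) (P i j) = (\<lambda>\<xi>. \<Sum>k<n. adjoint_op (R k i x) (R k j x \<xi>)))"
  proof (rule positive_opmat_factorization[OF sep, where P = "\<lambda>x i j. qop (E x) (P i j)" and c = c])
    show "bounded_op (qop (E x) (P i j))" if "i < n" "j < n" for x i j by (rule qP(1)[OF that that])
    show "(\<lambda>x. cinner (qop (E x) (P i j) \<xi>) \<eta>) \<in> borel_measurable M" if ij: "i < n" "j < n" for i j \<xi> \<eta>
      by (rule Linf_funD(2)[OF sep qop_Linf[OF cP[OF ij]]])
    show "cinner (qop (E x) (P i j) \<xi>) \<eta> = cinner \<xi> (qop (E x) (P j i) \<eta>)" if ij: "i < n" "j < n" for x i j \<xi> \<eta>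
    proof -
      have e: "P i j = (\<lambda>a. cnj (P j i a))"
        unfolding PS[OF ij] PS[OF ij(2,1)] by (simp add: mult.commute)
      have "cinner (qop (E x) (P i j) \<xi>) \<eta> = qintegral (E x) (P i j) \<xi> \<eta>" by (rule qP(2)[OF ij ij])
      also have "\<dots> = cnj (qintegral (E x) (P j i) \<eta> \<xi>)"
        unfolding e by (rule qintegral_sesquilinear(6)[OF channelsD(1)[OF E] bm[OF ij(2,1)] B[OF ij(2,1)]])
      also have "\<dots> = cnj (cinner (qop (E x) (P j i) \<eta>) \<xi>)" unfolding qP(2)[OF ij(2,1) ij(2,1)] ..
      also have "\<dots> = cinner \<xi> (qop (E x) (P j i) \<eta>)" by (rule cinner_commute[symmetric])
      finally show ?thesis .
    qed
    show "0 \<le> Re (\<Sum>i<n. \<Sum>j<n. cinner (qop (E x) (P i j) (v j)) (v i))" for x v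
    proof -
      have pos: "0 \<le> Re (\<Sum>i<n. \<Sum>j<n. qintegral (E x) (\<lambda>a. cnj (S k i a) * S k j a) (v j) (v i))" if k: "k < n" for k
      proof -
        define h where "h i a = (if i < n then S k i a else 0)" for i a
        have ch: "continuous_on UNIV (h i)" for i
          unfolding h_def using S[OF k, of i] by (cases "i < n") auto
        have "\<forall>i. \<exists>K\<ge>0. \<forall>a. cmod (h i a) \<le> K"
          using compact_continuous_bounded[OF compact ch] by metis
        then obtain L where L: "\<And>i. L i \<ge> 0" "\<And>i a. cmod (h i a) \<le> L i" by metis
        have hb: "cmod (h i a) \<le> (\<Sum>i<n. L i)" for i a
        proof (cases "i < n")
          case True
          then have "L i \<le> (\<Sum>i<n. L i)" by (intro member_le_sum) (auto intro: L)
          with L(2)[of i a] show ?thesis by linarith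
        next
          case False
          then show ?thesis by (simp add: h_def sum_nonneg L)
        qed
        have "0 \<le> Re (\<Sum>i<n. \<Sum>j<n. qintegral (E x) (\<lambda>a. cnj (h i a) * h j a) (v j) (v i))"
          by (rule qintegral_completely_positive[OF channelsD(1)[OF E] borel_measurable_continuous_onI[OF ch] hb])
        also have "(\<Sum>i<n. \<Sum>j<n. qintegral (E x) (\<lambda>a. cnj (h i a) * h j a) (v j) (v i))
          = (\<Sum>i<n. \<Sum>j<n. qintegral (E x) (\<lambda>a. cnj (S k i a) * S k j a) (v j) (v i))"
          by (intro sum.cong refl) (simp add: h_def)
        finally show ?thesis .
      qed
      have "(\<Sum>i<n. \<Sum>j<n. cinner (qop (E x) (P i j) (v j)) (v i))
        = (\<Sum>i<n. \<Sum>j<n. \<Sum>k<n. qintegral (E x) (\<lambda>a. cnj (S k i a) * S k j a) (v j) (v i))"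
      proof (intro sum.cong refl)
        fix i j assume "i \<in> {..<n}" "j \<in> {..<n}"
        then have ij: "i < n" "j < n" by auto
        show "cinner (qop (E x) (P i j) (v j)) (v i) = (\<Sum>k<n. qintegral (E x) (\<lambda>a. cnj (S k i a) * S k j a) (v j) (v i))"
          unfolding qP(2)[OF ij ij] unfolding PS[OF ij]
          by (rule qintegral_sum[OF compact channelsD(1)[OF E]]) (use cSS ij in auto)
      qed
      also have "\<dots> = (\<Sum>i<n. \<Sum>k<n. \<Sum>j<n. qintegral (E x) (\<lambda>a. cnj (S k i a) * S k j a) (v j) (v i))"
        by (intro sum.cong refl sum.swap)
      also have "\<dots> = (\<Sum>k<n. \<Sum>i<n. \<Sum>j<n. qintegral (E x) (\<lambda>a. cnj (S k i a) * S k j a) (v j) (v i))"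
        by (rule sum.swap)
      finally have eq: "(\<Sum>i<n. \<Sum>j<n. cinner (qop (E x) (P i j) (v j)) (v i)) = \<dots>" .
      show ?thesis unfolding eq by (subst Re_sum) (intro sum_nonneg pos, simp)
    qed
    show "Re (\<Sum>i<n. \<Sum>j<n. cinner (qop (E x) (P i j) (v j)) (v i)) \<le> c * (\<Sum>i<n. (norm (v i))\<^sup>2)" for x v
    proof -
      have "Re (\<Sum>i<n. \<Sum>j<n. cinner (qop (E x) (P i j) (v j)) (v i)) \<le> cmod (\<Sum>i<n. \<Sum>j<n. cinner (qop (E x) (P i j) (v j)) (v i))"
        by (rule complex_Re_le_cmod)
      also have "\<dots> \<le> (\<Sum>i<n. \<Sum>j<n. 4 * B * (norm (v i) * norm (v j)))"
      proof (intro sum_norm_le)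
        fix i j assume "i \<in> {..<n}" "j \<in> {..<n}"
        then have ij: "i < n" "j < n" by auto
        have "cmod (cinner (qop (E x) (P i j) (v j)) (v i)) \<le> norm (qop (E x) (P i j) (v j)) * norm (v i)"
          by (rule cinner_cauchy_schwarz)
        also have "\<dots> \<le> (4 * B * norm (v j)) * norm (v i)"
          by (intro mult_right_mono qP(3)[OF ij ij]) simp
        finally show "cmod (cinner (qop (E x) (P i j) (v j)) (v i)) \<le> 4 * B * (norm (v i) * norm (v j))"
          by (simp add: mult_ac)
      qed
      also have "\<dots> = 4 * B * (\<Sum>i<n. \<Sum>j<n. norm (v i) * norm (v j))" by (simp only: sum_distrib_left)
      also have "\<dots> \<le> 4 * B * (real n * (\<Sum>i<n. (norm (v i))\<^sup>2))"
        using B0 by (intro mult_left_mono sum_product_le) simp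
      also have "\<dots> \<le> c * (\<Sum>i<n. (norm (v i))\<^sup>2)"
        unfolding c_def by (simp add: algebra_simps sum_nonneg)
      finally show ?thesis .
    qed
    show "c > 0" unfolding c_def using B0 by (simp add: add_nonneg_pos)
  qed
  then obtain R where R: "\<And>i j. i < n \<Longrightarrow> j < n \<Longrightarrow> R i j \<in> Linf_fun M"
    "\<And>x i j. x \<in> space M \<Longrightarrow> i < n \<Longrightarrow> j < n \<Longrightarrow> qop (E x) (P i j) = (\<lambda>\<xi>. \<Sum>k<n. adjoint_op (R k i x) (R k j x \<xi>))"
    by blast
  have sp: "space M = UNIV" using sets_eq_imp_space_eq[OF borel] by simp
  show ?thesis
    unfolding positive_matrix_Linf_iff[OF sep] using R by (intro exI[of _ R]) (simp add: sp)
qed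

lemma ucp_of_channel_ucp: "ucp_of_channel \<in> ucp_maps cont_alg (Linf_alg M)"
proof -
  have car: "carrier cont_alg = {f :: 'a \<Rightarrow> complex. continuous_on UNIV f}" by (simp add: cont_alg_def)
  have val: "ucp_of_channel f = Linf_class M (\<lambda>x. qop (E x) f)" if "continuous_on UNIV f" for f
    unfolding ucp_of_channel_def using that by (simp add: car)
  show ?thesis
    unfolding ucp_maps_def
  proof (intro CollectI conjI ballI allI impI)
    show "ucp_of_channel \<in> carrier cont_alg \<rightarrow>\<^sub>E carrier (Linf_alg M)"
      unfolding ucp_of_channel_def by (auto simp: car intro!: Linf_class_carrier qop_Linf)
    fix f :: "'a \<Rightarrow> complex" assume "f \<in> carrier cont_alg"
    then have f: "continuous_on UNIV f" by (simp add: car)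
    { fix g :: "'a \<Rightarrow> complex" assume "g \<in> carrier cont_alg"
      then have g: "continuous_on UNIV g" by (simp add: car)
      have "ucp_of_channel (f \<oplus>\<^bsub>cont_alg\<^esub> g) = Linf_class M (\<lambda>x. qop (E x) (\<lambda>a. f a + g a))"
        by (subst val[symmetric]) (auto simp: cont_alg_def intro: continuous_on_add f g)
      then show "ucp_of_channel (f \<oplus>\<^bsub>cont_alg\<^esub> g) = ucp_of_channel f \<oplus>\<^bsub>Linf_alg M\<^esub> ucp_of_channel g"
        unfolding val[OF f] val[OF g] Linf_add[OF sep qop_Linf[OF f] qop_Linf[OF g]] qop_add[OF compact channelsD(1)[OF E] f g] . }
    fix c
    have "ucp_of_channel (c \<odot>\<^bsub>cont_alg\<^esub> f) = Linf_class M (\<lambda>x. qop (E x) (\<lambda>a. c * f a))"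
      by (subst val[symmetric]) (auto simp: cont_alg_def intro: continuous_on_mult_left f)
    then show "ucp_of_channel (c \<odot>\<^bsub>cont_alg\<^esub> f) = c \<odot>\<^bsub>Linf_alg M\<^esub> ucp_of_channel f"
      unfolding val[OF f] Linf_smult[OF sep qop_Linf[OF f]] qop_smult[OF compact channelsD(1)[OF E] f] .
  next
    have "ucp_of_channel \<one>\<^bsub>cont_alg\<^esub> = Linf_class M (\<lambda>x. qop (E x) (\<lambda>_. 1))"
      by (subst val[symmetric]) (auto simp: cont_alg_def)
    then show "ucp_of_channel \<one>\<^bsub>cont_alg\<^esub> = \<one>\<^bsub>Linf_alg M\<^esub>"
      unfolding qop_one[OF compact channelsD(1)[OF E]] Linf_one .
  next
    fix n and P :: "nat \<Rightarrow> nat \<Rightarrow> 'a \<Rightarrow> complex"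
    assume c: "\<forall>i<n. \<forall>j<n. P i j \<in> carrier cont_alg" and p: "positive_matrix cont_alg n P"
    have "positive_matrix (Linf_alg M) n (\<lambda>i j. Linf_class M (\<lambda>x. qop (E x) (P i j)))"
      by (rule ucp_of_channel_positive[OF p])
    moreover have "ucp_of_channel (P i j) = Linf_class M (\<lambda>x. qop (E x) (P i j))" if "i < n" "j < n" for i j
      using c that by (intro val) (simp add: car)
    ultimately show "positive_matrix (Linf_alg M) n (\<lambda>i j. ucp_of_channel (P i j))"
      unfolding positive_matrix_def by simp
  qed
qed

lemma ucp_of_channel_value:
  "continuous_on UNIV f \<Longrightarrow> ucp_of_channel f = Linf_class M (\<lambda>x. qop (E x) f)"
  unfolding ucp_of_channel_def by (simp add: cont_alg_def)

end

section \<open>The channel of a completely positive map\<close>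

lemma cont_carrier: "f \<in> carrier cont_alg \<longleftrightarrow> continuous_on UNIV (f :: 'a::topological_space \<Rightarrow> complex)"
  by (simp add: cont_alg_def)

lemma ucp_mapsD:
  assumes "\<Phi> \<in> ucp_maps R S"
  shows "\<Phi> \<in> carrier R \<rightarrow>\<^sub>E carrier S"
    "a \<in> carrier R \<Longrightarrow> b \<in> carrier R \<Longrightarrow> \<Phi> (a \<oplus>\<^bsub>R\<^esub> b) = \<Phi> a \<oplus>\<^bsub>S\<^esub> \<Phi> b"
    "a \<in> carrier R \<Longrightarrow> \<Phi> (c \<odot>\<^bsub>R\<^esub> a) = c \<odot>\<^bsub>S\<^esub> \<Phi> a"
    "\<Phi> \<one>\<^bsub>R\<^esub> = \<one>\<^bsub>S\<^esub>"
    "(\<And>i j. i < n \<Longrightarrow> j < n \<Longrightarrow> P i j \<in> carrier R) \<Longrightarrow> positive_matrix R n P \<Longrightarrow> positive_matrix S n (\<lambda>i j. \<Phi> (P i j))"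
  using assms unfolding ucp_maps_def by simp_all

context
  fixes M :: "'x::topological_space measure"
    and \<Phi> :: "('a::{t2_space, second_countable_topology} \<Rightarrow> complex) \<Rightarrow> ('x \<Rightarrow> 'h \<Rightarrow> 'h::complex_hilbert_space) set"
  assumes compact: "compact (UNIV :: 'a set)" and sep: "separable_space (euclidean :: 'h topology)"
    and borel: "sets M = sets borel" and \<Phi>: "\<Phi> \<in> ucp_maps cont_alg (Linf_alg M)"
begin

lemma space_M: "space M = UNIV"
  using sets_eq_imp_space_eq[OF borel] by simp

definition rep :: "('a \<Rightarrow> complex) \<Rightarrow> 'x \<Rightarrow> 'h \<Rightarrow> 'h"
  where "rep f = (SOME g. g \<in> Linf_fun M \<and> \<Phi> f = Linf_class M g)"

lemma rep:
  assumes "continuous_on UNIV f"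
  shows "rep f \<in> Linf_fun M" "\<Phi> f = Linf_class M (rep f)"
proof -
  have "\<Phi> f \<in> carrier (Linf_alg M)"
    using ucp_mapsD(1)[OF \<Phi>] assms by (auto simp: cont_carrier)
  then have "\<exists>g. g \<in> Linf_fun M \<and> \<Phi> f = Linf_class M g" by (metis Linf_carrierE)
  then have "rep f \<in> Linf_fun M \<and> \<Phi> f = Linf_class M (rep f)" unfolding rep_def by (rule someI_ex)
  then show "rep f \<in> Linf_fun M" "\<Phi> f = Linf_class M (rep f)" by blast+
qed

lemma rep_bounded: "continuous_on UNIV f \<Longrightarrow> bounded_op (rep f x)"
  using Linf_funD(1)[OF sep rep(1)] by (simp add: space_M)

lemma rep_add:
  assumes f: "continuous_on UNIV f" and g: "continuous_on UNIV g"
  shows "AE x in M. rep (\<lambda>a. f a + g a) x = (\<lambda>\<xi>. rep f x \<xi> + rep g x \<xi>)"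
proof (rule Linf_class_eqD)
  have c: "continuous_on UNIV (\<lambda>a. f a + g a)" using f g by (rule continuous_on_add)
  have "\<Phi> (\<lambda>a. f a + g a) = \<Phi> f \<oplus>\<^bsub>Linf_alg M\<^esub> \<Phi> g"
    using ucp_mapsD(2)[OF \<Phi>, of f g] f g by (simp add: cont_carrier) (simp add: cont_alg_def)
  then show "Linf_class M (rep (\<lambda>a. f a + g a)) = Linf_class M (\<lambda>x \<xi>. rep f x \<xi> + rep g x \<xi>)"
    unfolding rep(2)[OF c] rep(2)[OF f] rep(2)[OF g] Linf_add[OF sep rep(1)[OF f] rep(1)[OF g]] .
  show "rep (\<lambda>a. f a + g a) \<in> Linf_fun M" by (rule rep(1)[OF c])
  show "(\<lambda>x \<xi>. rep f x \<xi> + rep g x \<xi>) \<in> Linf_fun M" by (rule Linf_fun_add[OF sep rep(1)[OF f] rep(1)[OF g]])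
qed

lemma rep_smult:
  assumes f: "continuous_on UNIV f"
  shows "AE x in M. rep (\<lambda>a. c * f a) x = (\<lambda>\<xi>. scaleC c (rep f x \<xi>))"
proof (rule Linf_class_eqD)
  have cf: "continuous_on UNIV (\<lambda>a. c * f a)" using f by (rule continuous_on_mult_left)
  have "\<Phi> (\<lambda>a. c * f a) = c \<odot>\<^bsub>Linf_alg M\<^esub> \<Phi> f"
    using ucp_mapsD(3)[OF \<Phi>, of f c] f by (simp add: cont_carrier) (simp add: cont_alg_def)
  then show "Linf_class M (rep (\<lambda>a. c * f a)) = Linf_class M (\<lambda>x \<xi>. scaleC c (rep f x \<xi>))"
    unfolding rep(2)[OF cf] rep(2)[OF f] Linf_smult[OF sep rep(1)[OF f]] .
  show "rep (\<lambda>a. c * f a) \<in> Linf_fun M" by (rule rep(1)[OF cf])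
  show "(\<lambda>x \<xi>. scaleC c (rep f x \<xi>)) \<in> Linf_fun M" by (rule Linf_fun_scaleC[OF sep rep(1)[OF f]])
qed

lemma rep_one: "AE x in M. rep (\<lambda>_. 1) x = (\<lambda>\<xi>. \<xi>)"
proof (rule Linf_class_eqD)
  have "\<Phi> (\<lambda>_. 1) = Linf_class M (\<lambda>x \<xi>. \<xi>)"
    using ucp_mapsD(4)[OF \<Phi>] unfolding Linf_one by (simp add: cont_alg_def)
  then show "Linf_class M (rep (\<lambda>_. 1)) = Linf_class M (\<lambda>x \<xi>. \<xi>)"
    unfolding rep(2)[OF continuous_on_const] .
  show "rep (\<lambda>_. 1) \<in> Linf_fun M" by (rule rep(1)[OF continuous_on_const])
  show "(\<lambda>(x::'x) (\<xi>::'h). \<xi>) \<in> Linf_fun M" by (rule Linf_fun_const[OF sep bounded_op_id])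
qed

text \<open>A nonnegative function is \<open>\<surd>f \<surd>f\<close>, a positive \<open>1 \<times> 1\<close> matrix.\<close>

lemma rep_positive:
  fixes f :: "'a \<Rightarrow> real"
  assumes f: "continuous_on UNIV f" and pos: "\<And>a. 0 \<le> f a"
  shows "AE x in M. positive_op (rep (\<lambda>a. complex_of_real (f a)) x)"
proof -
  let ?f = "\<lambda>a. complex_of_real (f a)"
  have cf: "continuous_on UNIV ?f" using f by (intro continuous_intros)
  have "positive_matrix cont_alg 1 (\<lambda>i j. ?f)"
    unfolding positive_matrix_cont_iff
    by (rule exI[of _ "\<lambda>i j a. complex_of_real (sqrt (f a))"])
       (use f pos in \<open>auto intro!: continuous_intros simp flip: of_real_mult\<close>)
  then have "positive_matrix (Linf_alg M) 1 (\<lambda>i j. \<Phi> ?f)"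
    by (intro ucp_mapsD(5)[OF \<Phi>, of 1 "\<lambda>i j. ?f"]) (simp_all add: cont_carrier f)
  then obtain R where R: "R 0 0 \<in> Linf_fun M"
    "\<Phi> ?f = Linf_class M (\<lambda>x \<xi>. \<Sum>k<(1::nat). adjoint_op (R k 0 x) (R k 0 x \<xi>))"
    unfolding positive_matrix_Linf_iff[OF sep] by auto
  then have e: "Linf_class M (rep ?f) = Linf_class M (\<lambda>x. adjoint_op (R 0 0 x) \<circ> R 0 0 x)"
    unfolding rep(2)[OF cf] by (simp add: comp_def)
  have "AE x in M. rep ?f x = adjoint_op (R 0 0 x) \<circ> R 0 0 x"
    by (rule Linf_class_eqD[OF e rep(1)[OF cf] Linf_star_mult(2)[OF sep R(1) R(1)]])
  then show ?thesis
  proof eventually_elim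
    case (elim x)
    have b: "bounded_op (R 0 0 x)" using Linf_funD(1)[OF sep R(1)] by (simp add: space_M)
    have "cinner (rep ?f x \<xi>) \<xi> = complex_of_real ((norm (R 0 0 x \<xi>))\<^sup>2)" for \<xi>
      unfolding elim by (simp add: adjoint_op(4)[OF b] cinner_self)
    then show ?case using rep_bounded[OF cf, of x] by (intro positive_opI) auto
  qed
qed

abbreviation rrep :: "('a \<Rightarrow> real) \<Rightarrow> 'x \<Rightarrow> 'h \<Rightarrow> 'h"
  where "rrep f \<equiv> rep (\<lambda>a. complex_of_real (f a))"

lemma rrep_add:
  assumes "continuous_on UNIV f" "continuous_on UNIV g"
  shows "AE x in M. rrep (\<lambda>a. f a + g a) x = (\<lambda>\<xi>. rrep f x \<xi> + rrep g x \<xi>)"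
  unfolding of_real_add by (intro rep_add continuous_on_of_real assms)

lemma rrep_scale:
  assumes "continuous_on UNIV f"
  shows "AE x in M. rrep (\<lambda>a. c * f a) x = (\<lambda>\<xi>. scaleC (complex_of_real c) (rrep f x \<xi>))"
  unfolding of_real_mult by (intro rep_smult continuous_on_of_real assms)

text \<open>A representative depends continuously on \<open>f\<close> almost everywhere, by positivity at \<open>r \<plusminus> (f - g)\<close>; the null set
  is allowed to depend on both functions.\<close>

lemma rrep_bound:
  fixes f :: "'a \<Rightarrow> real"
  assumes f: "continuous_on UNIV f" and g: "continuous_on UNIV g" and b: "\<And>a. \<bar>f a - g a\<bar> \<le> r"
  shows "AE x in M. \<forall>\<xi>. cmod (cinner (rrep f x \<xi>) \<xi> - cinner (rrep g x \<xi>) \<xi>) \<le> r * (norm \<xi>)\<^sup>2"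
proof -
  have one: "continuous_on UNIV (\<lambda>_::'a. 1::real)" by (rule continuous_on_const)
  have c: "continuous_on UNIV (\<lambda>a. r * 1 + f a)" "continuous_on UNIV (\<lambda>a. r * 1 + g a)"
    "continuous_on UNIV (\<lambda>a. (- 1) * f a)" "continuous_on UNIV (\<lambda>a. (- 1) * g a)" "continuous_on UNIV (\<lambda>_::'a. r * 1)"
    by (intro continuous_intros f g)+
  have p: "AE x in M. positive_op (rrep (\<lambda>a. (r * 1 + f a) + (- 1) * g a) x)"
    "AE x in M. positive_op (rrep (\<lambda>a. (r * 1 + g a) + (- 1) * f a) x)"
    by (intro rep_positive continuous_on_add c; use b in \<open>simp add: abs_le_iff algebra_simps\<close>)+
  have o: "AE x in M. rrep (\<lambda>_. 1) x = (\<lambda>\<xi>. \<xi>)" using rep_one by simp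
  from p rrep_add[OF c(1,4)] rrep_add[OF c(2,3)] rrep_add[OF c(5) f] rrep_add[OF c(5) g]
    rrep_scale[OF f, of "- 1"] rrep_scale[OF g, of "- 1"] rrep_scale[OF one, of r] o
  show ?thesis
  proof eventually_elim
    case (elim x)
    show ?case
    proof
      fix \<xi>
      let ?d = "cinner (rrep f x \<xi>) \<xi> - cinner (rrep g x \<xi>) \<xi>"
      have e1: "cinner (rrep (\<lambda>a. (r * 1 + f a) + (- 1) * g a) x \<xi>) \<xi> = complex_of_real (r * (norm \<xi>)\<^sup>2) + ?d"
        unfolding elim(3) elim(5) elim(8) elim(9) elim(10)
        by (simp add: cinner_add_left cinner_diff_left cinner_scaleC_left cinner_self scaleC_minus_left cinner_minus_left)
      have e2: "cinner (rrep (\<lambda>a. (r * 1 + g a) + (- 1) * f a) x \<xi>) \<xi> = complex_of_real (r * (norm \<xi>)\<^sup>2) - ?d"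
        unfolding elim(4) elim(6) elim(7) elim(9) elim(10)
        by (simp add: cinner_add_left cinner_diff_left cinner_scaleC_left cinner_self scaleC_minus_left cinner_minus_left)
      have "Im ?d = 0" using arg_cong[OF positive_op_cinner(1)[OF elim(1), of \<xi>], of Im] unfolding e1 by simp
      moreover have "0 \<le> r * (norm \<xi>)\<^sup>2 + Re ?d" "0 \<le> r * (norm \<xi>)\<^sup>2 - Re ?d"
        using positive_op_cinner(2)[OF elim(1), of \<xi>] positive_op_cinner(2)[OF elim(2), of \<xi>] unfolding e1 e2 by simp_all
      ultimately show "cmod ?d \<le> r * (norm \<xi>)\<^sup>2" by (simp add: cmod_eq_Re abs_le_iff)
    qed
  qed
qed

text \<open>The countably many almost everywhere identities for functions in a countable dense set hold
  off one null set \<open>N\<close>.  On \<open>N\<close> the point mass at an arbitrary point is used instead.\<close>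

lemma channel_on_dense:
  fixes D :: "('a \<Rightarrow> real) set"
  assumes D: "countable D" "rational_dense D"
  shows "\<exists>E\<in>channels. \<forall>f\<in>D. AE x in M. \<forall>\<xi>. complex_of_real (integral\<^sup>L (qmeasure (E x) \<xi>) f) = cinner (rrep f x \<xi>) \<xi>"
proof -
  note dD = rational_denseD[OF D(2)]
  have "AE x in M. (\<forall>f\<in>D. \<forall>g\<in>D. rrep (\<lambda>a. f a + g a) x = (\<lambda>\<xi>. rrep f x \<xi> + rrep g x \<xi>))"
    unfolding AE_ball_countable[OF D(1)] by (blast intro: rrep_add dD(1))
  moreover have "AE x in M. (\<forall>q\<in>\<rat>. \<forall>f\<in>D. rrep (\<lambda>a. q * f a) x = (\<lambda>\<xi>. scaleC (complex_of_real q) (rrep f x \<xi>)))"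
    unfolding AE_ball_countable[OF countable_rat] AE_ball_countable[OF D(1)] by (blast intro: rrep_scale dD(1))
  moreover have "AE x in M. \<forall>f\<in>{f\<in>D. \<forall>a. 0 \<le> f a}. positive_op (rrep f x)"
  proof -
    have "countable {f\<in>D. \<forall>a. 0 \<le> f a}" using D(1) by (rule countable_subset[rotated]) blast
    then show ?thesis by (simp only: AE_ball_countable) (auto intro: rep_positive dD(1))
  qed
  moreover have "AE x in M. rrep (\<lambda>_. 1) x = (\<lambda>\<xi>. \<xi>)" using rep_one by simp
  ultimately have "AE x in M. (\<forall>f\<in>D. \<forall>g\<in>D. rrep (\<lambda>a. f a + g a) x = (\<lambda>\<xi>. rrep f x \<xi> + rrep g x \<xi>)) \<and>
     (\<forall>q\<in>\<rat>. \<forall>f\<in>D. rrep (\<lambda>a. q * f a) x = (\<lambda>\<xi>. scaleC (complex_of_real q) (rrep f x \<xi>))) \<and>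
     (\<forall>f\<in>{f\<in>D. \<forall>a. 0 \<le> f a}. positive_op (rrep f x)) \<and> rrep (\<lambda>_. 1) x = (\<lambda>\<xi>. \<xi>)"
    by eventually_elim blast
  then obtain N where good: "\<And>x. x \<in> space M - N \<Longrightarrow>
     (\<forall>f\<in>D. \<forall>g\<in>D. rrep (\<lambda>a. f a + g a) x = (\<lambda>\<xi>. rrep f x \<xi> + rrep g x \<xi>)) \<and>
     (\<forall>q\<in>\<rat>. \<forall>f\<in>D. rrep (\<lambda>a. q * f a) x = (\<lambda>\<xi>. scaleC (complex_of_real q) (rrep f x \<xi>))) \<and>
     (\<forall>f\<in>{f\<in>D. \<forall>a. 0 \<le> f a}. positive_op (rrep f x)) \<and> rrep (\<lambda>_. 1) x = (\<lambda>\<xi>. \<xi>)"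
    and N: "N \<in> null_sets M" by (rule AE_E3) blast
  have Nb: "N \<in> sets borel" using N borel by auto
  define T where "T x f = (if x \<in> N then (\<lambda>\<xi>. scaleC (complex_of_real (f undefined)) \<xi>) else rrep f x)" for x f
  have bnd: "bounded_op (T x f)" if "f \<in> D" for x f
    unfolding T_def using rep_bounded[OF continuous_on_of_real[OF dD(1)[OF that]]]
    by (auto intro: bounded_op_scaleC bounded_op_id)
  have "\<exists>E\<in>quantum_prob. \<forall>f\<in>D. \<forall>\<xi>. complex_of_real (integral\<^sup>L (qmeasure E \<xi>) f) = cinner (T x f \<xi>) \<xi>" for x
  proof (rule quantum_prob_from_dense[OF compact D(2)])
    have G: "x \<notin> N \<Longrightarrow> x \<in> space M - N" by (simp add: space_M)
    show "T x (\<lambda>a. f a + g a) \<xi> = T x f \<xi> + T x g \<xi>" if "f \<in> D" "g \<in> D" for f g \<xi>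
      unfolding T_def using good[OF G] that by (auto simp: scaleC_add_left)
    show "T x (\<lambda>a. q * f a) \<xi> = scaleC (complex_of_real q) (T x f \<xi>)" if "q \<in> \<rat>" "f \<in> D" for q f \<xi>
      unfolding T_def using good[OF G] that by (auto simp: scaleC_scaleC)
    show "T x (\<lambda>_. 1) \<xi> = \<xi>" for \<xi>
      unfolding T_def using good[OF G] by auto
    show "positive_op (T x f)" if f: "f \<in> D" and p: "\<And>a. 0 \<le> f a" for f
    proof (cases "x \<in> N")
      case True
      show ?thesis
        by (rule positive_opI[OF bnd[OF f]]) (use True p in \<open>auto simp: T_def cinner_scaleC_left cinner_self\<close>)
    next
      case False
      then show ?thesis using good[OF G[OF False]] f p unfolding T_def by auto
    qed
  qed (rule bnd)
  then obtain E where E: "\<And>x. E x \<in> quantum_prob"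
    and ET: "\<And>x f \<xi>. f \<in> D \<Longrightarrow> complex_of_real (integral\<^sup>L (qmeasure (E x) \<xi>) f) = cinner (T x f \<xi>) \<xi>" by metis
  have mD: "(\<lambda>x. integral\<^sup>L (qmeasure (E x) \<xi>) f) \<in> borel_measurable borel" if f: "f \<in> D" for f \<xi>
  proof -
    have "(\<lambda>x. cinner (rrep f x \<xi>) \<xi>) \<in> borel_measurable borel"
      using Linf_funD(2)[OF sep rep(1)[OF continuous_on_of_real[OF dD(1)[OF f]]]]
      unfolding measurable_cong_sets[OF borel refl] .
    then have "(\<lambda>x. if x \<in> N then complex_of_real (f undefined) * cinner \<xi> \<xi> else cinner (rrep f x \<xi>) \<xi>) \<in> borel_measurable borel"
      using Nb by (intro measurable_If_set) auto
    moreover have "(if x \<in> N then complex_of_real (f undefined) * cinner \<xi> \<xi> else cinner (rrep f x \<xi>) \<xi>) = cinner (T x f \<xi>) \<xi>" for x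
      by (simp add: T_def cinner_scaleC_left)
    ultimately have "(\<lambda>x. Re (cinner (T x f \<xi>) \<xi>)) \<in> borel_measurable borel" by simp
    then show ?thesis unfolding ET[OF f, symmetric] by simp
  qed
  have mC: "(\<lambda>x. integral\<^sup>L (qmeasure (E x) \<xi>) f) \<in> borel_measurable borel" if f: "continuous_on UNIV f" for f :: "'a \<Rightarrow> real" and \<xi>
  proof -
    have "\<forall>n. \<exists>d\<in>D. \<forall>a. \<bar>f a - d a\<bar> < 1 / real (Suc n)" using dD(6)[OF f] by simp
    then obtain d where d: "\<And>n. d n \<in> D" "\<And>n a. \<bar>f a - d n a\<bar> < 1 / real (Suc n)" by metis
    obtain K where K: "\<And>a. norm (f a) \<le> K" using compact_continuous_bounded[OF compact f] by blast
    have "(\<lambda>n. integral\<^sup>L (qmeasure (E x) \<xi>) (d n)) \<longlonglongrightarrow> integral\<^sup>L (qmeasure (E x) \<xi>) f" for x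
    proof (rule finite_borel_dominated[OF qmeasure(1)[OF E]])
      show "d n \<in> borel_measurable borel" for n by (rule borel_measurable_continuous_onI[OF dD(1)[OF d(1)]])
      show "norm (d n a) \<le> K + 1" for n a
      proof -
        have "1 / real (Suc n) \<le> 1" by simp
        then show ?thesis using d(2)[of a n] K[of a] unfolding real_norm_def by linarith
      qed
      show "(\<lambda>n. d n a) \<longlonglongrightarrow> f a" for a
      proof (rule LIM_zero_cancel, rule Lim_null_comparison)
        show "\<forall>\<^sub>F n in sequentially. norm (d n a - f a) \<le> 1 / real (Suc n)"
          using d(2)[of a] by (intro always_eventually allI) (simp add: abs_minus_commute less_imp_le)
        show "(\<lambda>n. 1 / real (Suc n)) \<longlonglongrightarrow> 0" using LIMSEQ_inverse_real_of_nat by (simp add: inverse_eq_divide)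
      qed
    qed
    then show ?thesis by (rule borel_measurable_LIMSEQ_metric[OF mD[OF d(1)]])
  qed
  have mA: "\<forall>\<xi>. (\<lambda>x. measure (qmeasure (E x) \<xi>) \<alpha>) \<in> borel_measurable borel" if "\<alpha> \<in> sets borel" for \<alpha>
    using that
  proof (induction rule: borel_dynkin_induct)
    case (basic U)
    obtain f :: "nat \<Rightarrow> 'a \<Rightarrow> real" where f: "\<And>n. continuous_on UNIV (f n)"
      and lim: "\<And>M. finite_borel_measure M \<Longrightarrow> (\<lambda>n. integral\<^sup>L M (f n)) \<longlonglongrightarrow> measure M U"
      by (rule open_indicator_limit[OF compact basic]) blast
    show ?case
      by (intro allI borel_measurable_LIMSEQ_metric[OF mC[OF f] lim[OF qmeasure(1)[OF E]]])
  next
    case (compl \<beta>)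
    have e: "measure (qmeasure (E x) \<xi>) (- \<beta>) = (norm \<xi>)\<^sup>2 - measure (qmeasure (E x) \<xi>) \<beta>" for x \<xi>
    proof -
      interpret finite_measure "qmeasure (E x) \<xi>" by (rule finite_borel_measureD[OF qmeasure(1)[OF E]])
      show ?thesis
        using finite_measure_compl[of \<beta>] compl(1) finite_borel_measureD(2,3)[OF qmeasure(1)[OF E], of x \<xi>] qmeasure(3)[OF E, of x \<xi>]
        by (simp add: Compl_eq_Diff_UNIV)
    qed
    show ?case unfolding e by (intro allI borel_measurable_diff borel_measurable_const compl(2)[rule_format])
  next
    case (union \<delta>)
    have l: "(\<lambda>n. \<Sum>i<n. measure (qmeasure (E x) \<xi>) (\<delta> i)) \<longlonglongrightarrow> measure (qmeasure (E x) \<xi>) (\<Union>i. \<delta> i)" for x \<xi>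
    proof -
      interpret finite_measure "qmeasure (E x) \<xi>" by (rule finite_borel_measureD[OF qmeasure(1)[OF E]])
      show ?thesis
        using finite_measure_UNION[of \<delta>] union(1,2) finite_borel_measureD(2)[OF qmeasure(1)[OF E], of x \<xi>] unfolding sums_def by simp
    qed
    show ?case
      by (intro allI borel_measurable_LIMSEQ_metric[OF _ l] borel_measurable_sum) (use union(3) in blast)
  qed
  have "E \<in> channels"
    unfolding channels_def
  proof (intro CollectI conjI allI ballI)
    show "E x \<in> quantum_prob" for x by (rule E)
    fix \<alpha> :: "'a set" and \<xi> \<eta> :: 'h assume \<alpha>: "\<alpha> \<in> sets borel"
    show "(\<lambda>x. cinner (E x \<alpha> \<xi>) \<eta>) \<in> borel_measurable borel"
      unfolding polarization[OF positive_op_bounded[OF quantum_probD(1)[OF E \<alpha>]], of _ \<xi> \<eta>] qmeasure(2)[OF E \<alpha>, symmetric]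
      by (intro borel_measurable_divide borel_measurable_sum borel_measurable_times borel_measurable_const
          measurable_compose[OF mA[OF \<alpha>, rule_format]] borel_measurable_continuous_onI continuous_on_of_real_id)
  qed
  moreover have "AE x in M. \<forall>\<xi>. complex_of_real (integral\<^sup>L (qmeasure (E x) \<xi>) f) = cinner (rrep f x \<xi>) \<xi>" if f: "f \<in> D" for f
    using AE_not_in[OF N] by eventually_elim (simp add: ET[OF f] T_def)
  ultimately show ?thesis by blast
qed

text \<open>The identity on the dense set extends to a given continuous function along a sequence, which costs
  countably many null sets; complex functions are split into real and imaginary parts.\<close>

lemma channel_of_ucp_exists:
  "\<exists>E\<in>channels. \<forall>f \<xi> \<eta>. continuous_on UNIV f \<longrightarrow> (AE x in M. cinner (rep f x \<xi>) \<eta> = qintegral (E x) f \<xi> \<eta>)"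
proof -
  obtain D :: "('a \<Rightarrow> real) set" where D: "countable D" "rational_dense D"
    using countable_rational_dense_exists[OF compact] by blast
  note dD = rational_denseD[OF D(2)]
  obtain E where E: "E \<in> channels"
    and ED: "\<And>f. f \<in> D \<Longrightarrow> AE x in M. \<forall>\<xi>. complex_of_real (integral\<^sup>L (qmeasure (E x) \<xi>) f) = cinner (rrep f x \<xi>) \<xi>"
    using channel_on_dense[OF D] by blast
  have Q: "E x \<in> quantum_prob" for x using E by (rule channelsD)
  have real: "AE x in M. \<forall>\<xi>. complex_of_real (integral\<^sup>L (qmeasure (E x) \<xi>) f) = cinner (rrep f x \<xi>) \<xi>"
    if f: "continuous_on UNIV f" for f
  proof -
    have "\<forall>n. \<exists>d\<in>D. \<forall>a. \<bar>f a - d a\<bar> < 1 / real (Suc n)" using dD(6)[OF f] by simp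
    then obtain d where d: "\<And>n. d n \<in> D" "\<And>n a. \<bar>f a - d n a\<bar> < 1 / real (Suc n)" by metis
    have "AE x in M. \<forall>n. (\<forall>\<xi>. complex_of_real (integral\<^sup>L (qmeasure (E x) \<xi>) (d n)) = cinner (rrep (d n) x \<xi>) \<xi>)"
      using ED[OF d(1)] by (simp add: AE_all_countable)
    moreover have "AE x in M. \<forall>n. (\<forall>\<xi>. cmod (cinner (rrep f x \<xi>) \<xi> - cinner (rrep (d n) x \<xi>) \<xi>) \<le> 1 / real (Suc n) * (norm \<xi>)\<^sup>2)"
      unfolding AE_all_countable by (intro allI rrep_bound f dD(1) d(1) less_imp_le d(2))
    ultimately show ?thesis
    proof eventually_elim
      case (elim x)
      show ?case
      proof
        fix \<xi> :: 'h
        have l0: "(\<lambda>n. 1 / real (Suc n) * (norm \<xi>)\<^sup>2) \<longlonglongrightarrow> 0"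
          using tendsto_mult_left_zero[OF LIMSEQ_inverse_real_of_nat, of "(norm \<xi>)\<^sup>2"] by (simp add: inverse_eq_divide)
        have diff: "\<bar>integral\<^sup>L (qmeasure (E x) \<xi>) f - integral\<^sup>L (qmeasure (E x) \<xi>) (d n)\<bar> \<le> 1 / real (Suc n) * (norm \<xi>)\<^sup>2" for n
        proof -
          note fm = qmeasure(1)[OF Q, of x \<xi>]
          interpret finite_measure "qmeasure (E x) \<xi>" by (rule finite_borel_measureD[OF fm])
          have i: "integrable (qmeasure (E x) \<xi>) g" if g: "continuous_on UNIV g" for g :: "'a \<Rightarrow> real"
          proof -
            obtain K where K: "\<And>a. norm (g a) \<le> K" using compact_continuous_bounded[OF compact g] by blast
            then show ?thesis by (rule finite_borel_integrable[OF fm borel_measurable_continuous_onI[OF g]])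
          qed
          have "\<bar>integral\<^sup>L (qmeasure (E x) \<xi>) f - integral\<^sup>L (qmeasure (E x) \<xi>) (d n)\<bar>
              = \<bar>integral\<^sup>L (qmeasure (E x) \<xi>) (\<lambda>a. f a - d n a)\<bar>"
            by (subst Bochner_Integration.integral_diff) (auto intro: i f dD(1) d(1))
          also have "\<dots> \<le> (\<integral>a. \<bar>f a - d n a\<bar> \<partial>qmeasure (E x) \<xi>)" by (rule integral_abs_bound)
          also have "\<dots> \<le> (\<integral>a. 1 / real (Suc n) \<partial>qmeasure (E x) \<xi>)"
            using d(2) by (intro integral_mono i continuous_intros f dD(1) d(1) less_imp_le)
          also have "\<dots> = 1 / real (Suc n) * (norm \<xi>)\<^sup>2"
            using qmeasure(3)[OF Q, of x \<xi>] finite_borel_measureD(3)[OF fm] by simp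
          finally show ?thesis .
        qed
        have "(\<lambda>n. integral\<^sup>L (qmeasure (E x) \<xi>) f - integral\<^sup>L (qmeasure (E x) \<xi>) (d n)) \<longlonglongrightarrow> 0"
          by (rule Lim_null_comparison[OF _ l0]) (use diff in simp)
        from tendsto_diff[OF tendsto_const this, of "integral\<^sup>L (qmeasure (E x) \<xi>) f"]
        have "(\<lambda>n. complex_of_real (integral\<^sup>L (qmeasure (E x) \<xi>) (d n))) \<longlonglongrightarrow> complex_of_real (integral\<^sup>L (qmeasure (E x) \<xi>) f)"
          by (intro tendsto_of_real) simp
        moreover have "(\<lambda>n. cinner (rrep f x \<xi>) \<xi> - cinner (rrep (d n) x \<xi>) \<xi>) \<longlonglongrightarrow> 0"
          by (rule Lim_null_comparison[OF _ l0]) (use elim(2) in simp)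
        from tendsto_diff[OF tendsto_const this, of "cinner (rrep f x \<xi>) \<xi>"]
        have "(\<lambda>n. cinner (rrep (d n) x \<xi>) \<xi>) \<longlonglongrightarrow> cinner (rrep f x \<xi>) \<xi>" by simp
        ultimately show "complex_of_real (integral\<^sup>L (qmeasure (E x) \<xi>) f) = cinner (rrep f x \<xi>) \<xi>"
          using elim(1) by (intro LIMSEQ_unique[of "\<lambda>n. cinner (rrep (d n) x \<xi>) \<xi>"]) simp_all
      qed
    qed
  qed
  have "AE x in M. cinner (rep f x \<xi>) \<eta> = qintegral (E x) f \<xi> \<eta>" if f: "continuous_on UNIV f" for f \<xi> \<eta>
  proof -
    define u v where "u a = Re (f a)" and "v a = Im (f a)" for a
    have uv: "continuous_on UNIV u" "continuous_on UNIV v" unfolding u_def v_def by (intro continuous_intros f)+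
    have cu: "continuous_on UNIV (\<lambda>a. complex_of_real (u a))" and cv: "continuous_on UNIV (\<lambda>a. complex_of_real (v a))"
      by (intro continuous_on_of_real uv)+
    have fe: "f = (\<lambda>a. complex_of_real (u a) + \<i> * complex_of_real (v a))"
      unfolding u_def v_def by (simp add: complex_eq[symmetric])
    have "AE x in M. rep f x = (\<lambda>\<xi>. rrep u x \<xi> + rep (\<lambda>a. \<i> * complex_of_real (v a)) x \<xi>)"
      by (subst fe) (intro rep_add cu continuous_on_mult_left cv)
    with real[OF uv(1)] real[OF uv(2)] rep_smult[OF cv, of \<i>] show ?thesis
    proof eventually_elim
      case (elim x)
      have diag: "cinner (rep f x \<zeta>) \<zeta> = integral\<^sup>L (qmeasure (E x) \<zeta>) f" for \<zeta>
      proof -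
        have "integral\<^sup>L (qmeasure (E x) \<zeta>) f = (\<integral>a. complex_of_real (u a) \<partial>qmeasure (E x) \<zeta>) + (\<integral>a. \<i> * complex_of_real (v a) \<partial>qmeasure (E x) \<zeta>)"
          by (subst fe) (intro Bochner_Integration.integral_add continuous_integrable_qmeasure[OF compact Q] cu continuous_on_mult_left cv)
        also have "\<dots> = complex_of_real (integral\<^sup>L (qmeasure (E x) \<zeta>) u) + \<i> * complex_of_real (integral\<^sup>L (qmeasure (E x) \<zeta>) v)"
          by simp
        also have "\<dots> = cinner (rep f x \<zeta>) \<zeta>"
          using elim(1,2) unfolding elim(4) elim(3) by (simp add: cinner_add_left cinner_scaleC_left)
        finally show ?thesis by simp
      qed
      show ?case
        unfolding polarization[OF rep_bounded[OF f], of x \<xi> \<eta>] qintegral_def diag ..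
    qed
  qed
  with E show ?thesis by blast
qed

end

section \<open>The correspondence\<close>

context
  fixes M :: "'x::topological_space measure"
    and E F :: "'x \<Rightarrow> 'a::{t2_space, second_countable_topology} set \<Rightarrow> 'h \<Rightarrow> 'h::complex_hilbert_space"
  assumes compact: "compact (UNIV :: 'a set)" and sep: "separable_space (euclidean :: 'h topology)"
    and E: "E \<in> channels" and F: "F \<in> channels"
begin

lemma channel_eq_imp_qintegral_eq:
  assumes eq: "\<And>\<alpha>. \<alpha> \<in> sets borel \<Longrightarrow> AE x in M. E x \<alpha> = F x \<alpha>" and f: "continuous_on UNIV f"
  shows "AE x in M. qintegral (E x) f \<xi> \<eta> = qintegral (F x) f \<xi> \<eta>"
proof -
  obtain K where K: "f \<in> borel_measurable borel" "\<And>a. cmod (f a) \<le> K"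
    using compact_continuous_borel_bounded[OF compact f] by blast
  obtain Z :: "nat \<Rightarrow> (nat \<Rightarrow> complex) set" and w T where T: "\<And>m. finite (Z m)" "\<And>m z. T m z \<in> sets borel"
    and l: "\<And>(E :: 'a set \<Rightarrow> 'h \<Rightarrow> 'h) \<xi> \<eta>. E \<in> quantum_prob \<Longrightarrow>
       (\<lambda>m. \<Sum>z\<in>Z m. w z * cinner (E (T m z) \<xi>) \<eta>) \<longlonglongrightarrow> qintegral E f \<xi> \<eta>"
    by (rule qintegral_approx[OF K, where 'h = 'h]) blast
  have "AE x in M. \<forall>m. \<forall>z\<in>Z m. E x (T m z) = F x (T m z)"
    unfolding AE_all_countable
    using T(1) eq[OF T(2)] by (auto simp: AE_ball_countable countable_finite)
  then show ?thesis
  proof eventually_elim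
    case (elim x)
    then have "(\<Sum>z\<in>Z m. w z * cinner (E x (T m z) \<xi>) \<eta>) = (\<Sum>z\<in>Z m. w z * cinner (F x (T m z) \<xi>) \<eta>)" for m
      by (intro sum.cong) auto
    then show ?case
      using l[OF channelsD(1)[OF E], of x \<xi> \<eta>] l[OF channelsD(1)[OF F], of x \<xi> \<eta>] by (simp add: LIMSEQ_unique)
  qed
qed

text \<open>Here the exceptional null set depends on \<open>\<alpha>\<close>, so that the induction over Borel sets can be run
  on almost everywhere statements.\<close>

lemma qintegral_eq_imp_channel_eq:
  assumes eq: "\<And>f \<xi>. continuous_on UNIV f \<Longrightarrow> AE x in M. qintegral (E x) f \<xi> \<xi> = qintegral (F x) f \<xi> \<xi>"
    and \<alpha>: "\<alpha> \<in> sets borel"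
  shows "AE x in M. E x \<alpha> = F x \<alpha>"
proof -
  note QE = channelsD(1)[OF E] and QF = channelsD(1)[OF F]
  have int: "AE x in M. integral\<^sup>L (qmeasure (E x) \<xi>) f = integral\<^sup>L (qmeasure (F x) \<xi>) f"
    if f: "continuous_on UNIV f" for f :: "'a \<Rightarrow> real" and \<xi>
  proof -
    have cf: "continuous_on UNIV (\<lambda>a. complex_of_real (f a))" using f by (rule continuous_on_of_real)
    obtain K where K: "(\<lambda>a. complex_of_real (f a)) \<in> borel_measurable borel" "\<And>a. cmod (complex_of_real (f a)) \<le> K"
      using compact_continuous_borel_bounded[OF compact cf] by blast
    show ?thesis
      using eq[OF cf, of \<xi>]
      unfolding qintegral_sesquilinear(5)[OF QE K] qintegral_sesquilinear(5)[OF QF K] by simp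
  qed
  have meas: "\<forall>\<xi>. AE x in M. measure (qmeasure (E x) \<xi>) \<alpha> = measure (qmeasure (F x) \<xi>) \<alpha>"
    using \<alpha>
  proof (induction rule: borel_dynkin_induct)
    case (basic U)
    obtain f :: "nat \<Rightarrow> 'a \<Rightarrow> real" where f: "\<And>n. continuous_on UNIV (f n)"
      and lim: "\<And>M. finite_borel_measure M \<Longrightarrow> (\<lambda>n. integral\<^sup>L M (f n)) \<longlonglongrightarrow> measure M U"
      by (rule open_indicator_limit[OF compact basic]) blast
    show ?case
    proof
      fix \<xi>
      have "AE x in M. \<forall>n. integral\<^sup>L (qmeasure (E x) \<xi>) (f n) = integral\<^sup>L (qmeasure (F x) \<xi>) (f n)"
        unfolding AE_all_countable using int[OF f] by blast
      then show "AE x in M. measure (qmeasure (E x) \<xi>) U = measure (qmeasure (F x) \<xi>) U"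
      proof eventually_elim
        case (elim x)
        show ?case
          by (rule LIMSEQ_unique[OF lim[OF qmeasure(1)[OF QE]]])
             (use lim[OF qmeasure(1)[OF QF], of x \<xi>] elim in simp)
      qed
    qed
  next
    case (compl \<beta>)
    have "measure (qmeasure G \<xi>) (- \<beta>) = (norm \<xi>)\<^sup>2 - measure (qmeasure G \<xi>) \<beta>" if G: "G \<in> quantum_prob" for G :: "'a set \<Rightarrow> 'h \<Rightarrow> 'h" and \<xi>
    proof -
      interpret finite_measure "qmeasure G \<xi>" by (rule finite_borel_measureD[OF qmeasure(1)[OF G]])
      show ?thesis
        using finite_measure_compl[of \<beta>] compl(1) finite_borel_measureD(2,3)[OF qmeasure(1)[OF G], of \<xi>] qmeasure(3)[OF G, of \<xi>]
        by (simp add: Compl_eq_Diff_UNIV)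
    qed
    then show ?case using compl(2) QE QF by simp
  next
    case (union \<delta>)
    have l: "measure (qmeasure G \<xi>) (\<Union>i. \<delta> i) = (\<Sum>i. measure (qmeasure G \<xi>) (\<delta> i))" if G: "G \<in> quantum_prob" for G :: "'a set \<Rightarrow> 'h \<Rightarrow> 'h" and \<xi>
    proof -
      interpret finite_measure "qmeasure G \<xi>" by (rule finite_borel_measureD[OF qmeasure(1)[OF G]])
      show ?thesis
        using finite_measure_UNION[of \<delta>] union(1,2) finite_borel_measureD(2)[OF qmeasure(1)[OF G], of \<xi>] by (simp add: sums_iff)
    qed
    show ?case
    proof
      fix \<xi>
      have "AE x in M. \<forall>i. measure (qmeasure (E x) \<xi>) (\<delta> i) = measure (qmeasure (F x) \<xi>) (\<delta> i)"
        unfolding AE_all_countable using union(3) by blast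
      then show "AE x in M. measure (qmeasure (E x) \<xi>) (\<Union>i. \<delta> i) = measure (qmeasure (F x) \<xi>) (\<Union>i. \<delta> i)"
        by eventually_elim (simp add: l QE QF)
    qed
  qed
  show ?thesis
  proof (rule AE_bounded_op_eqI[OF sep])
    show "bounded_op (E x \<alpha>)" "bounded_op (F x \<alpha>)" for x
      using quantum_probD(1)[OF QE \<alpha>] quantum_probD(1)[OF QF \<alpha>] by (auto intro: positive_op_bounded)
    fix \<xi> \<eta>
    have "AE x in M. \<forall>k::nat. measure (qmeasure (E x) (\<xi> + scaleC (\<i> ^ k) \<eta>)) \<alpha> = measure (qmeasure (F x) (\<xi> + scaleC (\<i> ^ k) \<eta>)) \<alpha>"
      unfolding AE_all_countable using meas by blast
    then show "AE x in M. cinner (E x \<alpha> \<xi>) \<eta> = cinner (F x \<alpha> \<xi>) \<eta>"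
    proof eventually_elim
      case (elim x)
      show ?case
        unfolding polarization[OF positive_op_bounded[OF quantum_probD(1)[OF QE \<alpha>]], of x \<xi> \<eta>]
          polarization[OF positive_op_bounded[OF quantum_probD(1)[OF QF \<alpha>]], of x \<xi> \<eta>]
          qmeasure(2)[OF QE \<alpha>, symmetric] qmeasure(2)[OF QF \<alpha>, symmetric] elim[rule_format] ..
    qed
  qed
qed

end

lemma equiv_channel_rel: "equiv channels (channel_rel M)"
proof (rule equivI)
  show "channel_rel M \<subseteq> channels \<times> channels" unfolding channel_rel_def by auto
  show "refl_on channels (channel_rel M)" unfolding channel_rel_def refl_on_def by auto
  show "sym (channel_rel M)" unfolding channel_rel_def sym_def by (auto elim!: eventually_mono)
  show "trans (channel_rel M)"
  proof (rule transI)
    fix E F G assume EF: "(E, F) \<in> channel_rel M" and FG: "(F, G) \<in> channel_rel M"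
    have "AE x in M. E x \<alpha> = G x \<alpha>" if "\<alpha> \<in> sets borel" for \<alpha>
    proof -
      have "AE x in M. E x \<alpha> = F x \<alpha>" "AE x in M. F x \<alpha> = G x \<alpha>"
        using EF FG that unfolding channel_rel_def by auto
      then show ?thesis by eventually_elim simp
    qed
    then show "(E, G) \<in> channel_rel M" using EF FG unfolding channel_rel_def by auto
  qed
qed

context
  fixes M :: "'x::topological_space measure"
  assumes compact: "compact (UNIV :: 'a::{t2_space, second_countable_topology} set)"
    and sep: "separable_space (euclidean :: 'h::complex_hilbert_space topology)"
    and borel: "sets M = sets borel"
begin

text \<open>Since the integrals of equivalent channels agree almost everywhere, one representative of each class
  suffices.\<close>

lemma represents_class_iff:
  fixes E :: "'x \<Rightarrow> 'a set \<Rightarrow> 'h \<Rightarrow> 'h" and \<Phi> :: "('a \<Rightarrow> complex) \<Rightarrow> ('x \<Rightarrow> 'h \<Rightarrow> 'h) set"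
  assumes E: "E \<in> channels"
    and g: "\<And>f. continuous_on UNIV f \<Longrightarrow> g f \<in> Linf_fun M" "\<And>f. continuous_on UNIV f \<Longrightarrow> \<Phi> f = Linf_class M (g f)"
  shows "represents M (channel_rel M `` {E}) \<Phi> \<longleftrightarrow>
    (\<forall>f \<xi> \<eta>. continuous_on UNIV f \<longrightarrow> (AE x in M. cinner (g f x \<xi>) \<eta> = qintegral (E x) f \<xi> \<eta>))"
proof -
  have val: "cmeasure_integral (\<lambda>\<alpha>. cinner (F x \<alpha> \<xi>) \<eta>) f = qintegral (F x) f \<xi> \<eta>"
    if F: "F \<in> channels" and f: "continuous_on UNIV f" for F :: "'x \<Rightarrow> 'a set \<Rightarrow> 'h \<Rightarrow> 'h" and f x \<xi> \<eta>
  proof -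
    obtain K where "f \<in> borel_measurable borel" "\<And>a. cmod (f a) \<le> K"
      using compact_continuous_borel_bounded[OF compact f] by blast
    then show ?thesis by (rule cmeasure_integral_quantum[OF channelsD(1)[OF F]])
  qed
  show ?thesis
  proof
    assume r: "represents M (channel_rel M `` {E}) \<Phi>"
    have EE: "E \<in> channel_rel M `` {E}" using E by (simp add: channel_rel_def)
    show "\<forall>f \<xi> \<eta>. continuous_on UNIV f \<longrightarrow> (AE x in M. cinner (g f x \<xi>) \<eta> = qintegral (E x) f \<xi> \<eta>)"
    proof (intro allI impI)
      fix f :: "'a \<Rightarrow> complex" and \<xi> \<eta> assume f: "continuous_on UNIV f"
      have "g f \<in> \<Phi> f" unfolding g(2)[OF f] by (rule Linf_class_self[OF g(1)[OF f]])
      then have "AE x in M. cinner (g f x \<xi>) \<eta> = cmeasure_integral (\<lambda>\<alpha>. cinner (E x \<alpha> \<xi>) \<eta>) f"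
        using r f EE unfolding represents_def by (simp add: cont_carrier)
      then show "AE x in M. cinner (g f x \<xi>) \<eta> = qintegral (E x) f \<xi> \<eta>" unfolding val[OF E f] .
    qed
  next
    assume a: "\<forall>f \<xi> \<eta>. continuous_on UNIV f \<longrightarrow> (AE x in M. cinner (g f x \<xi>) \<eta> = qintegral (E x) f \<xi> \<eta>)"
    show "represents M (channel_rel M `` {E}) \<Phi>"
      unfolding represents_def
    proof (intro ballI allI)
      fix f :: "'a \<Rightarrow> complex" and \<xi> \<eta> F p
      assume "f \<in> carrier cont_alg" and F: "F \<in> channel_rel M `` {E}" and p: "p \<in> \<Phi> f"
      then have f: "continuous_on UNIV f" by (simp add: cont_carrier)
      have Fc: "F \<in> channels" and EF: "\<And>\<alpha>. \<alpha> \<in> sets borel \<Longrightarrow> AE x in M. E x \<alpha> = F x \<alpha>"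
        using F unfolding channel_rel_def by auto
      have "AE x in M. p x = g f x" using p unfolding g(2)[OF f] in_Linf_class[OF g(1)[OF f]] by blast
      moreover have "AE x in M. cinner (g f x \<xi>) \<eta> = qintegral (E x) f \<xi> \<eta>" using a f by blast
      moreover have "AE x in M. qintegral (E x) f \<xi> \<eta> = qintegral (F x) f \<xi> \<eta>"
        by (rule channel_eq_imp_qintegral_eq[OF compact sep E Fc EF f])
      ultimately show "AE x in M. cinner (p x \<xi>) \<eta> = cmeasure_integral (\<lambda>\<alpha>. cinner (F x \<alpha> \<xi>) \<eta>) f"
        unfolding val[OF Fc f] by eventually_elim simp
    qed
  qed
qed

lemma represents_rep_iff:
  fixes E :: "'x \<Rightarrow> 'a set \<Rightarrow> 'h \<Rightarrow> 'h"
  assumes E: "E \<in> channels" and \<Phi>: "\<Phi> \<in> ucp_maps cont_alg (Linf_alg M)"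
  shows "represents M (channel_rel M `` {E}) \<Phi> \<longleftrightarrow>
    (\<forall>f \<xi> \<eta>. continuous_on UNIV f \<longrightarrow> (AE x in M. cinner (rep M \<Phi> f x \<xi>) \<eta> = qintegral (E x) f \<xi> \<eta>))"
  by (rule represents_class_iff[OF E]) (rule rep[OF compact sep borel \<Phi>], assumption)+

lemma channel_classesE:
  assumes "D \<in> channel_classes M"
  obtains E where "E \<in> channels" "D = channel_rel M `` {E}"
  using assms unfolding channel_classes_def by (rule quotientE)

lemma represented_by_ucp:
  assumes D: "(D :: ('x \<Rightarrow> 'a set \<Rightarrow> 'h \<Rightarrow> 'h) set) \<in> channel_classes M"
  shows "\<exists>\<Phi>\<in>ucp_maps cont_alg (Linf_alg M). represents M D \<Phi>"
proof -
  obtain E where E: "E \<in> channels" "D = channel_rel M `` {E}" using channel_classesE[OF D] .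
  have "represents M D (ucp_of_channel M E)"
    unfolding E(2)
    by (subst represents_class_iff[OF E(1) qop_Linf[OF compact sep borel E(1)] ucp_of_channel_value[OF compact sep borel E(1)]])
       (simp_all add: qop_continuous(2)[OF compact channelsD(1)[OF E(1)]])
  then show ?thesis using ucp_of_channel_ucp[OF compact sep borel E(1)] by blast
qed

lemma represented_ucp_unique:
  assumes D: "(D :: ('x \<Rightarrow> 'a set \<Rightarrow> 'h \<Rightarrow> 'h) set) \<in> channel_classes M"
    and \<Phi>: "\<Phi> \<in> ucp_maps cont_alg (Linf_alg M)" "represents M D \<Phi>"
    and \<Psi>: "\<Psi> \<in> ucp_maps cont_alg (Linf_alg M)" "represents M D \<Psi>"
  shows "\<Phi> = \<Psi>"
proof (rule PiE_ext[OF ucp_mapsD(1)[OF \<Phi>(1)] ucp_mapsD(1)[OF \<Psi>(1)]])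
  obtain E where E: "E \<in> channels" "D = channel_rel M `` {E}" using channel_classesE[OF D] .
  note r\<Phi> = rep[OF compact sep borel \<Phi>(1)] and r\<Psi> = rep[OF compact sep borel \<Psi>(1)]
  fix f :: "'a \<Rightarrow> complex" assume "f \<in> carrier cont_alg"
  then have f: "continuous_on UNIV f" by (simp add: cont_carrier)
  have sp: "space M = UNIV" using sets_eq_imp_space_eq[OF borel] by simp
  have "AE x in M. rep M \<Phi> f x = rep M \<Psi> f x"
  proof (rule AE_bounded_op_eqI[OF sep])
    fix \<xi> \<eta>
    have "AE x in M. cinner (rep M \<Phi> f x \<xi>) \<eta> = qintegral (E x) f \<xi> \<eta>"
      using \<Phi>(2) f unfolding E(2) represents_rep_iff[OF E(1) \<Phi>(1)] by blast
    moreover have "AE x in M. cinner (rep M \<Psi> f x \<xi>) \<eta> = qintegral (E x) f \<xi> \<eta>"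
      using \<Psi>(2) f unfolding E(2) represents_rep_iff[OF E(1) \<Psi>(1)] by blast
    ultimately show "AE x in M. cinner (rep M \<Phi> f x \<xi>) \<eta> = cinner (rep M \<Psi> f x \<xi>) \<eta>"
      by eventually_elim simp
  qed (rule Linf_funD(1)[OF sep r\<Phi>(1)[OF f]] Linf_funD(1)[OF sep r\<Psi>(1)[OF f]]; assumption)+
  then show "\<Phi> f = \<Psi> f"
    unfolding r\<Phi>(2)[OF f] r\<Psi>(2)[OF f] by (rule Linf_class_eqI[OF r\<Phi>(1)[OF f] r\<Psi>(1)[OF f]])
qed

lemma channel_map_eq_iff:
  assumes D: "(D :: ('x \<Rightarrow> 'a set \<Rightarrow> 'h \<Rightarrow> 'h) set) \<in> channel_classes M"
    and \<Phi>: "\<Phi> \<in> ucp_maps cont_alg (Linf_alg M)"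
  shows "\<Phi> = channel_map M D \<longleftrightarrow> represents M D \<Phi>"
proof -
  obtain \<Psi> where \<Psi>: "\<Psi> \<in> ucp_maps cont_alg (Linf_alg M)" "represents M D \<Psi>"
    using represented_by_ucp[OF D] by blast
  have "channel_map M D = \<Psi>"
    unfolding channel_map_def by (rule the_equality) (use \<Psi> represented_ucp_unique[OF D] in blast)+
  then show ?thesis using \<Psi> \<Phi> represented_ucp_unique[OF D] by blast
qed

lemma represented_class_unique_exists:
  assumes \<Phi>: "\<Phi> \<in> ucp_maps (cont_alg :: ('a \<Rightarrow> complex) star_algebra) (Linf_alg M :: ('x \<Rightarrow> 'h \<Rightarrow> 'h) set star_algebra)"
  shows "\<exists>!D. D \<in> channel_classes M \<and> represents M D \<Phi>"
proof -
  obtain E where E: "E \<in> channels"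
    and rE: "\<And>f \<xi> \<eta>. continuous_on UNIV f \<Longrightarrow> AE x in M. cinner (rep M \<Phi> f x \<xi>) \<eta> = qintegral (E x) f \<xi> \<eta>"
    using channel_of_ucp_exists[OF compact sep borel \<Phi>] by blast
  show ?thesis
  proof (rule ex1I[of _ "channel_rel M `` {E}"])
    show "channel_rel M `` {E} \<in> channel_classes M \<and> represents M (channel_rel M `` {E}) \<Phi>"
      using rE E unfolding represents_rep_iff[OF E \<Phi>] channel_classes_def by (auto intro: quotientI)
  next
    fix D assume D: "D \<in> channel_classes M \<and> represents M D \<Phi>"
    then obtain F where F: "F \<in> channels" "D = channel_rel M `` {F}" using channel_classesE by blast
    have rF: "AE x in M. cinner (rep M \<Phi> f x \<xi>) \<eta> = qintegral (F x) f \<xi> \<eta>" if "continuous_on UNIV f" for f \<xi> \<eta>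
      using D that unfolding F(2) represents_rep_iff[OF F(1) \<Phi>] by blast
    have eq: "AE x in M. qintegral (F x) f \<xi> \<xi> = qintegral (E x) f \<xi> \<xi>" if f: "continuous_on UNIV f" for f \<xi>
      using rE[OF f, of \<xi> \<xi>] rF[OF f, of \<xi> \<xi>] by eventually_elim simp
    have "(F, E) \<in> channel_rel M"
      unfolding channel_rel_def using E F(1) qintegral_eq_imp_channel_eq[OF compact sep F(1) E eq] by blast
    then show "D = channel_rel M `` {E}"
      unfolding F(2) by (rule equiv_class_eq[OF equiv_channel_rel])
  qed
qed

end

theorem theorem3p11:
  fixes \<mu> :: "'x::t2_space measure"
  assumes compact_A: "compact (UNIV :: 'a::{t2_space, second_countable_topology} set)"
    and compact_X: "compact (UNIV :: 'x set)"
    and separable_H: "separable_space (euclidean :: 'h::complex_hilbert_space topology)"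
    and prob: "prob_space \<mu>"
    and borel: "sets \<mu> = sets borel"
  shows
    "(\<forall>D \<in> (channel_classes \<mu> :: ('x \<Rightarrow> 'a set \<Rightarrow> 'h \<Rightarrow> 'h) set set).
        \<exists>\<Phi> \<in> ucp_maps cont_alg (Linf_alg \<mu>). represents \<mu> D \<Phi>) \<and>
     (\<forall>\<Phi> \<in> ucp_maps (cont_alg :: ('a \<Rightarrow> complex) star_algebra)
                   (Linf_alg \<mu> :: ('x \<Rightarrow> 'h \<Rightarrow> 'h) set star_algebra).
        \<exists>!D. D \<in> channel_classes \<mu> \<and> \<Phi> = channel_map \<mu> D)"
proof (intro conjI ballI)
  fix D :: "('x \<Rightarrow> 'a set \<Rightarrow> 'h \<Rightarrow> 'h) set" assume "D \<in> channel_classes \<mu>"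
  then show "\<exists>\<Phi> \<in> ucp_maps cont_alg (Linf_alg \<mu>). represents \<mu> D \<Phi>"
    by (rule represented_by_ucp[OF compact_A separable_H borel])
next
  fix \<Phi> :: "('a \<Rightarrow> complex) \<Rightarrow> ('x \<Rightarrow> 'h \<Rightarrow> 'h) set"
  assume \<Phi>: "\<Phi> \<in> ucp_maps cont_alg (Linf_alg \<mu>)"
  have "(D \<in> channel_classes \<mu> \<and> \<Phi> = channel_map \<mu> D) \<longleftrightarrow> (D \<in> channel_classes \<mu> \<and> represents \<mu> D \<Phi>)" for D
    using channel_map_eq_iff[OF compact_A separable_H borel _ \<Phi>] by blast
  then show "\<exists>!D. D \<in> channel_classes \<mu> \<and> \<Phi> = channel_map \<mu> D"
    using represented_class_unique_exists[OF compact_A separable_H borel \<Phi>] by simp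
qed

end
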